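(* Consider the two-point bandit game with tree-compatible losses described in the context, with scales $\sigma_1\ge\dots\ge\sigma_L>0$. Let $\delta=(\delta_1,\dots,\delta_L)$ be a probability distribution on $\{1,\dots,L\}$ with all $\delta_j>0$. Let the learner run the following algorithm: $p_1=\arg\min_{p\in\Delta_K}\psi_1(p)$, and for each $t\ge1$: (1) sample $A_{t,1}\sim p_t$; independently sample $j_t\sim\delta$; sample $A_{t,2}$ from $p_t$ conditioned on $A_{t,2}\sim_{j_t-1}A_{t,1}$; (2) play $A_{t,1},A_{t,2}$ and for all $a\in\mathcal A$ set $$z_t(a)=\mathbf 1\{a\sim_{j_t}A_{t,1}\}\frac{y_t(A_{t,1})-y_t(A_{t,2})+\sigma_{j_t}}{\delta_{j_t}\,p_t[\mathrm{anc}_{j_t}(A_{t,1})]};$$ (3) set $p_{t+1}=\arg\min_{p\in\Delta_K}\big\langle\sum_{s\le t}z_s,p\big\rangle+\psi_{t+1}(p)$; where $$\psi_t(p)=2\sqrt6\sum_{j=1}^L\frac{\sigma_j}{\sqrt{\delta_j}}\sqrt{\max\{t,6/\delta_j\}}\sum_{v\in V_j}\big(p[v]-\sqrt{p[v]}\big).$$ For a positive sequence $r=(r_j)_{j=1}^L$ let $K_{\mathrm{eff}}(r)=\big(\sum_{j=1}^L r_j\sqrt{|V_j|}\big)^2$, and write $\sigma/\delta=(\sigma_j/\delta_j)_j$, $\sigma/\sqrt\delta=(\sigma_j/\sqrt{\delta_j})_j$. Then for every $T\ge1$, $$\mathrm{Reg}^{(2)}_T\le18\sqrt{K_{\mathrm{eff}}(\sigma/\delta)}+8\sqrt6\,\sqrt{K_{\mathrm{eff}}(\sigma/\sqrt\delta)\,T}.$$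 Moreover, suppose there exists $\Delta\in\mathbb R_+^K$ with $|\{a\in\mathcal A:\Delta(a)=0\}|\le1$ such that $\mathrm{Reg}^{(2)}_T\ge\mathbb E\sum_{t=1}^T\frac12\big(\Delta(A_{t,1})+\Delta(A_{t,2})\big)$ holds for any algorithm. Put $$\Gamma(j,\Delta)=\sum_{v\in V_j:\ \min_{a\succeq v}\Delta(a)\ne0}\frac1{\min_{a\succeq v}\Delta(a)},\qquad K^{\mathrm{sto}}_{\mathrm{eff}}(r)=\Big(\sum_{j=1}^L r_j\sqrt{\Gamma(j,\Delta)}\Big)^2,$$ where $a\succeq v$ ranges over leaves $a\in\mathcal A$ descending from $v$. Then $$\mathrm{Reg}^{(2)}_T\le36\sqrt{K_{\mathrm{eff}}(\sigma/\delta)}+96\,K^{\mathrm{sto}}_{\mathrm{eff}}(\sigma/\sqrt\delta)\,\ln(eT).$$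
   Context: Tree. $\mathcal A$ is a finite set of $K$ actions, the leaf set of a rooted tree of depth $L\ge1$ all of whose leaves are at depth $L$. $V_j$ is the set of nodes at depth $j$ ($V_0$ contains only the root, $V_L=\mathcal A$). $v\preceq w$ (or $w\succeq v$) means $v$ is an ancestor of $w$; every node is its own ancestor. $\mathrm{anc}_j(w)$ is the unique ancestor of $w$ at depth $j$, and $a\sim_jb$ means $\mathrm{anc}_j(a)=\mathrm{anc}_j(b)$. $\Delta_K$ is the simplex of probability vectors indexed by $\mathcal A$; for $x\in\mathbb R^K$, $x[v]=\sum_{a\in\mathcal A:\,v\preceq a}x(a)$. The similarity is $s(a,b)=1+\max\{j\in\{0,\dots,L\}:a\sim_jb\}$. Game. At each round $t$ the environment secretly draws $y_t:\mathcal A\to\mathbb R$ that is tree-compatible: $|y_t(a)-y_t(b)|\le\sigma_{s(a,b)}$ for all $a,b\in\mathcal A$, with $\sigma_{L+1}=0$. The learner plays two actions $A_{t,1},A_{t,2}\in\mathcal A$ (possibly equal), observes $y_t(A_{t,1})$ and $y_t(A_{t,2})$, and incurs their average. $y_t$ may depend on everything up to round $t-1$, but is independent of the learner's actions at round $t$ or later, conditionally on the events up to the end of round $t-1$. Losses are integrable so that all expectations below are defined. The sampling statements in the algorithm describe conditional laws given the past. The regret is $\mathrm{Reg}^{(2)}_T=\mathbb E\big[\sum_{t=1}^T\frac12(y_t(A_{t,1})+y_t(A_{t,2}))\big]-\min_{a\in\mathcal A}\mathbb E\big[\sum_{t=1}^Ty_t(a)\big]$. *)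

theory Defs
  imports "HOL-Probability.Probability"
begin

section \<open>Rooted trees with all leaves at the same depth\<close>

text \<open>The nodes of the tree are all elements of the finite type \<open>'v\<close>; the root is its own parent.\<close>

record 'v rooted_tree =
  tree_root :: 'v
  tree_parent :: "'v \<Rightarrow> 'v"

definition ancestor :: "'v rooted_tree \<Rightarrow> 'v \<Rightarrow> 'v \<Rightarrow> bool" where
  "ancestor \<T> v w \<longleftrightarrow> (\<exists>n. (tree_parent \<T> ^^ n) w = v)"

definition depth :: "'v rooted_tree \<Rightarrow> 'v \<Rightarrow> nat" where
  "depth \<T> v = (LEAST n. (tree_parent \<T> ^^ n) v = tree_root \<T>)"

definition level :: "'v rooted_tree \<Rightarrow> nat \<Rightarrow> 'v set" where
  "level \<T> j = {v. depth \<T> v = j}"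

definition leaves :: "'v rooted_tree \<Rightarrow> 'v set" where
  "leaves \<T> = {v. \<forall>w. w \<noteq> tree_root \<T> \<longrightarrow> tree_parent \<T> w \<noteq> v}"

definition uniform_tree :: "'v::finite rooted_tree \<Rightarrow> nat \<Rightarrow> bool" where
  "uniform_tree \<T> L \<longleftrightarrow>
     tree_parent \<T> (tree_root \<T>) = tree_root \<T> \<and>
     (\<forall>v. ancestor \<T> (tree_root \<T>) v) \<and>
     1 \<le> L \<and> (\<forall>v\<in>leaves \<T>. depth \<T> v = L)"

definition anc :: "'v rooted_tree \<Rightarrow> nat \<Rightarrow> 'v \<Rightarrow> 'v" where
  "anc \<T> j w = (THE v. v \<in> level \<T> j \<and> ancestor \<T> v w)"

definition same_anc :: "'v rooted_tree \<Rightarrow> nat \<Rightarrow> 'v \<Rightarrow> 'v \<Rightarrow> bool" where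
  "same_anc \<T> j a b \<longleftrightarrow> anc \<T> j a = anc \<T> j b"

definition similarity :: "'v rooted_tree \<Rightarrow> nat \<Rightarrow> 'v \<Rightarrow> 'v \<Rightarrow> nat" where
  "similarity \<T> L a b = 1 + Max {j \<in> {0..L}. same_anc \<T> j a b}"

definition leaves_below :: "'v rooted_tree \<Rightarrow> 'v \<Rightarrow> 'v set" where
  "leaves_below \<T> v = {a \<in> leaves \<T>. ancestor \<T> v a}"

definition mass :: "'v rooted_tree \<Rightarrow> ('v \<Rightarrow> real) \<Rightarrow> 'v \<Rightarrow> real" where
  "mass \<T> x v = (\<Sum>a\<in>leaves_below \<T> v. x a)"

definition tree_compatible :: "'v rooted_tree \<Rightarrow> nat \<Rightarrow> (nat \<Rightarrow> real) \<Rightarrow> ('v \<Rightarrow> real) \<Rightarrow> bool" where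
  "tree_compatible \<T> L \<sigma> y \<longleftrightarrow>
     (\<forall>a\<in>leaves \<T>. \<forall>b\<in>leaves \<T>. \<bar>y a - y b\<bar> \<le> \<sigma> (similarity \<T> L a b))"

section \<open>The two-point bandit game\<close>

text \<open>
  A round consists of a loss function and a move \<open>(a, b, k)\<close>: the two actions played and a
  private signal \<open>k\<close> of the learner (its internal randomness in that round). Rounds are numbered
  from 0 here, so index \<open>n\<close> stands for round \<open>n + 1\<close>.
\<close>

type_synonym 'v move = "'v \<times> 'v \<times> nat"
type_synonym 'v round = "('v \<Rightarrow> real) \<times> 'v move"
type_synonym 'v observation = "(real \<times> real) \<times> 'v move"
type_synonym 'v environment = "nat \<Rightarrow> (nat \<Rightarrow> 'v round) \<Rightarrow> ('v \<Rightarrow> real) measure"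
type_synonym 'v algorithm = "nat \<Rightarrow> (nat \<Rightarrow> 'v observation) \<Rightarrow> 'v move pmf"

definition loss_space :: "'v set \<Rightarrow> ('v \<Rightarrow> real) measure" where
  "loss_space A = (\<Pi>\<^sub>M a\<in>A. borel)"

definition round_space :: "'v set \<Rightarrow> 'v round measure" where
  "round_space A = loss_space A \<Otimes>\<^sub>M count_space UNIV"

definition observation_space :: "'v observation measure" where
  "observation_space = borel \<Otimes>\<^sub>M count_space UNIV"

definition observe :: "'v round \<Rightarrow> 'v observation" where
  "observe = (\<lambda>(y, a, b, k). ((y a, y b), (a, b, k)))"

definition observed :: "nat \<Rightarrow> (nat \<Rightarrow> 'v round) \<Rightarrow> nat \<Rightarrow> 'v observation" where
  "observed n h = (\<lambda>i\<in>{0..<n}. observe (h i))"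

text \<open>
  An environment gives the conditional law of the next loss function given all previous rounds
  (including the learner's signals); an algorithm gives the conditional law of the next move given
  the previous observations.
\<close>

definition is_environment :: "'v set \<Rightarrow> 'v environment \<Rightarrow> bool" where
  "is_environment A env \<longleftrightarrow>
     (\<forall>n. env n \<in> (\<Pi>\<^sub>M i\<in>{0..<n}. round_space A) \<rightarrow>\<^sub>M prob_algebra (loss_space A))"

definition tree_compatible_environment ::
    "'v rooted_tree \<Rightarrow> nat \<Rightarrow> (nat \<Rightarrow> real) \<Rightarrow> 'v environment \<Rightarrow> bool" where
  "tree_compatible_environment \<T> L \<sigma> env \<longleftrightarrow>
     (\<forall>n. \<forall>h\<in>space (\<Pi>\<^sub>M i\<in>{0..<n}. round_space (leaves \<T>)).
        AE y in env n h. tree_compatible \<T> L \<sigma> y)"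

definition is_algorithm :: "'v set \<Rightarrow> 'v algorithm \<Rightarrow> bool" where
  "is_algorithm A \<pi> \<longleftrightarrow>
     (\<forall>n. (\<lambda>h. measure_pmf (\<pi> n h))
            \<in> (\<Pi>\<^sub>M i\<in>{0..<n}. observation_space) \<rightarrow>\<^sub>M prob_algebra (count_space UNIV)) \<and>
     (\<forall>n. \<forall>h\<in>space (\<Pi>\<^sub>M i\<in>{0..<n}. observation_space). set_pmf (\<pi> n h) \<subseteq> A \<times> A \<times> UNIV)"

text \<open>
  Taking the product measure makes the loss and the learner's move of a round conditionally
  independent given the past.
\<close>

definition round_kernel ::
    "'v environment \<Rightarrow> 'v algorithm \<Rightarrow> nat \<Rightarrow> (nat \<Rightarrow> 'v round) \<Rightarrow> 'v round measure" where
  "round_kernel env \<pi> n h = env n h \<Otimes>\<^sub>M measure_pmf (\<pi> n (observed n h))"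

text \<open>
  The law of the whole infinite play, given by the Ionescu-Tulcea theorem; lemma
  \<open>Ionescu_Tulcea_round_kernel\<close> below shows that it applies.
\<close>

definition game_law ::
    "'v set \<Rightarrow> 'v environment \<Rightarrow> 'v algorithm \<Rightarrow> (nat \<Rightarrow> 'v round) measure" where
  "game_law A env \<pi> =
     projective_family.lim UNIV
       (Ionescu_Tulcea.CI (round_kernel env \<pi>) (\<lambda>_. round_space A)) (\<lambda>_. round_space A)"

definition loss_at :: "(nat \<Rightarrow> 'v round) \<Rightarrow> nat \<Rightarrow> 'v \<Rightarrow> real" where
  "loss_at \<omega> n = fst (\<omega> n)"

definition action1 :: "(nat \<Rightarrow> 'v round) \<Rightarrow> nat \<Rightarrow> 'v" where
  "action1 \<omega> n = fst (snd (\<omega> n))"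

definition action2 :: "(nat \<Rightarrow> 'v round) \<Rightarrow> nat \<Rightarrow> 'v" where
  "action2 \<omega> n = fst (snd (snd (\<omega> n)))"

definition integrable_losses :: "'v set \<Rightarrow> 'v environment \<Rightarrow> 'v algorithm \<Rightarrow> nat \<Rightarrow> bool" where
  "integrable_losses A env \<pi> T \<longleftrightarrow>
     (\<forall>n<T. \<forall>a\<in>A. integrable (game_law A env \<pi>) (\<lambda>\<omega>. loss_at \<omega> n a))"

definition regret :: "'v set \<Rightarrow> 'v environment \<Rightarrow> 'v algorithm \<Rightarrow> nat \<Rightarrow> real" where
  "regret A env \<pi> T =
     (\<integral>\<omega>. (\<Sum>n<T. 1/2 * (loss_at \<omega> n (action1 \<omega> n) + loss_at \<omega> n (action2 \<omega> n)))
        \<partial>game_law A env \<pi>)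
     - (MIN a\<in>A. \<integral>\<omega>. (\<Sum>n<T. loss_at \<omega> n a) \<partial>game_law A env \<pi>)"

definition expected_gaps :: "'v set \<Rightarrow> 'v environment \<Rightarrow> 'v algorithm \<Rightarrow> ('v \<Rightarrow> real) \<Rightarrow> nat \<Rightarrow> real" where
  "expected_gaps A env \<pi> \<Delta> T =
     (\<integral>\<omega>. (\<Sum>n<T. 1/2 * (\<Delta> (action1 \<omega> n) + \<Delta> (action2 \<omega> n))) \<partial>game_law A env \<pi>)"

section \<open>The algorithm\<close>

text \<open>
  The simplex is rendered as the set of probability mass functions supported on the leaves, and
  the distribution \<open>\<delta>\<close> as a probability mass function on the natural numbers.
\<close>

definition regularizer ::
    "'v rooted_tree \<Rightarrow> nat \<Rightarrow> (nat \<Rightarrow> real) \<Rightarrow> nat pmf \<Rightarrow> nat \<Rightarrow> 'v pmf \<Rightarrow> real" where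
  "regularizer \<T> L \<sigma> \<delta> t p =
     2 * sqrt 6 * (\<Sum>j=1..L. \<sigma> j / sqrt (pmf \<delta> j) * sqrt (max (real t) (6 / pmf \<delta> j)) *
       (\<Sum>v\<in>level \<T> j. mass \<T> (pmf p) v - sqrt (mass \<T> (pmf p) v)))"

definition ftrl_point ::
    "'v rooted_tree \<Rightarrow> nat \<Rightarrow> (nat \<Rightarrow> real) \<Rightarrow> nat pmf \<Rightarrow> nat \<Rightarrow> ('v \<Rightarrow> real) \<Rightarrow> 'v pmf" where
  "ftrl_point \<T> L \<sigma> \<delta> t Z =
     arg_min (\<lambda>p. (\<Sum>a\<in>leaves \<T>. Z a * pmf p a) + regularizer \<T> L \<sigma> \<delta> t p)
       (\<lambda>p. set_pmf p \<subseteq> leaves \<T>)"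

definition loss_estimate ::
    "'v rooted_tree \<Rightarrow> (nat \<Rightarrow> real) \<Rightarrow> nat pmf \<Rightarrow> 'v pmf \<Rightarrow> 'v observation \<Rightarrow> 'v \<Rightarrow> real" where
  "loss_estimate \<T> \<sigma> \<delta> p = (\<lambda>((u1, u2), (a1, a2, j)) a.
     if same_anc \<T> j a a1
     then (u1 - u2 + \<sigma> j) / (pmf \<delta> j * mass \<T> (pmf p) (anc \<T> j a1))
     else 0)"

text \<open>\<open>cumulative_estimate \<dots> n h\<close> is the sum of the estimates of rounds \<open>1, \<dots>, n\<close>.\<close>

primrec cumulative_estimate ::
    "'v rooted_tree \<Rightarrow> nat \<Rightarrow> (nat \<Rightarrow> real) \<Rightarrow> nat pmf \<Rightarrow> nat \<Rightarrow> (nat \<Rightarrow> 'v observation) \<Rightarrow> 'v \<Rightarrow> real"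
where
  "cumulative_estimate \<T> L \<sigma> \<delta> 0 h = (\<lambda>a. 0)"
| "cumulative_estimate \<T> L \<sigma> \<delta> (Suc n) h =
     (\<lambda>a. cumulative_estimate \<T> L \<sigma> \<delta> n h a +
        loss_estimate \<T> \<sigma> \<delta>
          (ftrl_point \<T> L \<sigma> \<delta> (Suc n) (cumulative_estimate \<T> L \<sigma> \<delta> n h)) (h n) a)"

definition draw_move :: "'v rooted_tree \<Rightarrow> nat pmf \<Rightarrow> 'v pmf \<Rightarrow> 'v move pmf" where
  "draw_move \<T> \<delta> p =
     bind_pmf p (\<lambda>a1. bind_pmf \<delta> (\<lambda>j.
       bind_pmf (cond_pmf p {a2. same_anc \<T> (j - 1) a2 a1}) (\<lambda>a2. return_pmf (a1, a2, j))))"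

definition tree_ftrl ::
    "'v rooted_tree \<Rightarrow> nat \<Rightarrow> (nat \<Rightarrow> real) \<Rightarrow> nat pmf \<Rightarrow> 'v algorithm" where
  "tree_ftrl \<T> L \<sigma> \<delta> n h =
     draw_move \<T> \<delta> (ftrl_point \<T> L \<sigma> \<delta> (Suc n) (cumulative_estimate \<T> L \<sigma> \<delta> n h))"

section \<open>Effective numbers of actions\<close>

definition K_eff :: "'v rooted_tree \<Rightarrow> nat \<Rightarrow> (nat \<Rightarrow> real) \<Rightarrow> real" where
  "K_eff \<T> L r = (\<Sum>j=1..L. r j * sqrt (real (card (level \<T> j))))\<^sup>2"

definition min_gap :: "'v rooted_tree \<Rightarrow> ('v \<Rightarrow> real) \<Rightarrow> 'v \<Rightarrow> real" where
  "min_gap \<T> \<Delta> v = (MIN a\<in>leaves_below \<T> v. \<Delta> a)"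

definition inverse_gaps :: "'v rooted_tree \<Rightarrow> nat \<Rightarrow> ('v \<Rightarrow> real) \<Rightarrow> real" where
  "inverse_gaps \<T> j \<Delta> = (\<Sum>v | v \<in> level \<T> j \<and> min_gap \<T> \<Delta> v \<noteq> 0. 1 / min_gap \<T> \<Delta> v)"

definition K_eff_sto :: "'v rooted_tree \<Rightarrow> nat \<Rightarrow> ('v \<Rightarrow> real) \<Rightarrow> (nat \<Rightarrow> real) \<Rightarrow> real" where
  "K_eff_sto \<T> L \<Delta> r = (\<Sum>j=1..L. r j * sqrt (inverse_gaps \<T> j \<Delta>))\<^sup>2"

section \<open>Well-definedness of the law of the game\<close>

lemma measurable_observe:
  fixes A :: "'v::finite set"
  shows "observe \<in> round_space A \<rightarrow>\<^sub>M observation_space"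
proof -
  have component: "(\<lambda>y. y a) \<in> borel_measurable (loss_space A)" for a
  proof (cases "a \<in> A")
    case True
    then show ?thesis by (simp add: loss_space_def)
  next
    case False
    then have "y a = undefined" if "y \<in> space (loss_space A)" for y
      using that by (auto simp: loss_space_def space_PiM PiE_iff extensional_def)
    then have "(\<lambda>y. y a) \<in> borel_measurable (loss_space A) \<longleftrightarrow>
        (\<lambda>y. undefined :: real) \<in> borel_measurable (loss_space A)"
      by (intro measurable_cong) auto
    then show ?thesis by simp
  qed
  have "(\<lambda>(m, y). observe (y, m)) \<in> count_space UNIV \<Otimes>\<^sub>M loss_space A \<rightarrow>\<^sub>M observation_space"
  proof (rule measurable_pair_measure_countable1)
    fix m :: "'v move"
    obtain a b k where m: "m = (a, b, k)" by (cases m)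
    show "(\<lambda>y. case (m, y) of (m, y) \<Rightarrow> observe (y, m)) \<in> loss_space A \<rightarrow>\<^sub>M observation_space"
      using component[of a] component[of b]
      by (auto simp: m observe_def observation_space_def intro!: measurable_Pair borel_measurable_Pair)
  qed auto
  from measurable_compose[OF measurable_pair_swap' this] show ?thesis
    by (simp add: round_space_def split_beta)
qed

lemma measurable_observed:
  fixes A :: "'v::finite set"
  shows "observed n \<in> (\<Pi>\<^sub>M i\<in>{0..<n}. round_space A) \<rightarrow>\<^sub>M (\<Pi>\<^sub>M i\<in>{0..<n}. observation_space)"
  unfolding observed_def[abs_def]
proof (rule measurable_restrict)
  fix i assume "i \<in> {0..<n}"
  then have "(\<lambda>h. h i) \<in> (\<Pi>\<^sub>M i\<in>{0..<n}. round_space A) \<rightarrow>\<^sub>M round_space A"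
    by (rule measurable_component_singleton)
  then show "(\<lambda>h. observe (h i)) \<in> (\<Pi>\<^sub>M i\<in>{0..<n}. round_space A) \<rightarrow>\<^sub>M observation_space"
    by (rule measurable_compose[OF _ measurable_observe])
qed

lemma Ionescu_Tulcea_round_kernel:
  fixes A :: "'v::finite set"
  assumes "is_environment A env" "is_algorithm A \<pi>"
  shows "Ionescu_Tulcea (round_kernel env \<pi>) (\<lambda>_. round_space A)"
proof -
  have kernel: "round_kernel env \<pi> n
      \<in> (\<Pi>\<^sub>M i\<in>{0..<n}. round_space A) \<rightarrow>\<^sub>M prob_algebra (round_space A)" for n
  proof -
    have "env n \<in> (\<Pi>\<^sub>M i\<in>{0..<n}. round_space A) \<rightarrow>\<^sub>M prob_algebra (loss_space A)"
      using assms(1) by (simp add: is_environment_def)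
    moreover have "(\<lambda>h. measure_pmf (\<pi> n (observed n h)))
        \<in> (\<Pi>\<^sub>M i\<in>{0..<n}. round_space A) \<rightarrow>\<^sub>M prob_algebra (count_space UNIV)"
      using assms(2) by (intro measurable_compose[OF measurable_observed]) (simp add: is_algorithm_def)
    ultimately show ?thesis
      unfolding round_kernel_def[abs_def] round_space_def by (rule measurable_pair_prob)
  qed
  show ?thesis
  proof (rule Ionescu_Tulcea.intro)
    show "round_kernel env \<pi> n
        \<in> (\<Pi>\<^sub>M i\<in>{0..<n}. round_space A) \<rightarrow>\<^sub>M subprob_algebra (round_space A)" for n
      using kernel by (rule measurable_prob_algebraD)
    show "prob_space (round_kernel env \<pi> n h)" if "h \<in> space (\<Pi>\<^sub>M i\<in>{0..<n}. round_space A)" for n h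
      using measurable_space[OF kernel that] by (simp add: space_prob_algebra)
  qed
qed

end

theory Submission
  imports Defs
begin

text \<open>
  Given the past and the loss function, the estimate \<open>z\<^sub>t(a)\<close> has mean
  \<open>y\<^sub>t(a) - \<langle>p\<^sub>t, y\<^sub>t\<rangle>\<close> plus a constant, and both actions have marginal law \<open>p\<^sub>t\<close>, so the
  regret is that of follow-the-regularised-leader on the estimates. The Bregman divergence of
  \<open>p \<mapsto> - sqrt p\<close> at \<open>x\<close> is exactly \<open>(sqrt q - sqrt x)\<^sup>2 / (2 * sqrt x)\<close>, which makes the stability
  term of a single level a quadratic maximisation; since an estimate of level \<open>j\<close> only sees the
  masses of that level, the other levels can be dropped. Stability and penalty of round \<open>t\<close>
  together cost at most \<open>sqrt 6 * \<sigma>\<^sub>j / sqrt (\<delta>\<^sub>j * t)\<close> times a function of each node mass that is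
  bounded by \<open>2 * sqrt x\<close> and by \<open>2 * (1 - x)\<close>. The first bound and the Cauchy-Schwarz inequality
  give the adversarial rate. The second one removes, at each level, the ancestor of the optimal
  leaf; then regret = 2 * regret - regret is self-bounding, because Cauchy-Schwarz with the gaps as
  weights leaves a term \<open>2 * b * sqrt g - g \<le> b\<^sup>2\<close> in the expected gap \<open>g\<close> of the round.
\<close>

section \<open>Elementary estimates\<close>

text \<open>The summand \<open>\<sigma> j\<close> in the estimate is there for its sign: the second
  action is drawn below the ancestor of the first at depth \<open>j - 1\<close>, so the observed
  difference is at most \<open>\<sigma> j\<close> in absolute value and the estimate lies between 0
  and \<open>2 * \<sigma> j\<close> over \<open>pmf \<delta> j\<close> times the sampled mass. After
  centring, some coordinates of the loss are negative, and the quadratic maximisation needs a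
  curvature \<open>scale t j\<close> that dominates estimate times mass. That product has a bound
  free of the mass, and the floor \<open>6 / pmf \<delta> j\<close> in the regularizer is tuned to
  it; through \<open>\<psi> 1\<close> the same floor produces the term that does not grow with
  \<open>T\<close>. Two obstacles are measure-theoretic. The leader is an \<open>arg_min\<close>, a
  chosen object, so its measurability in the history is extracted from a Lipschitz estimate. And no
  lower bound on the masses is at hand, so integrability of the estimates, like the size of the
  averaged stability term, rests on cancelling inverse masses against the probability of the move.
  Stability is therefore kept as a bound depending on the realised move and averaged only
  afterwards.\<close>

lemma sum_inverse_sqrt_le: "(\<Sum>n<T. 1 / sqrt (real (Suc n))) \<le> 2 * sqrt (real T)"
proof (induction T)
  case 0
  then show ?case by simp
next
  case (Suc T)
  define a b where "a = sqrt (real (Suc T))" and "b = sqrt (real T)"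
  have ab: "a > 0" "b \<ge> 0" "a\<^sup>2 = b\<^sup>2 + 1" by (auto simp: a_def b_def)
  have "0 \<le> (a - b)\<^sup>2" by simp
  then have "2 * b + 1 / a \<le> 2 * a"
    using ab by (simp add: field_simps power2_eq_square)
  then show ?case using Suc by (simp add: a_def b_def)
qed

lemma sum_inverse_le_ln: "1 \<le> T \<Longrightarrow> (\<Sum>n<T. 1 / real (Suc n)) \<le> ln (exp 1 * real T)"
proof (induction T rule: dec_induct)
  case base
  then show ?case by simp
next
  case (step T)
  have "ln (real T / real (Suc T)) \<le> real T / real (Suc T) - 1"
    using step by (intro ln_le_minus_one) auto
  then have "1 / real (Suc T) \<le> ln (real (Suc T)) - ln (real T)"
    using step by (simp add: ln_div field_simps)
  then show ?case using step by (simp add: ln_mult)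
qed

text \<open>The difference is \<open>1 / (a + b)\<close>, and \<open>a \<le> 2 * b\<close> for
  \<open>n\<close> at least 1 gives \<open>a + b \<ge> 3 / 2 * a\<close>. The later root stands in
  the denominator because the growth of the regularizer from \<open>n\<close> to
  \<open>Suc n\<close> is charged to time \<open>Suc n\<close>.\<close>

lemma sqrt_Suc_diff_le:
  assumes "1 \<le> n"
  shows "sqrt (real (Suc n)) - sqrt (real n) \<le> 2 / (3 * sqrt (real (Suc n)))"
proof -
  define a b where "a = sqrt (real (Suc n))" and "b = sqrt (real n)"
  have ab: "a > 0" "b \<ge> 0" "a\<^sup>2 = b\<^sup>2 + 1" by (auto simp: a_def b_def)
  have "1 \<le> b" using assms by (simp add: b_def)
  then have "1 \<le> b\<^sup>2" by (rule one_le_power)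
  then have "(2 * b)\<^sup>2 \<ge> a\<^sup>2" using ab by (simp add: power_mult_distrib)
  then have "a \<le> 2 * b" using ab by (intro power2_le_imp_le[of a]) auto
  then have "b\<^sup>2 \<ge> a / 2 * b" using ab by (simp add: power2_eq_square mult_right_mono)
  have "(a - b) * (a + a / 2) \<le> (a - b) * (a + b)"
    using \<open>a \<le> 2 * b\<close> ab by (intro mult_left_mono) (auto simp: a_def b_def)
  also have "\<dots> = 1" using ab by (simp add: power2_eq_square algebra_simps)
  finally show ?thesis unfolding a_def[symmetric] b_def[symmetric] using ab by (simp add: field_simps)
qed

text \<open>The contribution of a node of mass \<open>x\<close> to one round: stability plus penalty.\<close>

definition node_cost :: "real \<Rightarrow> real" where
  "node_cost x = sqrt x * (1 - x) * (2 + x) / 3 + 4 / 3 * (sqrt x - x)"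

text \<open>With \<open>s = sqrt x\<close> both are polynomial inequalities on the unit interval.
  The first constant is sharp at 0, where the two summands contribute 2/3 and 4/3; the second bound
  makes a node that carries almost all the mass almost free.\<close>

lemma node_cost_le:
  assumes "0 \<le> x" "x \<le> 1"
  shows "node_cost x \<le> 2 * sqrt x" "node_cost x \<le> 2 * (1 - x)"
proof -
  define s where "s = sqrt x"
  have s: "x = s\<^sup>2" "0 \<le> s" "s \<le> 1" using assms by (auto simp: s_def)
  have cost: "node_cost x = s * ((1 - s\<^sup>2) * (2 + s\<^sup>2) / 3) + 4 / 3 * (s - s\<^sup>2)"
    unfolding node_cost_def s_def[symmetric] by (simp add: s(1))
  have "(1 - s\<^sup>2) * (2 + s\<^sup>2) \<le> 2"
    using mult_nonneg_nonneg[of "s\<^sup>2" "1 + s\<^sup>2"] by (simp add: algebra_simps)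
  then have "s * ((1 - s\<^sup>2) * (2 + s\<^sup>2) / 3) \<le> s * (2 / 3)"
    using s by (intro mult_left_mono) auto
  moreover have "4 / 3 * (s - s\<^sup>2) \<le> 4 / 3 * s" by simp
  ultimately have "node_cost x \<le> s * (2 / 3) + 4 / 3 * s"
    unfolding cost by (rule add_mono)
  then show "node_cost x \<le> 2 * sqrt x" by (simp add: s_def)
  have s2: "s\<^sup>2 \<le> 1" using s by (simp add: power_le_one)
  have "s * (2 + s\<^sup>2) \<le> 1 * 3" using s s2 by (intro mult_mono) auto
  then have "(1 - s\<^sup>2) * (s * (2 + s\<^sup>2)) \<le> (1 - s\<^sup>2) * 3"
    using s2 by (intro mult_left_mono) auto
  moreover have "(1 - s) * (4 / 3 * s) \<le> (1 - s) * (1 + s)"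
    using s by (intro mult_left_mono) auto
  ultimately have "node_cost x \<le> 2 * (1 - s\<^sup>2)"
    unfolding cost by (simp add: power2_eq_square field_simps)
  then show "node_cost x \<le> 2 * (1 - x)" by (simp add: s(1)[symmetric])
qed

text \<open>Cauchy-Schwarz with free weights. Unit weights produce the square root of the number of
  nodes; the gaps as weights produce the inverse gaps times the expected gap.\<close>

lemma sum_sqrt_le:
  fixes x :: "'a \<Rightarrow> real"
  assumes "\<And>v. v \<in> V \<Longrightarrow> 0 \<le> x v" "\<And>v. v \<in> V \<Longrightarrow> 0 < d v"
  shows "(\<Sum>v\<in>V. sqrt (x v)) \<le> sqrt (\<Sum>v\<in>V. 1 / d v) * sqrt (\<Sum>v\<in>V. d v * x v)"
proof -
  have "(\<Sum>v\<in>V. sqrt (x v))\<^sup>2 = (\<Sum>v\<in>V. sqrt (1 / d v) * sqrt (d v * x v))\<^sup>2"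
    using assms by (intro arg_cong[of _ _ "\<lambda>x. x\<^sup>2"] sum.cong refl)
      (simp add: real_sqrt_mult[symmetric] less_imp_neq[symmetric])
  also have "\<dots> \<le> (\<Sum>v\<in>V. (sqrt (1 / d v))\<^sup>2) * (\<Sum>v\<in>V. (sqrt (d v * x v))\<^sup>2)"
    by (rule Cauchy_Schwarz_ineq_sum)
  also have "\<dots> = (\<Sum>v\<in>V. 1 / d v) * (\<Sum>v\<in>V. d v * x v)"
    using assms by (intro arg_cong2[of _ _ _ _ "(*)"] sum.cong refl) (auto simp: less_imp_le)
  finally show ?thesis by (simp add: real_le_rsqrt real_sqrt_mult[symmetric])
qed

section \<open>Bregman divergence of the negative square root and stability at one level\<close>

definition sqrt_bregman :: "real \<Rightarrow> real \<Rightarrow> real" where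
  "sqrt_bregman q x = (sqrt q - sqrt x)\<^sup>2 / (2 * sqrt x)"

lemma sqrt_bregman_eq:
  assumes "0 \<le> q" "0 < x"
  shows "sqrt_bregman q x = sqrt x - sqrt q + (q - x) / (2 * sqrt x)"
proof -
  define s r where "s = sqrt x" and "r = sqrt q"
  have "x = s\<^sup>2" "q = r\<^sup>2" "s > 0" using assms by (auto simp: s_def r_def)
  then show ?thesis unfolding sqrt_bregman_def s_def[symmetric] r_def[symmetric]
    by (simp add: field_simps power2_eq_square)
qed

text \<open>A second-order expansion whose remainder is valid for every \<open>y \<ge> 0\<close>,
  including the boundary. In \<open>u = y / x - 1\<close> it reads
  \<open>1 + u / 2 - u\<^sup>2 / 2 \<le> sqrt (1 + u)\<close>; the coefficient 1/2, instead of
  Taylor's 1/8, is the smallest that survives at \<open>u = -1\<close>.\<close>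

lemma sqrt_quadratic_lower_bound:
  fixes x y :: real
  assumes x: "0 < x" and y: "0 \<le> y"
  shows "sqrt x + (y - x) / (2 * sqrt x) - (y - x)\<^sup>2 / (2 * x * sqrt x) \<le> sqrt y"
proof -
  define u where "u = y / x - 1"
  have y_eq: "y = x * (1 + u)" and u: "-1 \<le> u" using x y by (auto simp: u_def field_simps)
  have "(1 + u) * (2 - u) / 2 \<le> sqrt (1 + u)"
  proof (cases "u \<le> 2")
    case True
    \<comment> \<open>This is the identity
      \<open>(1 + u) * (2 - u)\<^sup>2 - 4 = u\<^sup>2 * (u - 3)\<close> in disguise.\<close>
    have "u\<^sup>2 * (u - 3) \<le> 0" using True by (simp add: mult_nonneg_nonpos)
    then have "(1 + u) * (2 - u)\<^sup>2 \<le> 4" by (simp add: power2_eq_square algebra_simps)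
    then have "(1 + u) * ((1 + u) * (2 - u)\<^sup>2) \<le> (1 + u) * 4"
      using u by (intro mult_left_mono) auto
    then have "((1 + u) * (2 - u) / 2)\<^sup>2 \<le> 1 + u" by (simp add: power2_eq_square field_simps)
    then show ?thesis by (rule real_le_rsqrt)
  next
    case False
    then have "(1 + u) * (2 - u) \<le> 0" using u by (intro mult_nonneg_nonpos) auto
    then show ?thesis using u by (smt (verit) real_sqrt_ge_zero divide_nonpos_pos)
  qed
  then have "sqrt x * ((1 + u) * (2 - u) / 2) \<le> sqrt x * sqrt (1 + u)"
    using x by (intro mult_left_mono) auto
  also have "\<dots> = sqrt y" by (simp add: y_eq real_sqrt_mult)
  finally have *: "sqrt x * ((1 + u) * (2 - u) / 2) \<le> sqrt y" .
  define s where "s = sqrt x"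
  have s: "x = s\<^sup>2" "s > 0" using x by (auto simp: s_def)
  have yx: "y - x = s\<^sup>2 * u" by (simp add: y_eq s algebra_simps)
  have "s + (y - x) / (2 * s) - (y - x)\<^sup>2 / (2 * s\<^sup>2 * s) = s * ((1 + u) * (2 - u) / 2)"
    unfolding yx using s by (simp add: field_simps power2_eq_square)
  then show ?thesis using * unfolding s_def[symmetric] s(1)[symmetric] by linarith
qed

text \<open>In the coordinate \<open>d = sqrt q - sqrt x\<close> the left-hand side is the quadratic
  \<open>- 2 * s * w * d - k * d\<^sup>2 / (2 * s)\<close> with \<open>k = c + 2 * s * w\<close>,
  concave by \<open>pos\<close>; the right-hand side is its unconstrained maximum. No sign of
  \<open>w\<close> is assumed, since the centred loss is negative at all nodes but one.\<close>

lemma linear_minus_bregman_le: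
  fixes w c x q :: real
  assumes x: "0 < x" and q: "0 \<le> q" and pos: "0 < c + 2 * sqrt x * w"
  shows "w * (x - q) - c * sqrt_bregman q x \<le> 2 * (x * sqrt x) * w\<^sup>2 / (c + 2 * sqrt x * w)"
proof -
  define s r where "s = sqrt x" and "r = sqrt q"
  have s: "x = s\<^sup>2" "q = r\<^sup>2" "s > 0" "r \<ge> 0" using x q by (auto simp: s_def r_def)
  define d k where "d = r - s" and "k = c + 2 * s * w"
  have k: "k > 0" using pos by (simp add: k_def s_def)
  have "w * (x - q) - c * sqrt_bregman q x = - 2 * s * w * d - k * d\<^sup>2 / (2 * s)"
    unfolding sqrt_bregman_def s_def[symmetric] r_def[symmetric] s(1,2) d_def k_def
    using s(3,4) by (simp add: field_simps power2_eq_square)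
  also have "\<dots> = 2 * s ^ 3 * w\<^sup>2 / k - (k * d + 2 * s\<^sup>2 * w)\<^sup>2 / (2 * s * k)"
    using s(3) k by (simp add: field_simps power2_eq_square power3_eq_cube)
  also have "\<dots> \<le> 2 * s ^ 3 * w\<^sup>2 / k" using s(3) k by simp
  finally show ?thesis
    unfolding s_def[symmetric] k_def using s by (simp add: power2_eq_square power3_eq_cube)
qed

text \<open>
  Subtracting the constant \<open>w * x v\<close> from all coordinates of the loss vector does not change the
  left-hand side and produces the factors that vanish as \<open>x v\<close> tends to 1.
\<close>

lemma level_stability:
  fixes x q :: "'v \<Rightarrow> real" and w c :: real
  assumes fin: "finite V" and v: "v \<in> V"
    and x: "\<And>u. u \<in> V \<Longrightarrow> 0 < x u" "sum x V = 1"
    and q: "\<And>u. u \<in> V \<Longrightarrow> 0 \<le> q u" "sum q V = 1"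
    and w: "0 \<le> w" and c: "0 < c" "6 * w * x v \<le> c"
  shows "w * (x v - q v) - c * (\<Sum>u\<in>V. sqrt_bregman (q u) (x u))
      \<le> w\<^sup>2 / c * (2 * (x v * sqrt (x v)) * (1 - x v)\<^sup>2 + 3 * (x v)\<^sup>2 * (\<Sum>u\<in>V - {v}. x u * sqrt (x u)))"
proof -
  have x_le: "x u \<le> 1" if "u \<in> V" for u
    using member_le_sum[of u V x] that x fin by (auto simp: less_imp_le)
  define l where "l u = (if u = v then w * (1 - x v) else - (w * x v))" for u
  have "(\<Sum>u\<in>V. l u * (x u - q u))
      = (\<Sum>u\<in>V. (if u = v then w * (x v - q v) else 0) - w * x v * (x u - q u))"
    by (intro sum.cong) (auto simp: l_def algebra_simps)
  also have "\<dots> = w * (x v - q v) - w * x v * (sum x V - sum q V)"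
    using fin v by (simp add: sum_subtractf sum_distrib_left[symmetric])
  finally have "w * (x v - q v) - c * (\<Sum>u\<in>V. sqrt_bregman (q u) (x u))
      = (\<Sum>u\<in>V. l u * (x u - q u) - c * sqrt_bregman (q u) (x u))"
    using x q by (simp add: sum_subtractf sum_distrib_left)
  also have "\<dots> = (l v * (x v - q v) - c * sqrt_bregman (q v) (x v))
      + (\<Sum>u\<in>V - {v}. l u * (x u - q u) - c * sqrt_bregman (q u) (x u))"
    using fin v by (rule sum.remove)
  also have "\<dots> \<le> w\<^sup>2 / c * (2 * (x v * sqrt (x v)) * (1 - x v)\<^sup>2)
      + (\<Sum>u\<in>V - {v}. w\<^sup>2 / c * (3 * (x v)\<^sup>2 * (x u * sqrt (x u))))"
  proof (intro add_mono sum_mono)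
    have lv: "0 \<le> l v" using w x_le v by (simp add: l_def)
    \<comment> \<open>At the sampled node the centred loss is nonnegative and only enlarges the
      denominator, so the factor 2 is kept.\<close>
    then have k: "c \<le> c + 2 * sqrt (x v) * l v" using x v by (simp add: less_imp_le)
    have "l v * (x v - q v) - c * sqrt_bregman (q v) (x v)
        \<le> 2 * (x v * sqrt (x v)) * (l v)\<^sup>2 / (c + 2 * sqrt (x v) * l v)"
      using x(1)[OF v] q(1)[OF v] order.strict_trans2[OF c(1) k] by (intro linear_minus_bregman_le)
    also have "\<dots> \<le> 2 * (x v * sqrt (x v)) * (l v)\<^sup>2 / c"
      using k c x v by (intro divide_left_mono mult_pos_pos order.strict_trans2[OF c(1) k]) (auto simp: less_imp_le)
    also have "\<dots> = w\<^sup>2 / c * (2 * (x v * sqrt (x v)) * (1 - x v)\<^sup>2)"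
      by (simp add: l_def power_mult_distrib)
    finally show "l v * (x v - q v) - c * sqrt_bregman (q v) (x v)
        \<le> w\<^sup>2 / c * (2 * (x v * sqrt (x v)) * (1 - x v)\<^sup>2)" .
  next
    fix u assume u: "u \<in> V - {v}"
    \<comment> \<open>At the other nodes the centred loss is negative. The condition
      \<open>6 * w * x v \<le> c\<close> limits the damage to a third of \<open>c\<close>; the
      remaining \<open>2 / 3 * c\<close> turns the factor 2 into 3.\<close>
    have "2 * sqrt (x u) * (w * x v) \<le> 2 * 1 * (w * x v)"
      using x_le u w x v by (intro mult_right_mono mult_left_mono mult_nonneg_nonneg) (auto simp: less_imp_le)
    then have k: "2 / 3 * c \<le> c + 2 * sqrt (x u) * l u"
      using c u by (simp add: l_def)
    have "l u * (x u - q u) - c * sqrt_bregman (q u) (x u)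
        \<le> 2 * (x u * sqrt (x u)) * (l u)\<^sup>2 / (c + 2 * sqrt (x u) * l u)"
      using x q u k c by (intro linear_minus_bregman_le) auto
    also have "\<dots> \<le> 2 * (x u * sqrt (x u)) * (l u)\<^sup>2 / (2 / 3 * c)"
      using k c x u by (intro divide_left_mono mult_pos_pos) (auto simp: less_imp_le)
    also have "\<dots> = w\<^sup>2 / c * (3 * (x v)\<^sup>2 * (x u * sqrt (x u)))"
      using u c by (simp add: l_def power_mult_distrib field_simps)
    finally show "l u * (x u - q u) - c * sqrt_bregman (q u) (x u)
        \<le> w\<^sup>2 / c * (3 * (x v)\<^sup>2 * (x u * sqrt (x u)))" .
  qed
  also have "\<dots> = w\<^sup>2 / c * (2 * (x v * sqrt (x v)) * (1 - x v)\<^sup>2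
      + 3 * (x v)\<^sup>2 * (\<Sum>u\<in>V - {v}. x u * sqrt (x u)))"
    by (simp only: sum_distrib_left[symmetric] ring_distribs)
  finally show ?thesis .
qed

section \<open>Auxiliary facts on mass functions and first-order conditions\<close>

lemma pmf_of_function:
  fixes f :: "'v::finite \<Rightarrow> real"
  assumes "\<And>a. 0 \<le> f a" "\<And>a. a \<notin> A \<Longrightarrow> f a = 0" "sum f A = 1"
  shows "\<exists>p. set_pmf p \<subseteq> A \<and> (\<forall>a. pmf p a = f a)"
proof -
  have "sum f UNIV = sum f A"
    using assms by (intro sum.mono_neutral_right) auto
  then have "(\<integral>\<^sup>+ a. ennreal (f a) \<partial>count_space UNIV) = 1"
    using assms by (subst nn_integral_count_space_finite) auto
  then have "pmf (embed_pmf f) a = f a" for a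
    using assms by (intro pmf_embed_pmf) auto
  then show ?thesis using assms by (intro exI[of _ "embed_pmf f"]) (force simp: set_pmf_iff)
qed

text \<open>Replaces a one-sided derivative at 0: for small \<open>\<epsilon>\<close> the quadratic
  term cannot compensate a negative linear one.\<close>

lemma nonneg_of_quadratic:
  fixes G C :: real
  assumes "\<And>\<epsilon>. 0 < \<epsilon> \<Longrightarrow> \<epsilon> \<le> 1 \<Longrightarrow> 0 \<le> \<epsilon> * G + \<epsilon>\<^sup>2 * C"
  shows "0 \<le> G"
proof (rule ccontr)
  assume "\<not> 0 \<le> G"
  \<comment> \<open>Chosen so that \<open>\<epsilon> * C\<close> offsets at most half of the
    supposed negative \<open>G\<close>.\<close>
  define \<epsilon> where "\<epsilon> = min 1 (- G / (2 * (\<bar>C\<bar> + 1)))"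
  have \<epsilon>: "0 < \<epsilon>" "\<epsilon> \<le> 1" using \<open>\<not> 0 \<le> G\<close> by (auto simp: \<epsilon>_def divide_less_0_iff)
  have "0 \<le> \<epsilon> * (G + \<epsilon> * C)" using assms[OF \<epsilon>] by (simp add: power2_eq_square algebra_simps)
  then have "0 \<le> G + \<epsilon> * C" using \<epsilon> by (simp add: zero_le_mult_iff)
  also have "\<dots> \<le> G + \<epsilon> * (\<bar>C\<bar> + 1)" using \<epsilon> by (intro add_left_mono mult_left_mono) auto
  also have "\<dots> \<le> G + (- G / (2 * (\<bar>C\<bar> + 1))) * (\<bar>C\<bar> + 1)"
    by (intro add_left_mono mult_right_mono) (auto simp: \<epsilon>_def)
  also have "\<dots> = G / 2" by (simp add: field_simps)
  finally show False using \<open>\<not> 0 \<le> G\<close> by simp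
qed

text \<open>A move records every draw that produced it, so its value determines the branch. This
  collapses the nested binds of \<open>draw_move\<close> to a product.\<close>

lemma pmf_bind_eq_single:
  assumes "\<And>b. b \<noteq> a \<Longrightarrow> pmf (g b) x = 0"
  shows "pmf (bind_pmf p g) x = pmf p a * pmf (g a) x"
proof -
  have "pmf (bind_pmf p g) x = (\<integral>b. indicator {a} b * pmf (g a) x \<partial>measure_pmf p)"
    unfolding pmf_bind using assms by (intro Bochner_Integration.integral_cong) (auto simp: indicator_def)
  then show ?thesis by (simp add: pmf.rep_eq)
qed

section \<open>Uniform trees\<close>

locale tree =
  fixes \<T> :: "'v::finite rooted_tree" and L :: nat
  assumes uniform: "uniform_tree \<T> L"
begin

abbreviation "par \<equiv> tree_parent \<T>"
abbreviation "rt \<equiv> tree_root \<T>"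
abbreviation "A \<equiv> leaves \<T>"

lemma parent_root: "par rt = rt"
  and ancestor_root: "ancestor \<T> rt v"
  and L_pos: "1 \<le> L"
  and depth_leaf: "a \<in> A \<Longrightarrow> depth \<T> a = L"
  using uniform by (auto simp: uniform_tree_def)

lemma depth_reaches_root: "(par ^^ depth \<T> v) v = rt"
  using ancestor_root[of v] unfolding depth_def ancestor_def by (rule LeastI_ex)

lemma depth_le: "(par ^^ n) v = rt \<Longrightarrow> depth \<T> v \<le> n"
  unfolding depth_def by (rule Least_le)

lemma depth_root: "depth \<T> rt = 0"
  using depth_le[of 0 rt] by simp

lemma depth_eq_0_iff: "depth \<T> v = 0 \<longleftrightarrow> v = rt"
  using depth_reaches_root[of v] depth_root by auto

lemma depth_parent: "depth \<T> (par v) = depth \<T> v - 1"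
proof (cases "v = rt")
  case True
  then show ?thesis by (simp add: parent_root depth_root)
next
  case False
  then obtain n where n: "depth \<T> v = Suc n"
    using depth_eq_0_iff not0_implies_Suc by blast
  have "(par ^^ n) (par v) = rt"
    using depth_reaches_root[of v] n by (simp add: funpow_swap1)
  then have "depth \<T> (par v) \<le> n" by (rule depth_le)
  moreover have "(par ^^ Suc (depth \<T> (par v))) v = rt"
    using depth_reaches_root[of "par v"] by (simp add: funpow_swap1)
  then have "depth \<T> v \<le> Suc (depth \<T> (par v))" by (rule depth_le)
  ultimately show ?thesis using n by simp
qed

lemma depth_funpow_parent: "depth \<T> ((par ^^ n) v) = depth \<T> v - n"
  by (induction n) (auto simp: depth_parent)

lemma leaves_below_nonempty: "leaves_below \<T> v \<noteq> {}"
\<comment> \<open>Downward induction: the node type is finite, so depths are bounded, and a node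
  that is not a leaf has a child one level deeper.\<close>
proof (induction "Max (range (depth \<T>)) - depth \<T> v" arbitrary: v rule: less_induct)
  case less
  show ?case
  proof (cases "v \<in> A")
    case True
    moreover have "ancestor \<T> v v" unfolding ancestor_def by (rule exI[of _ 0]) simp
    ultimately show ?thesis by (auto simp: leaves_below_def)
  next
    case False
    then obtain w where w: "w \<noteq> rt" "par w = v" by (auto simp: leaves_def)
    have "depth \<T> w \<le> Max (range (depth \<T>))" by (rule Max_ge) auto
    moreover have "depth \<T> w = Suc (depth \<T> v)"
      using depth_parent[of w] depth_eq_0_iff[of w] w by simp
    ultimately obtain a where a: "a \<in> leaves_below \<T> w" using less[of w] by fastforce
    then obtain n where "(par ^^ n) a = w" by (auto simp: leaves_below_def ancestor_def)
    then have "(par ^^ Suc n) a = v" using w by simp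
    then have "ancestor \<T> v a" unfolding ancestor_def by blast
    then show ?thesis using a by (auto simp: leaves_below_def)
  qed
qed

lemma leaves_nonempty: "A \<noteq> {}"
  using leaves_below_nonempty by (auto simp: leaves_below_def)

lemma anc_eq_funpow:
  assumes "j \<le> depth \<T> w"
  shows "anc \<T> j w = (par ^^ (depth \<T> w - j)) w"
  unfolding anc_def
proof (rule the_equality)
  show "(par ^^ (depth \<T> w - j)) w \<in> level \<T> j \<and> ancestor \<T> ((par ^^ (depth \<T> w - j)) w) w"
    using assms by (auto simp: level_def depth_funpow_parent ancestor_def)
next
  fix v assume "v \<in> level \<T> j \<and> ancestor \<T> v w"
  then obtain n where n: "v = (par ^^ n) w" and j: "depth \<T> w - n = j"
    by (auto simp: level_def ancestor_def depth_funpow_parent)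
  show "v = (par ^^ (depth \<T> w - j)) w"
  proof (cases "n \<le> depth \<T> w")
    case True
    then have "depth \<T> w - j = n" using j by simp
    then show ?thesis using n by simp
  next
    case False
    \<comment> \<open>Since the root is its own parent, iterating beyond the depth of
      \<open>w\<close> still yields an ancestor, namely the root; truncated subtraction confines
      this case to depth 0.\<close>
    then have "j = 0" using j by simp
    moreover have "v = rt"
      using n j \<open>j = 0\<close> depth_eq_0_iff[of v] depth_funpow_parent by simp
    ultimately show ?thesis using depth_reaches_root by simp
  qed
qed

lemma anc_leaf: "a \<in> A \<Longrightarrow> j \<le> L \<Longrightarrow> anc \<T> j a = (par ^^ (L - j)) a"
  using anc_eq_funpow depth_leaf by simp

lemma anc_in_level: "a \<in> A \<Longrightarrow> j \<le> L \<Longrightarrow> anc \<T> j a \<in> level \<T> j"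
  by (simp add: anc_leaf level_def depth_funpow_parent depth_leaf)

lemma anc_L: "a \<in> A \<Longrightarrow> anc \<T> L a = a"
  by (simp add: anc_leaf)

lemma anc_anc:
  assumes "a \<in> A" "i \<le> j" "j \<le> L"
  shows "anc \<T> i a = (par ^^ (j - i)) (anc \<T> j a)"
proof -
  have "par ^^ (L - i) = par ^^ (j - i) \<circ> par ^^ (L - j)"
    using assms funpow_add[of "j - i" "L - j" par] by simp
  then show ?thesis using assms by (simp add: anc_leaf)
qed

lemma same_anc_mono:
  "a \<in> A \<Longrightarrow> b \<in> A \<Longrightarrow> i \<le> j \<Longrightarrow> j \<le> L \<Longrightarrow> same_anc \<T> j a b \<Longrightarrow> same_anc \<T> i a b"
  by (simp add: same_anc_def anc_anc[of _ i j])

lemma leaves_below_level: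
  assumes "v \<in> level \<T> j" "j \<le> L"
  shows "leaves_below \<T> v = {a \<in> A. anc \<T> j a = v}"
proof -
  have "ancestor \<T> v a \<longleftrightarrow> anc \<T> j a = v" if a: "a \<in> A" for a
  proof
    assume anc: "ancestor \<T> v a"
    then obtain n where n: "(par ^^ n) a = v" by (auto simp: ancestor_def)
    then have j: "L - n = j" using assms a by (auto simp: level_def depth_funpow_parent depth_leaf)
    show "anc \<T> j a = v"
    proof (cases "n \<le> L")
      case True
      then have "L - j = n" using j by simp
      then show ?thesis using n a assms by (simp add: anc_leaf)
    next
      case False
      then have "j = 0" using j by simp
      then have "v = rt" using assms depth_eq_0_iff by (auto simp: level_def)
      then show ?thesis using \<open>j = 0\<close> a depth_reaches_root[of a] by (simp add: anc_leaf depth_leaf)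
    qed
  next
    assume "anc \<T> j a = v"
    then show "ancestor \<T> v a" using a assms by (auto simp: anc_leaf ancestor_def)
  qed
  then show ?thesis by (auto simp: leaves_below_def)
qed

lemma level_L: "level \<T> L = A"
proof (intro equalityI subsetI)
  fix v assume v: "v \<in> level \<T> L"
  obtain a where "a \<in> leaves_below \<T> v" using leaves_below_nonempty by auto
  then show "v \<in> A" using leaves_below_level[OF v] anc_L by auto
qed (auto simp: level_def depth_leaf)

lemma leaves_below_leaf: "a \<in> A \<Longrightarrow> leaves_below \<T> a = {a}"
  using leaves_below_level[of a L] anc_L by (auto simp: level_L)

lemma mass_level:
  "v \<in> level \<T> j \<Longrightarrow> j \<le> L \<Longrightarrow> mass \<T> x v = (\<Sum>a | a \<in> A \<and> anc \<T> j a = v. x a)"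
  by (simp add: mass_def leaves_below_level)

lemma sum_anc:
  fixes f :: "'v \<Rightarrow> 'v \<Rightarrow> real"
  assumes "j \<le> L"
  shows "(\<Sum>v\<in>level \<T> j. \<Sum>a | a \<in> A \<and> anc \<T> j a = v. f v a) = (\<Sum>a\<in>A. f (anc \<T> j a) a)"
proof -
  have "(\<Sum>v\<in>level \<T> j. \<Sum>a | a \<in> A \<and> anc \<T> j a = v. f v a)
      = (\<Sum>v\<in>level \<T> j. \<Sum>a | a \<in> A \<and> anc \<T> j a = v. f (anc \<T> j a) a)"
    by (intro sum.cong refl) auto
  also have "\<dots> = (\<Sum>a\<in>A. f (anc \<T> j a) a)"
    using assms by (intro sum.group) (auto simp: anc_in_level)
  finally show ?thesis .
qed

lemma sum_mass: "j \<le> L \<Longrightarrow> (\<Sum>v\<in>level \<T> j. f v * mass \<T> x v) = (\<Sum>a\<in>A. f (anc \<T> j a) * x a)"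
  using sum_anc[of j "\<lambda>v a. f v * x a"] by (simp add: mass_level sum_distrib_left)

lemma similarity_ge:
  assumes "same_anc \<T> j a b" "j \<le> L"
  shows "Suc j \<le> similarity \<T> L a b"
  using assms unfolding similarity_def by (auto intro!: Max_ge)

lemma similarity_le:
  assumes "a \<in> A" "b \<in> A" shows "similarity \<T> L a b \<le> L + 1"
proof -
  have "anc \<T> 0 a = rt" if "a \<in> A" for a
    using that anc_in_level[of a 0] depth_eq_0_iff by (auto simp: level_def)
  \<comment> \<open>Keeps \<open>Max\<close> away from the empty set: any two leaves share the
    root.\<close>
  then have "0 \<in> {j \<in> {0..L}. same_anc \<T> j a b}" using assms by (simp add: same_anc_def)
  then have "Max {j \<in> {0..L}. same_anc \<T> j a b} \<in> {j \<in> {0..L}. same_anc \<T> j a b}"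
    by (intro Max_in) auto
  then show ?thesis unfolding similarity_def by auto
qed

end

section \<open>The regularised leader\<close>

locale tree_algorithm = tree \<T> L
  for \<T> :: "'v::finite rooted_tree" and L :: nat +
  fixes \<sigma> :: "nat \<Rightarrow> real" and \<delta> :: "nat pmf"
  assumes \<sigma>_antimono: "\<And>i j. 1 \<le> i \<Longrightarrow> i \<le> j \<Longrightarrow> j \<le> L \<Longrightarrow> \<sigma> j \<le> \<sigma> i"
    and \<sigma>_L: "\<sigma> L > 0"
    and \<sigma>_last: "\<sigma> (L + 1) = 0"
    and \<delta>_support: "set_pmf \<delta> = {1..L}"
begin

abbreviation M :: "'v pmf \<Rightarrow> 'v \<Rightarrow> real" where "M p v \<equiv> mass \<T> (pmf p) v"
abbreviation P :: "nat \<Rightarrow> ('v \<Rightarrow> real) \<Rightarrow> 'v pmf" where "P \<equiv> ftrl_point \<T> L \<sigma> \<delta>"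
abbreviation \<psi> :: "nat \<Rightarrow> 'v pmf \<Rightarrow> real" where "\<psi> \<equiv> regularizer \<T> L \<sigma> \<delta>"

definition linear :: "('v \<Rightarrow> real) \<Rightarrow> 'v pmf \<Rightarrow> real" where
  "linear z p = (\<Sum>a\<in>A. z a * pmf p a)"

definition objective :: "nat \<Rightarrow> ('v \<Rightarrow> real) \<Rightarrow> 'v pmf \<Rightarrow> real" where
  "objective t Z p = linear Z p + \<psi> t p"

definition scale :: "nat \<Rightarrow> nat \<Rightarrow> real" where
  "scale t j = 2 * sqrt 6 * (\<sigma> j / sqrt (pmf \<delta> j)) * sqrt (max (real t) (6 / pmf \<delta> j))"

definition rate :: "nat \<Rightarrow> real" where
  "rate j = \<sigma> j / sqrt (pmf \<delta> j)"

section \<open>Coefficients of the regularizer\<close>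

lemma \<sigma>_pos: "j \<in> {1..L} \<Longrightarrow> \<sigma> j > 0"
  using \<sigma>_antimono[of j L] \<sigma>_L by auto

lemma \<delta>_pos: "j \<in> {1..L} \<Longrightarrow> pmf \<delta> j > 0"
  using \<delta>_support by (intro pmf_positive) auto

lemma rate_pos: "j \<in> {1..L} \<Longrightarrow> rate j > 0"
  using \<sigma>_pos \<delta>_pos by (simp add: rate_def)

lemma scale_pos: "j \<in> {1..L} \<Longrightarrow> scale t j > 0"
  using \<sigma>_pos[of j] \<delta>_pos[of j] by (simp add: scale_def less_max_iff_disj)

text \<open>One bound for each argument of the maximum. The constant floor, with
  \<open>2 * sqrt 6 * sqrt 6 = 12\<close>, validates the stability estimate; the growing argument
  gives the decay of the round costs like \<open>1 / sqrt t\<close>.\<close>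

lemma scale_lower_bounds:
  assumes j: "j \<in> {1..L}"
  shows "12 * \<sigma> j / pmf \<delta> j \<le> scale t j" "2 * sqrt 6 * rate j * sqrt (real t) \<le> scale t j"
proof -
  have pos: "0 \<le> 2 * sqrt 6 * (\<sigma> j / sqrt (pmf \<delta> j))"
    using \<sigma>_pos[OF j] \<delta>_pos[OF j] by simp
  have "12 * \<sigma> j / pmf \<delta> j = 2 * sqrt 6 * (\<sigma> j / sqrt (pmf \<delta> j)) * sqrt (6 / pmf \<delta> j)"
    using \<delta>_pos[OF j] by (simp add: real_sqrt_divide field_simps)
  also have "\<dots> \<le> scale t j"
    unfolding scale_def using pos by (intro mult_left_mono) auto
  finally show "12 * \<sigma> j / pmf \<delta> j \<le> scale t j" .
  show "2 * sqrt 6 * rate j * sqrt (real t) \<le> scale t j"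
    unfolding scale_def rate_def using pos by (intro mult_left_mono) auto
qed

lemma scale_1: "j \<in> {1..L} \<Longrightarrow> scale 1 j = 12 * (\<sigma> j / pmf \<delta> j)"
proof -
  assume j: "j \<in> {1..L}"
  have "pmf \<delta> j \<le> 1" by (rule pmf_le_1)
  then have "max (real 1) (6 / pmf \<delta> j) = 6 / pmf \<delta> j"
    using \<delta>_pos[OF j] by (simp add: max_def field_simps)
  then have "scale 1 j = 2 * sqrt 6 * (\<sigma> j / sqrt (pmf \<delta> j)) * sqrt (6 / pmf \<delta> j)"
    unfolding scale_def by simp
  then show ?thesis
    using \<delta>_pos[OF j] by (simp add: real_sqrt_divide field_simps)
qed

text \<open>Taking the maximum with a constant can only flatten the growth of
  \<open>sqrt t\<close>.\<close>

lemma scale_diff: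
  assumes j: "j \<in> {1..L}"
  shows "scale t j \<le> scale (Suc t) j"
    "scale (Suc t) j - scale t j \<le> 2 * sqrt 6 * rate j * (sqrt (Suc t) - sqrt t)"
proof -
  let ?b = "6 / pmf \<delta> j"
  have pos: "0 \<le> 2 * sqrt 6 * rate j" using rate_pos[OF j] by simp
  have eq: "scale t j = 2 * sqrt 6 * rate j * sqrt (max (real t) ?b)" for t
    by (simp add: scale_def rate_def)
  show "scale t j \<le> scale (Suc t) j"
    unfolding eq using pos by (intro mult_left_mono) auto
  have "sqrt (max (real (Suc t)) ?b) - sqrt (max (real t) ?b) \<le> sqrt (Suc t) - sqrt t"
    by (cases "?b \<le> real t") (auto simp: max_def)
  then have "2 * sqrt 6 * rate j * (sqrt (max (real (Suc t)) ?b) - sqrt (max (real t) ?b))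
      \<le> 2 * sqrt 6 * rate j * (sqrt (Suc t) - sqrt t)"
    using pos by (intro mult_left_mono)
  then show "scale (Suc t) j - scale t j \<le> 2 * sqrt 6 * rate j * (sqrt (Suc t) - sqrt t)"
    unfolding eq by (simp add: algebra_simps)
qed

lemma regularizer_eq: "\<psi> t p = (\<Sum>j=1..L. scale t j * (\<Sum>v\<in>level \<T> j. M p v - sqrt (M p v)))"
  unfolding regularizer_def by (simp add: scale_def sum_distrib_left mult.assoc)

lemma M_nonneg: "0 \<le> M p v"
  unfolding mass_def by (intro sum_nonneg) simp

lemma sum_pmf_leaves: "set_pmf p \<subseteq> A \<Longrightarrow> (\<Sum>a\<in>A. pmf p a) = 1"
  by (rule sum_pmf_eq_1) auto

lemma sum_M: "set_pmf p \<subseteq> A \<Longrightarrow> j \<le> L \<Longrightarrow> (\<Sum>v\<in>level \<T> j. M p v) = 1"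
  using sum_mass[of j "\<lambda>_. 1" "pmf p"] sum_pmf_leaves by simp

lemma M_le_1: "set_pmf p \<subseteq> A \<Longrightarrow> M p v \<le> 1"
  unfolding mass_def using sum_mono2[of A "leaves_below \<T> v" "pmf p"] sum_pmf_leaves[of p]
  by (auto simp: leaves_below_def)

lemma M_leaf: "a \<in> A \<Longrightarrow> M p a = pmf p a"
  by (simp add: mass_def leaves_below_leaf)

lemma M_return: "M (return_pmf a) v \<in> {0, 1}"
  by (simp add: mass_def leaves_below_def indicator_def sum.If_cases)

text \<open>The masses of a point mass are 0 or 1, where \<open>x - sqrt x\<close> vanishes. On the
  simplex the linear part of the regularizer is a constant; it normalises all vertices to 0, so a
  comparator leaf pays no regularisation.\<close>

lemma regularizer_return: "\<psi> t (return_pmf a) = 0"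
proof -
  have "M (return_pmf a) v - sqrt (M (return_pmf a) v) = 0" for v
    using M_return[of a v] by auto
  then show ?thesis by (simp add: regularizer_eq)
qed

lemma regularizer_eq_sqrt:
  assumes "set_pmf p \<subseteq> A"
  shows "\<psi> t p = (\<Sum>j=1..L. scale t j) - (\<Sum>j=1..L. scale t j * (\<Sum>v\<in>level \<T> j. sqrt (M p v)))"
  using assms by (simp add: regularizer_eq sum_subtractf sum_M right_diff_distrib)

lemma M_convex_combination:
  assumes "\<And>a. pmf r a = (1 - \<epsilon>) * pmf p a + \<epsilon> * pmf q a"
  shows "M r v = (1 - \<epsilon>) * M p v + \<epsilon> * M q v"
  by (simp add: mass_def assms sum.distrib sum_distrib_left)

lemma linear_convex_combination:
  assumes "\<And>a. pmf r a = (1 - \<epsilon>) * pmf p a + \<epsilon> * pmf q a"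
  shows "linear Z r = (1 - \<epsilon>) * linear Z p + \<epsilon> * linear Z q"
  by (simp add: linear_def assms sum.distrib sum_distrib_left distrib_left mult.left_commute)

lemma convex_combination_exists:
  assumes "0 \<le> \<epsilon>" "\<epsilon> \<le> 1" "set_pmf p \<subseteq> A" "set_pmf q \<subseteq> A"
  obtains r where "set_pmf r \<subseteq> A" "\<And>a. pmf r a = (1 - \<epsilon>) * pmf p a + \<epsilon> * pmf q a"
proof -
  have "pmf p a = 0" "pmf q a = 0" if "a \<notin> A" for a
    using assms that by (auto simp: pmf_eq_0_set_pmf)
  then have "\<exists>r. set_pmf r \<subseteq> A \<and> (\<forall>a. pmf r a = (1 - \<epsilon>) * pmf p a + \<epsilon> * pmf q a)"
    using assms
    by (intro pmf_of_function)
       (auto simp: sum.distrib sum_distrib_left[symmetric] sum_pmf_leaves)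
  then show ?thesis using that by blast
qed

section \<open>Existence, interiority and strong convexity of the minimiser\<close>

text \<open>The mass functions are transported to the compact simplex in \<open>real^'v\<close>,
  where the continuous objective attains its infimum.\<close>

lemma minimiser_exists:
  "\<exists>p. set_pmf p \<subseteq> A \<and> (\<forall>q. set_pmf q \<subseteq> A \<longrightarrow> objective t Z p \<le> objective t Z q)"
proof -
  define S where "S = {x::real^'v. (\<forall>a. 0 \<le> x $ a) \<and> (\<forall>a. a \<notin> A \<longrightarrow> x $ a = 0) \<and> (\<Sum>a\<in>A. x $ a) = 1}"
  define f where "f x = (\<Sum>a\<in>A. Z a * x $ a)
      + (\<Sum>j=1..L. scale t j * (\<Sum>v\<in>level \<T> j. mass \<T> (\<lambda>a. x $ a) v - sqrt (mass \<T> (\<lambda>a. x $ a) v)))"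
    for x :: "real^'v"
  have f_eq: "f x = objective t Z p" if "\<And>a. pmf p a = x $ a" for x p
  proof -
    have "(\<lambda>a. x $ a) = pmf p" using that by auto
    then show ?thesis by (simp add: f_def objective_def linear_def regularizer_eq)
  qed
  have "closed S"
    unfolding S_def
    by (intro closed_Collect_conj closed_Collect_all closed_Collect_imp closed_Collect_le
          closed_Collect_eq open_Collect_const continuous_intros)
  moreover have "bounded S"
  proof (rule boundedI)
    fix x assume x: "x \<in> S"
    have "norm x \<le> (\<Sum>a\<in>UNIV. \<bar>x $ a\<bar>)" by (rule norm_le_l1_cart)
    also have "\<dots> = (\<Sum>a\<in>A. \<bar>x $ a\<bar>)"
      using x by (intro sum.mono_neutral_right) (auto simp: S_def)
    also have "\<dots> = 1" using x by (simp add: S_def)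
    finally show "norm x \<le> 1" .
  qed
  ultimately have "compact S" by (simp add: compact_eq_bounded_closed)
  moreover have "continuous_on S f"
    unfolding f_def mass_def by (intro continuous_intros)
  moreover have "(\<chi> a. pmf p a) \<in> S" if "set_pmf p \<subseteq> A" for p
    using that by (auto simp: S_def sum_pmf_leaves pmf_eq_0_set_pmf)
  note in_S = this
  moreover obtain a where "a \<in> A" using leaves_nonempty by auto
  then have "(\<chi> b. pmf (return_pmf a) b) \<in> S" by (intro in_S) auto
  then have "S \<noteq> {}" by blast
  ultimately obtain x where x: "x \<in> S" "\<And>y. y \<in> S \<Longrightarrow> f x \<le> f y"
    using continuous_attains_inf by metis
  then obtain p where p: "set_pmf p \<subseteq> A" "\<And>a. pmf p a = x $ a"
    using pmf_of_function[of "\<lambda>a. x $ a" A] by (auto simp: S_def)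
  have "objective t Z p \<le> objective t Z q" if q: "set_pmf q \<subseteq> A" for q
    using x(2)[OF in_S[OF q]] f_eq[OF p(2)] f_eq[of q "\<chi> a. pmf q a"] by simp
  then show ?thesis using p by blast
qed

text \<open>\<open>arg_min\<close> is defined by choice; existence of a minimiser is what gives the
  chosen point these two properties, through which all later arguments access it.\<close>

lemma ftrl_point_support: "set_pmf (P t Z) \<subseteq> A"
  and ftrl_point_le: "set_pmf q \<subseteq> A \<Longrightarrow> objective t Z (P t Z) \<le> objective t Z q"
proof -
  obtain p where "is_arg_min (objective t Z) (\<lambda>p. set_pmf p \<subseteq> A) p"
    using minimiser_exists[of t Z] by (auto simp: is_arg_min_def not_less)
  then have "is_arg_min (objective t Z) (\<lambda>p. set_pmf p \<subseteq> A) (arg_min (objective t Z) (\<lambda>p. set_pmf p \<subseteq> A))"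
    unfolding arg_min_def by (rule someI)
  moreover have "P t Z = arg_min (objective t Z) (\<lambda>p. set_pmf p \<subseteq> A)"
    unfolding ftrl_point_def objective_def[abs_def] linear_def by simp
  ultimately have "is_arg_min (objective t Z) (\<lambda>p. set_pmf p \<subseteq> A) (P t Z)" by simp
  then show "set_pmf (P t Z) \<subseteq> A"
    and "set_pmf q \<subseteq> A \<Longrightarrow> objective t Z (P t Z) \<le> objective t Z q"
    by (auto simp: is_arg_min_def not_less)
qed

text \<open>The square root at the leaf level has infinite slope at 0, so the minimiser is interior.\<close>

lemma ftrl_point_pos:
  assumes a: "a \<in> A"
  shows "0 < pmf (P t Z) a"
proof (rule ccontr)
  define p where "p = P t Z"
  assume "\<not> 0 < pmf (P t Z) a"
  then have pa: "pmf p a = 0" using pmf_nonneg[of p a] unfolding p_def by linarith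
  have p: "set_pmf p \<subseteq> A" by (simp add: p_def ftrl_point_support)
  define C where "C = linear Z (return_pmf a) - linear Z p
      + (\<Sum>j=1..L. scale t j * (\<Sum>v\<in>level \<T> j. sqrt (M p v)))"
  \<comment> \<open>Chosen so that \<open>s * (\<bar>C\<bar> + 1)\<close> is at most half of
    \<open>scale t L\<close>, which contradicts the first-order comparison below.\<close>
  define s where "s = min 1 (scale t L / (2 * (\<bar>C\<bar> + 1)))"
  have L: "L \<in> {1..L}" using L_pos by simp
  have cL: "0 < scale t L" by (rule scale_pos[OF L])
  have s: "0 < s" "s \<le> 1" using cL by (auto simp: s_def)
  have s2: "s\<^sup>2 \<le> 1" using s by (simp add: power_le_one)
  \<comment> \<open>The weight moved to the missing leaf is \<open>s\<^sup>2\<close>: the square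
    root at that leaf then gains \<open>s\<close>, of first order, while all other changes are of
    order \<open>s\<^sup>2\<close>.\<close>
  obtain r where r: "set_pmf r \<subseteq> A" "\<And>b. pmf r b = (1 - s\<^sup>2) * pmf p b + s\<^sup>2 * pmf (return_pmf a) b"
    using convex_combination_exists[of "s\<^sup>2" p "return_pmf a"] s2 p a by auto
  note M_r = M_convex_combination[OF r(2)]
  define h where "h v = (if v = a then s else 0)" for v
  \<comment> \<open>Uses \<open>1 - s\<^sup>2\<close> as a crude lower bound for its own square
    root; the loss is again only of order \<open>s\<^sup>2\<close>.\<close>
  have root_ge: "(1 - s\<^sup>2) * sqrt (M p v) \<le> sqrt (M r v)" for v
  proof -
    have "(1 - s\<^sup>2) * (1 - s\<^sup>2) \<le> 1 - s\<^sup>2" using s2 by (simp add: mult_left_le_one_le)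
    then have "((1 - s\<^sup>2) * (1 - s\<^sup>2)) * M p v \<le> (1 - s\<^sup>2) * M p v"
      by (intro mult_right_mono M_nonneg)
    also have "\<dots> \<le> M r v" using M_nonneg[of "return_pmf a" v] by (simp add: M_r)
    finally have "sqrt (((1 - s\<^sup>2) * (1 - s\<^sup>2)) * M p v) \<le> sqrt (M r v)" by simp
    then show ?thesis using s2 by (simp add: real_sqrt_mult)
  qed
  have level_ge: "(1 - s\<^sup>2) * (\<Sum>v\<in>level \<T> j. sqrt (M p v)) + (if j = L then s else 0)
      \<le> (\<Sum>v\<in>level \<T> j. sqrt (M r v))" if j: "j \<in> {1..L}" for j
  proof (cases "j = L")
    case False
    then show ?thesis by (simp add: sum_distrib_left sum_mono root_ge)
  next
    case True
    have "M r a = s\<^sup>2" "M p a = 0" using a pa by (simp_all add: M_r M_leaf)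
    then have "(1 - s\<^sup>2) * sqrt (M p v) + h v \<le> sqrt (M r v)" for v
      using s root_ge[of v] by (auto simp: h_def)
    then have "(\<Sum>v\<in>A. (1 - s\<^sup>2) * sqrt (M p v) + h v) \<le> (\<Sum>v\<in>A. sqrt (M r v))"
      by (intro sum_mono) auto
    moreover have "(\<Sum>v\<in>A. h v) = s" using a by (simp add: h_def)
    ultimately show ?thesis using True by (simp add: level_L sum.distrib sum_distrib_left)
  qed
  have "(\<Sum>j=1..L. scale t j * ((1 - s\<^sup>2) * (\<Sum>v\<in>level \<T> j. sqrt (M p v)) + (if j = L then s else 0)))
      \<le> (\<Sum>j=1..L. scale t j * (\<Sum>v\<in>level \<T> j. sqrt (M r v)))"
    using level_ge scale_pos by (intro sum_mono mult_left_mono) (auto simp: less_imp_le)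
  moreover have "(\<Sum>j=1..L. scale t j * ((1 - s\<^sup>2) * (\<Sum>v\<in>level \<T> j. sqrt (M p v)) + (if j = L then s else 0)))
      = (1 - s\<^sup>2) * (\<Sum>j=1..L. scale t j * (\<Sum>v\<in>level \<T> j. sqrt (M p v))) + scale t L * s"
  proof -
    have "(\<Sum>j=1..L. scale t j * (if j = L then s else 0)) = scale t L * s"
      using L by (simp add: if_distrib[of "\<lambda>x. scale t _ * x"] cong: if_cong)
    then show ?thesis by (simp add: distrib_left sum.distrib sum_distrib_left mult.left_commute)
  qed
  moreover have "objective t Z p \<le> objective t Z r"
    unfolding p_def by (rule ftrl_point_le[OF r(1)])
  ultimately have "0 \<le> s\<^sup>2 * C - scale t L * s"
    unfolding objective_def C_def regularizer_eq_sqrt[OF p] regularizer_eq_sqrt[OF r(1)]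
      linear_convex_combination[OF r(2)] by (simp add: algebra_simps)
  then have "scale t L * s \<le> (s * C) * s" by (simp add: power2_eq_square mult_ac)
  then have "scale t L \<le> s * C" using s by (simp add: mult.commute)
  also have "\<dots> \<le> s * (\<bar>C\<bar> + 1)" using s by (intro mult_left_mono) auto
  also have "\<dots> \<le> scale t L / (2 * (\<bar>C\<bar> + 1)) * (\<bar>C\<bar> + 1)"
    by (intro mult_right_mono) (auto simp: s_def)
  also have "\<dots> = scale t L / 2" by (simp add: field_simps)
  finally show False using cL by simp
qed

lemma M_ftrl_point_pos: "0 < M (P t Z) v"
proof -
  have "0 < (\<Sum>a\<in>leaves_below \<T> v. pmf (P t Z) a)"
    using leaves_below_nonempty ftrl_point_pos by (intro sum_pos) (auto simp: leaves_below_def)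
  then show ?thesis by (simp add: mass_def)
qed

text \<open>
  Comparing the interior minimiser \<open>p\<close> with \<open>p + \<epsilon> (q - p)\<close> as \<open>\<epsilon>\<close> tends to 0 shows that the
  linear part \<open>G\<close> of the increment is nonnegative, and what remains is the divergence.
\<close>

lemma objective_ge_bregman:
  fixes t :: nat and Z :: "'v \<Rightarrow> real"
  assumes q: "set_pmf q \<subseteq> A"
  defines "p \<equiv> P t Z"
  shows "(\<Sum>j=1..L. scale t j * (\<Sum>v\<in>level \<T> j. sqrt_bregman (M q v) (M p v)))
      \<le> objective t Z q - objective t Z p"
proof -
  have p: "set_pmf p \<subseteq> A" by (simp add: p_def ftrl_point_support)
  have p_pos: "0 < M p v" for v by (simp add: p_def M_ftrl_point_pos)
  define g where "g v = (M q v - M p v) / (2 * sqrt (M p v))" for v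
  define k where "k v = (M q v - M p v)\<^sup>2 / (2 * M p v * sqrt (M p v))" for v
  define G where "G = linear Z q - linear Z p - (\<Sum>j=1..L. scale t j * (\<Sum>v\<in>level \<T> j. g v))"
  define C where "C = (\<Sum>j=1..L. scale t j * (\<Sum>v\<in>level \<T> j. k v))"
  have "0 \<le> G"
  proof (rule nonneg_of_quadratic)
    fix \<epsilon> :: real assume \<epsilon>: "0 < \<epsilon>" "\<epsilon> \<le> 1"
    obtain r where r: "set_pmf r \<subseteq> A" "\<And>b. pmf r b = (1 - \<epsilon>) * pmf p b + \<epsilon> * pmf q b"
      using convex_combination_exists[of \<epsilon> p q] \<epsilon> p q by (auto simp: less_imp_le)
    have "sqrt (M p v) + \<epsilon> * g v - \<epsilon>\<^sup>2 * k v \<le> sqrt (M r v)" for v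
    proof -
      have "M r v - M p v = \<epsilon> * (M q v - M p v)"
        by (simp add: M_convex_combination[OF r(2)] algebra_simps)
      then show ?thesis
        using sqrt_quadratic_lower_bound[OF p_pos[of v] M_nonneg[of r v]]
        by (simp add: g_def k_def power_mult_distrib)
    qed
    then have "(\<Sum>j=1..L. scale t j * (\<Sum>v\<in>level \<T> j. sqrt (M p v) + \<epsilon> * g v - \<epsilon>\<^sup>2 * k v))
        \<le> (\<Sum>j=1..L. scale t j * (\<Sum>v\<in>level \<T> j. sqrt (M r v)))"
      using scale_pos by (intro sum_mono mult_left_mono) (auto simp: less_imp_le)
    moreover have "(\<Sum>j=1..L. scale t j * (\<Sum>v\<in>level \<T> j. sqrt (M p v) + \<epsilon> * g v - \<epsilon>\<^sup>2 * k v))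
        = (\<Sum>j=1..L. scale t j * (\<Sum>v\<in>level \<T> j. sqrt (M p v)))
          + \<epsilon> * (\<Sum>j=1..L. scale t j * (\<Sum>v\<in>level \<T> j. g v)) - \<epsilon>\<^sup>2 * C"
      by (simp add: C_def sum.distrib sum_subtractf sum_distrib_left right_diff_distrib
            distrib_left mult.left_commute)
    moreover have "objective t Z p \<le> objective t Z r"
      unfolding p_def by (rule ftrl_point_le[OF r(1)])
    ultimately show "0 \<le> \<epsilon> * G + \<epsilon>\<^sup>2 * C"
      unfolding objective_def regularizer_eq_sqrt[OF p] regularizer_eq_sqrt[OF r(1)]
        linear_convex_combination[OF r(2)] G_def by (simp add: algebra_simps)
  qed
  moreover have "sqrt_bregman (M q v) (M p v) = sqrt (M p v) - sqrt (M q v) + g v" for v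
    unfolding g_def by (rule sqrt_bregman_eq[OF M_nonneg p_pos])
  then have "(\<Sum>j=1..L. scale t j * (\<Sum>v\<in>level \<T> j. sqrt_bregman (M q v) (M p v)))
      = (\<Sum>j=1..L. scale t j * (\<Sum>v\<in>level \<T> j. sqrt (M p v)))
        - (\<Sum>j=1..L. scale t j * (\<Sum>v\<in>level \<T> j. sqrt (M q v)))
        + (\<Sum>j=1..L. scale t j * (\<Sum>v\<in>level \<T> j. g v))"
    by (simp add: sum.distrib sum_subtractf right_diff_distrib distrib_left)
  ultimately show ?thesis
    unfolding objective_def regularizer_eq_sqrt[OF p] regularizer_eq_sqrt[OF q] G_def by simp
qed

section \<open>Continuous and measurable dependence of the leader on the estimates\<close>

text \<open>The leaf level alone makes the objective strongly convex in the roots of the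
  probabilities. Comparing each of the two minimisers with the other cancels the regularizer and
  leaves \<open>\<langle>Z - Z', p' - p\<rangle>\<close>. The 16 is a factor 4 from that comparison
  times a factor 4 for passing from roots to probabilities.\<close>

lemma ftrl_point_lipschitz:
  assumes a: "a \<in> A"
  shows "(pmf (P t Z') a - pmf (P t Z) a)\<^sup>2 \<le> 16 / (scale t L)\<^sup>2 * (\<Sum>b\<in>A. (Z' b - Z b)\<^sup>2)"
proof -
  let ?c = "scale t L"
  have L: "L \<in> {1..L}" using L_pos by simp
  have c: "0 < ?c" by (rule scale_pos[OF L])
  define D where "D p q = (\<Sum>b\<in>A. (sqrt (pmf q b) - sqrt (pmf p b))\<^sup>2)" for p q :: "'v pmf"
  have strong: "?c / 2 * D (P t Z) q \<le> objective t Z q - objective t Z (P t Z)"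
    if q: "set_pmf q \<subseteq> A" for Z q
  proof -
    have "sqrt_bregman x y \<ge> 0" if "y \<ge> 0" for x y
      using that by (simp add: sqrt_bregman_def)
    then have nonneg: "0 \<le> scale t j * (\<Sum>v\<in>level \<T> j. sqrt_bregman (M q v) (M (P t Z) v))"
      if "j \<in> {1..L}" for j
      using scale_pos[OF that] M_nonneg by (intro mult_nonneg_nonneg sum_nonneg) (auto simp: less_imp_le)
    \<comment> \<open>The root in the denominator of the divergence is at most 1.\<close>
    have "1 / 2 * (sqrt (pmf q b) - sqrt (pmf (P t Z) b))\<^sup>2 \<le> sqrt_bregman (M q b) (M (P t Z) b)"
      if "b \<in> A" for b
      using ftrl_point_pos[OF that, of t Z] pmf_le_1[of "P t Z" b]
        mult_right_mono[of "sqrt (pmf (P t Z) b)" 1 "(sqrt (pmf q b) - sqrt (pmf (P t Z) b))\<^sup>2"]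
      by (simp add: sqrt_bregman_def M_leaf[OF that] field_simps)
    then have "1 / 2 * D (P t Z) q \<le> (\<Sum>b\<in>A. sqrt_bregman (M q b) (M (P t Z) b))"
      unfolding D_def sum_distrib_left by (intro sum_mono)
    then have "?c * (1 / 2 * D (P t Z) q)
        \<le> ?c * (\<Sum>v\<in>level \<T> L. sqrt_bregman (M q v) (M (P t Z) v))"
      unfolding level_L using c by (intro mult_left_mono) auto
    also have "\<dots> \<le> (\<Sum>j=1..L. scale t j * (\<Sum>v\<in>level \<T> j. sqrt_bregman (M q v) (M (P t Z) v)))"
      using L nonneg by (intro member_le_sum) auto
    also have "\<dots> \<le> objective t Z q - objective t Z (P t Z)"
      by (rule objective_ge_bregman[OF q])
    finally show ?thesis by simp
  qed
  define d where "d b = sqrt (pmf (P t Z') b) - sqrt (pmf (P t Z) b)" for b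
  have d: "\<bar>pmf (P t Z') b - pmf (P t Z) b\<bar> \<le> 2 * \<bar>d b\<bar>" for b
  proof -
    have "pmf (P t Z') b - pmf (P t Z) b = (sqrt (pmf (P t Z') b) + sqrt (pmf (P t Z) b)) * d b"
      by (simp add: d_def algebra_simps)
    moreover have "\<bar>sqrt (pmf (P t Z') b) + sqrt (pmf (P t Z) b)\<bar> \<le> 1 + 1"
      using pmf_le_1[of "P t Z'" b] pmf_le_1[of "P t Z" b]
        add_mono[of "sqrt (pmf (P t Z') b)" 1 "sqrt (pmf (P t Z) b)" 1]
      by simp
    ultimately show ?thesis by (simp only: abs_mult) (intro mult_right_mono, auto)
  qed
  \<comment> \<open>Sum of the two strong convexity inequalities; the distance is symmetric, hence
    the two equal terms.\<close>
  have "?c / 2 * (\<Sum>b\<in>A. (d b)\<^sup>2) + ?c / 2 * (\<Sum>b\<in>A. (d b)\<^sup>2)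
      \<le> (\<Sum>b\<in>A. (Z b - Z' b) * (pmf (P t Z') b - pmf (P t Z) b))"
    using strong[OF ftrl_point_support[of t Z'], of Z] strong[OF ftrl_point_support[of t Z], of Z']
    by (simp add: D_def d_def objective_def linear_def power2_commute algebra_simps sum.distrib sum_subtractf)
  also have "\<dots> \<le> (\<Sum>b\<in>A. 2 / ?c * (Z' b - Z b)\<^sup>2 + ?c / 2 * (d b)\<^sup>2)"
  proof (rule sum_mono)
    fix b
    have "(Z b - Z' b) * (pmf (P t Z') b - pmf (P t Z) b)
        \<le> \<bar>Z b - Z' b\<bar> * \<bar>pmf (P t Z') b - pmf (P t Z) b\<bar>"
      by (metis abs_ge_self abs_mult)
    also have "\<dots> \<le> \<bar>Z' b - Z b\<bar> * (2 * \<bar>d b\<bar>)"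
      using d[of b] by (simp add: abs_minus_commute mult_left_mono)
    \<comment> \<open>Young's inequality, weighted to absorb exactly one of the two copies of the
      distance.\<close>
    also have "\<dots> = 2 / ?c * \<bar>Z' b - Z b\<bar>\<^sup>2 + ?c / 2 * \<bar>d b\<bar>\<^sup>2
        - (2 * \<bar>Z' b - Z b\<bar> - ?c * \<bar>d b\<bar>)\<^sup>2 / (2 * ?c)"
      using c by (simp add: field_simps power2_diff power2_eq_square)
    also have "\<dots> \<le> 2 / ?c * (Z' b - Z b)\<^sup>2 + ?c / 2 * (d b)\<^sup>2" using c by simp
    finally show "(Z b - Z' b) * (pmf (P t Z') b - pmf (P t Z) b)
        \<le> 2 / ?c * (Z' b - Z b)\<^sup>2 + ?c / 2 * (d b)\<^sup>2" .
  qed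
  also have "\<dots> = 2 / ?c * (\<Sum>b\<in>A. (Z' b - Z b)\<^sup>2) + ?c / 2 * (\<Sum>b\<in>A. (d b)\<^sup>2)"
    by (simp add: sum.distrib sum_distrib_left)
  finally have "?c / 2 * (\<Sum>b\<in>A. (d b)\<^sup>2) \<le> 2 / ?c * (\<Sum>b\<in>A. (Z' b - Z b)\<^sup>2)" by simp
  then have sum_d: "(\<Sum>b\<in>A. (d b)\<^sup>2) \<le> 4 / ?c\<^sup>2 * (\<Sum>b\<in>A. (Z' b - Z b)\<^sup>2)"
    using c by (simp add: field_simps power2_eq_square)
  have "(pmf (P t Z') a - pmf (P t Z) a)\<^sup>2 \<le> (2 * \<bar>d a\<bar>)\<^sup>2"
    using d[of a] by (rule power2_le_iff_abs_le[THEN iffD2, rotated]) simp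
  also have "\<dots> = 4 * (d a)\<^sup>2" by (simp add: power_mult_distrib)
  also have "\<dots> \<le> 4 * (\<Sum>b\<in>A. (d b)\<^sup>2)" using a by (intro mult_left_mono member_le_sum) auto
  also have "\<dots> \<le> 4 * (4 / ?c\<^sup>2 * (\<Sum>b\<in>A. (Z' b - Z b)\<^sup>2))" using sum_d by simp
  finally show ?thesis by simp
qed

lemma continuous_ftrl_point: "continuous_on UNIV (\<lambda>Z. pmf (P t Z) a)"
proof (cases "a \<in> A")
  case False
  then have "pmf (P t Z) a = 0" for Z
    using ftrl_point_support by (auto simp: pmf_eq_0_set_pmf)
  then show ?thesis by simp
next
  case True
  have "((\<lambda>Z'. pmf (P t Z') a) \<longlongrightarrow> pmf (P t Z) a) (at Z)" for Z
  proof -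
    have "continuous_on UNIV (\<lambda>Z' :: 'v \<Rightarrow> real. sqrt (16 / (scale t L)\<^sup>2 * (\<Sum>b\<in>A. (Z' b - Z b)\<^sup>2)))"
      by (intro continuous_intros continuous_on_product_coordinates)
    then have "((\<lambda>Z'. sqrt (16 / (scale t L)\<^sup>2 * (\<Sum>b\<in>A. (Z' b - Z b)\<^sup>2)))
        \<longlongrightarrow> sqrt (16 / (scale t L)\<^sup>2 * (\<Sum>b\<in>A. (Z b - Z b)\<^sup>2))) (at Z)"
      unfolding continuous_on_def by (rule bspec) simp
    then have lim: "((\<lambda>Z'. sqrt (16 / (scale t L)\<^sup>2 * (\<Sum>b\<in>A. (Z' b - Z b)\<^sup>2))) \<longlongrightarrow> 0) (at Z)"
      by simp
    have "((\<lambda>Z'. pmf (P t Z') a - pmf (P t Z) a) \<longlongrightarrow> 0) (at Z)"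
    proof (rule Lim_null_comparison[OF always_eventually lim], intro allI)
      show "norm (pmf (P t Z') a - pmf (P t Z) a) \<le> sqrt (16 / (scale t L)\<^sup>2 * (\<Sum>b\<in>A. (Z' b - Z b)\<^sup>2))" for Z'
        using ftrl_point_lipschitz[OF True, of t Z' Z] by (intro real_le_rsqrt) simp
    qed
    then show ?thesis by (rule LIM_zero_cancel)
  qed
  then show ?thesis by (simp add: continuous_on_def)
qed

text \<open>Continuity is meant in the product topology on functions, for which coordinatewise
  measurability suffices.\<close>

lemma measurable_ftrl_point:
  assumes "\<And>b. (\<lambda>h. Z h b) \<in> borel_measurable N"
  shows "(\<lambda>h. pmf (P t (Z h)) a) \<in> borel_measurable N"
proof -
  have "Z \<in> borel_measurable N"
    using assms by (rule measurable_coordinatewise_then_product)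
  moreover have "(\<lambda>Z. pmf (P t Z) a) \<in> borel_measurable borel"
    by (rule borel_measurable_continuous_onI[OF continuous_ftrl_point])
  ultimately show ?thesis by (rule measurable_compose)
qed

lemma measurable_loss_estimate:
  assumes p: "\<And>b. (\<lambda>h. pmf (p h) b) \<in> borel_measurable N"
    and x: "x \<in> N \<rightarrow>\<^sub>M observation_space"
  shows "(\<lambda>h. loss_estimate \<T> \<sigma> \<delta> (p h) (x h) a) \<in> borel_measurable N"
proof -
  have mass: "(\<lambda>h. M (p h) v) \<in> borel_measurable N" for v
    unfolding mass_def by (intro borel_measurable_sum p)
  have fx: "(\<lambda>h. fst (x h)) \<in> borel_measurable N" and sx: "(\<lambda>h. snd (x h)) \<in> N \<rightarrow>\<^sub>M count_space UNIV"
    using x unfolding observation_space_def by (auto intro: measurable_compose)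
  have u: "(\<lambda>h. fst (fst (x h))) \<in> borel_measurable N" "(\<lambda>h. snd (fst (x h))) \<in> borel_measurable N"
    using measurable_compose[OF fx[folded borel_prod] measurable_fst]
      measurable_compose[OF fx[folded borel_prod] measurable_snd] by auto
  have "(\<lambda>h. loss_estimate \<T> \<sigma> \<delta> (p h) (fst (x h), snd (x h)) a) \<in> borel_measurable N"
  \<comment> \<open>Moves form a countable discrete space, so the move may be fixed, which also
    fixes the case distinction in the estimate.\<close>
  proof (rule measurable_compose_countable[OF _ sx])
    fix m :: "'v move"
    obtain a1 a2 j where m: "m = (a1, a2, j)" by (cases m)
    show "(\<lambda>h. loss_estimate \<T> \<sigma> \<delta> (p h) (fst (x h), m) a) \<in> borel_measurable N"
      unfolding m loss_estimate_def using u mass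
      by (cases "same_anc \<T> j a a1") (simp_all add: split_beta)
  qed
  then show ?thesis by simp
qed

lemma measurable_cumulative_estimate:
  assumes "\<And>i. i < n \<Longrightarrow> (\<lambda>h. x h i) \<in> N \<rightarrow>\<^sub>M observation_space"
  shows "(\<lambda>h. cumulative_estimate \<T> L \<sigma> \<delta> n (x h) a) \<in> borel_measurable N"
  using assms
proof (induction n arbitrary: a)
  case 0
  then show ?case by simp
next
  case (Suc n)
  have IH: "(\<lambda>h. cumulative_estimate \<T> L \<sigma> \<delta> n (x h) b) \<in> borel_measurable N" for b
    using Suc by simp
  show ?case
    using IH Suc.prems[of n]
    by (auto intro!: borel_measurable_add measurable_loss_estimate measurable_ftrl_point)
qed

lemma cumulative_estimate_cong:
  "(\<And>i. i < n \<Longrightarrow> h i = h' i) \<Longrightarrow> cumulative_estimate \<T> L \<sigma> \<delta> n h = cumulative_estimate \<T> L \<sigma> \<delta> n h'"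
  by (induction n) auto

section \<open>The sampling law of a move\<close>

definition moves :: "'v move set" where
  "moves = A \<times> A \<times> {1..L}"

lemma finite_moves: "finite moves"
  by (simp add: moves_def)

lemma
  assumes p: "set_pmf p \<subseteq> A"
  shows set_draw_move: "set_pmf (draw_move \<T> \<delta> p) \<subseteq> {(a1, a2, j) \<in> moves. same_anc \<T> (j - 1) a2 a1}"
    and pmf_draw_move: "a1 \<in> set_pmf p \<Longrightarrow> j \<in> {1..L} \<Longrightarrow> pmf (draw_move \<T> \<delta> p) (a1, a2, j) =
      pmf p a1 * pmf \<delta> j * (if same_anc \<T> (j - 1) a2 a1 then pmf p a2 / M p (anc \<T> (j - 1) a1) else 0)"
proof -
  \<comment> \<open>\<open>cond_pmf\<close> is meaningful only for events that meet the support;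
    \<open>a1\<close> itself lies in this one.\<close>
  have ne: "set_pmf p \<inter> {a2. same_anc \<T> (j - 1) a2 a1} \<noteq> {}" if "a1 \<in> set_pmf p" for a1 j
    using that by (auto simp: same_anc_def)
  show "set_pmf (draw_move \<T> \<delta> p) \<subseteq> {(a1, a2, j) \<in> moves. same_anc \<T> (j - 1) a2 a1}"
    using p \<delta>_support ne by (auto simp: draw_move_def moves_def set_cond_pmf)
  assume a1: "a1 \<in> set_pmf p" and j: "j \<in> {1..L}"
  have "measure (measure_pmf p) {a2. same_anc \<T> (j - 1) a2 a1} = M p (anc \<T> (j - 1) a1)"
  proof -
    have "anc \<T> (j - 1) a1 \<in> level \<T> (j - 1)" using a1 p j by (intro anc_in_level) auto
    then have "M p (anc \<T> (j - 1) a1) = sum (pmf p) {a \<in> A. anc \<T> (j - 1) a = anc \<T> (j - 1) a1}"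
      using j by (subst mass_level[of _ "j - 1"]) auto
    also have "\<dots> = measure (measure_pmf p) {a \<in> A. anc \<T> (j - 1) a = anc \<T> (j - 1) a1}"
      by (simp add: measure_measure_pmf_finite)
    also have "\<dots> = measure (measure_pmf p) {a2. same_anc \<T> (j - 1) a2 a1}"
      using p by (intro measure_pmf.finite_measure_eq_AE) (auto simp: AE_measure_pmf_iff same_anc_def)
    finally show ?thesis by simp
  qed
  then show "pmf (draw_move \<T> \<delta> p) (a1, a2, j) =
      pmf p a1 * pmf \<delta> j * (if same_anc \<T> (j - 1) a2 a1 then pmf p a2 / M p (anc \<T> (j - 1) a1) else 0)"
    unfolding draw_move_def
    by (subst pmf_bind_eq_single[where a = a1],
        force simp: pmf_eq_0_set_pmf set_bind_pmf,
        subst pmf_bind_eq_single[where a = j],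
        force simp: pmf_eq_0_set_pmf,
        subst pmf_bind_eq_single[where a = a2],
        force simp: pmf_eq_0_set_pmf)
      (simp add: pmf_cond[OF ne[OF a1]] del: One_nat_def)
qed

text \<open>All moves lie in the fixed finite set \<open>moves\<close>, so the probability of any
  event is a finite sum of point probabilities, each an explicit expression in the measurable
  \<open>pmf\<close> of the leader. Interiority of the leader is what makes that expression valid
  for every first action.\<close>

lemma is_algorithm_tree_ftrl: "is_algorithm A (tree_ftrl \<T> L \<sigma> \<delta>)"
proof -
  have support: "set_pmf (tree_ftrl \<T> L \<sigma> \<delta> n h) \<subseteq> moves" for n h
    unfolding tree_ftrl_def using set_draw_move[OF ftrl_point_support] by blast
  have "(\<lambda>h. measure_pmf (tree_ftrl \<T> L \<sigma> \<delta> n h))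
      \<in> (\<Pi>\<^sub>M i\<in>{0..<n}. observation_space) \<rightarrow>\<^sub>M prob_algebra (count_space UNIV)" for n
  proof (rule measurable_prob_algebraI)
    let ?N = "\<Pi>\<^sub>M i\<in>{0..<n}. (observation_space :: 'v observation measure)"
    let ?p = "\<lambda>h. P (Suc n) (cumulative_estimate \<T> L \<sigma> \<delta> n h)"
    have p: "(\<lambda>h. pmf (?p h) b) \<in> borel_measurable ?N" for b
      by (intro measurable_ftrl_point measurable_cumulative_estimate measurable_component_singleton) auto
    have mass: "(\<lambda>h. M (?p h) v) \<in> borel_measurable ?N" for v
      unfolding mass_def by (intro borel_measurable_sum p)
    have pmf_measurable: "(\<lambda>h. pmf (tree_ftrl \<T> L \<sigma> \<delta> n h) m) \<in> borel_measurable ?N" if "m \<in> moves" for m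
    proof -
      obtain a1 a2 j where m: "m = (a1, a2, j)" by (cases m)
      then have "a1 \<in> A" "j \<in> {1..L}" using that by (auto simp: moves_def)
      then have eq: "pmf (tree_ftrl \<T> L \<sigma> \<delta> n h) m = pmf (?p h) a1 * pmf \<delta> j *
          (if same_anc \<T> (j - 1) a2 a1 then pmf (?p h) a2 / M (?p h) (anc \<T> (j - 1) a1) else 0)" for h
        unfolding tree_ftrl_def m
        by (intro pmf_draw_move ftrl_point_support) (auto simp: set_pmf_iff ftrl_point_pos less_imp_neq[symmetric])
      show ?thesis unfolding eq using p mass by (cases "same_anc \<T> (j - 1) a2 a1") auto
    qed
    show "(\<lambda>h. measure_pmf (tree_ftrl \<T> L \<sigma> \<delta> n h)) \<in> ?N \<rightarrow>\<^sub>M subprob_algebra (count_space UNIV)"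
    proof (rule measurable_subprob_algebra)
      fix X :: "'v move set"
      have "emeasure (measure_pmf (tree_ftrl \<T> L \<sigma> \<delta> n h)) X
          = (\<Sum>m\<in>X \<inter> moves. ennreal (pmf (tree_ftrl \<T> L \<sigma> \<delta> n h) m))" for h
      proof -
        have "emeasure (measure_pmf (tree_ftrl \<T> L \<sigma> \<delta> n h)) X
            = emeasure (measure_pmf (tree_ftrl \<T> L \<sigma> \<delta> n h)) (X \<inter> moves)"
          using support[of n h] by (intro emeasure_eq_AE) (auto simp: AE_measure_pmf_iff)
        then show ?thesis by (simp add: emeasure_measure_pmf_finite finite_moves)
      qed
      then show "(\<lambda>h. emeasure (measure_pmf (tree_ftrl \<T> L \<sigma> \<delta> n h)) X) \<in> borel_measurable ?N"
        using pmf_measurable by (auto intro!: borel_measurable_sum measurable_compose[OF _ measurable_ennreal])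
    qed (auto intro: measure_pmf.subprob_space_axioms)
  qed (rule measure_pmf.prob_space_axioms)
  then show ?thesis using support by (force simp: is_algorithm_def moves_def)
qed

section \<open>Pathwise regret\<close>

text \<open>The right-hand side of \<open>level_stability\<close> at the largest weight that an
  estimate with sampled node \<open>v\<close> can have.\<close>

definition stability_bound :: "nat \<Rightarrow> 'v pmf \<Rightarrow> nat \<Rightarrow> 'v \<Rightarrow> real" where
  "stability_bound t p j v = (2 * \<sigma> j / (pmf \<delta> j * M p v))\<^sup>2 / scale t j *
     (2 * (M p v * sqrt (M p v)) * (1 - M p v)\<^sup>2
      + 3 * (M p v)\<^sup>2 * (\<Sum>u\<in>level \<T> j - {v}. M p u * sqrt (M p u)))"

definition penalty_bound :: "nat \<Rightarrow> 'v pmf \<Rightarrow> real" where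
  "penalty_bound t p = (\<Sum>j=1..L. sqrt 6 * rate j / sqrt t *
     (\<Sum>v\<in>level \<T> j. 4 / 3 * (sqrt (M p v) - M p v)))"

definition round_bound :: "nat \<Rightarrow> 'v pmf \<Rightarrow> real" where
  "round_bound t p = (\<Sum>j=1..L. sqrt 6 * rate j / sqrt t * (\<Sum>v\<in>level \<T> j. node_cost (M p v)))"

lemma linear_node:
  assumes "j \<le> L" "v \<in> level \<T> j" "\<And>a. a \<in> A \<Longrightarrow> z a = (if anc \<T> j a = v then w else 0)"
  shows "linear z p = w * M p v"
proof -
  have "linear z p = (\<Sum>a\<in>A. if anc \<T> j a = v then w * pmf p a else 0)"
    unfolding linear_def using assms by (intro sum.cong) auto
  then show ?thesis using assms by (simp add: mass_level sum.If_cases sum_distrib_left Collect_conj_eq)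
qed

lemma stability:
  fixes t :: nat and Z :: "'v \<Rightarrow> real"
  assumes j: "j \<in> {1..L}" and v: "v \<in> level \<T> j"
    and w: "0 \<le> w" "w \<le> 2 * \<sigma> j / (pmf \<delta> j * M (P t Z) v)"
    and z: "\<And>a. a \<in> A \<Longrightarrow> z a = (if anc \<T> j a = v then w else 0)"
    and q: "set_pmf q \<subseteq> A"
  defines "p \<equiv> P t Z"
  shows "linear z p - linear z q - (objective t Z q - objective t Z p) \<le> stability_bound t p j v"
proof -
  have p: "set_pmf p \<subseteq> A" and p_pos: "0 < M p u" for u
    by (simp_all add: p_def ftrl_point_support M_ftrl_point_pos)
  have jL: "j \<le> L" using j by simp
  have c: "0 < scale t j" by (rule scale_pos[OF j])
  \<comment> \<open>The mass cancels. Six times this bound is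
    \<open>12 * \<sigma> j / pmf \<delta> j\<close>, the floor of \<open>scale\<close>, which is the
    condition required by \<open>level_stability\<close>.\<close>
  have "w * M p v \<le> 2 * \<sigma> j / pmf \<delta> j"
    using mult_right_mono[OF w(2), of "M p v"] p_pos[of v] by (simp add: p_def M_nonneg)
  then have cw: "6 * w * M p v \<le> scale t j" using scale_lower_bounds(1)[OF j, of t] by simp
  let ?D = "\<lambda>i. scale t i * (\<Sum>v\<in>level \<T> i. sqrt_bregman (M q v) (M p v))"
  have "0 \<le> ?D i" if "i \<in> {1..L}" for i
    using scale_pos[OF that, of t] p_pos
    by (intro mult_nonneg_nonneg sum_nonneg) (auto simp: sqrt_bregman_def less_imp_le)
  then have "?D j \<le> (\<Sum>i=1..L. ?D i)"
    using j by (intro member_le_sum) auto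
  also have "\<dots> \<le> objective t Z q - objective t Z p"
    unfolding p_def by (rule objective_ge_bregman[OF q])
  finally have "linear z p - linear z q - (objective t Z q - objective t Z p) \<le> w * (M p v - M q v) - ?D j"
    using linear_node[OF jL v z, of p] linear_node[OF jL v z, of q] by (simp add: right_diff_distrib)
  also have "\<dots> \<le> w\<^sup>2 / scale t j *
     (2 * (M p v * sqrt (M p v)) * (1 - M p v)\<^sup>2
      + 3 * (M p v)\<^sup>2 * (\<Sum>u\<in>level \<T> j - {v}. M p u * sqrt (M p u)))"
    using v p_pos sum_M[OF p jL] sum_M[OF q jL] M_nonneg w(1) c cw by (intro level_stability) auto
  also have "\<dots> \<le> stability_bound t p j v"
    unfolding stability_bound_def
    using w c M_nonneg
    by (intro mult_right_mono divide_right_mono power_mono add_nonneg_nonneg mult_nonneg_nonneg sum_nonneg)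
       (auto simp: p_def)
  finally show ?thesis .
qed

text \<open>\<open>M p v\<close> is the probability that \<open>v\<close> is the ancestor of the
  first action at depth \<open>j\<close>. Together with \<open>pmf \<delta> j\<close> it removes
  enough of the squared inverse weight for only \<open>sqrt (M p v)\<close> to remain.\<close>

lemma expected_stability_bound:
  assumes p: "set_pmf p \<subseteq> A" and p_pos: "\<And>v. 0 < M p v" and t: "1 \<le> t"
  shows "(\<Sum>j=1..L. pmf \<delta> j * (\<Sum>v\<in>level \<T> j. M p v * stability_bound t p j v))
      + penalty_bound t p \<le> round_bound t p"
proof -
  have "pmf \<delta> j * (\<Sum>v\<in>level \<T> j. M p v * stability_bound t p j v)
      \<le> sqrt 6 * rate j / sqrt t * (\<Sum>v\<in>level \<T> j. sqrt (M p v) * (1 - M p v) * (2 + M p v) / 3)"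
    if j: "j \<in> {1..L}" for j
  proof -
    have d: "0 < pmf \<delta> j" and s: "0 < \<sigma> j" and c: "0 < scale t j" and r: "0 < rate j"
      using j by (simp_all only: \<delta>_pos \<sigma>_pos scale_pos rate_pos)
    have jL: "j \<le> L" using j by simp
    let ?V = "level \<T> j" and ?x = "M p"
    define k where "k = 4 * (\<sigma> j)\<^sup>2 / (pmf \<delta> j * scale t j)"
    have "pmf \<delta> j * (\<Sum>v\<in>?V. ?x v * stability_bound t p j v)
        = (\<Sum>v\<in>?V. pmf \<delta> j * (?x v * stability_bound t p j v))"
      by (rule sum_distrib_left)
    also have "\<dots> = (\<Sum>v\<in>?V. k * (2 * sqrt (?x v) * (1 - ?x v)\<^sup>2
            + 3 * (?x v * (\<Sum>u\<in>?V - {v}. ?x u * sqrt (?x u)))))"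
    proof (rule sum.cong[OF refl])
      fix v assume "v \<in> ?V"
      have x: "0 < ?x v" by (rule p_pos)
      define B C where "B = (1 - ?x v)\<^sup>2" and "C = (\<Sum>u\<in>?V - {v}. ?x u * sqrt (?x u))"
      show "pmf \<delta> j * (?x v * stability_bound t p j v)
          = k * (2 * sqrt (?x v) * (1 - ?x v)\<^sup>2 + 3 * (?x v * (\<Sum>u\<in>?V - {v}. ?x u * sqrt (?x u))))"
        unfolding stability_bound_def k_def B_def[symmetric] C_def[symmetric]
        using x d s c by (simp add: field_simps power2_eq_square)
    qed
    also have "\<dots> = k * ((\<Sum>v\<in>?V. 2 * sqrt (?x v) * (1 - ?x v)\<^sup>2)
        + 3 * (\<Sum>v\<in>?V. ?x v * (\<Sum>u\<in>?V - {v}. ?x u * sqrt (?x u))))"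
      by (simp add: sum_distrib_left sum.distrib distrib_left)
    \<comment> \<open>Exchanging the sums, each \<open>u\<close> is met by all other nodes, whose
      total mass is \<open>1 - x u\<close>.\<close>
    also have "(\<Sum>v\<in>?V. ?x v * (\<Sum>u\<in>?V - {v}. ?x u * sqrt (?x u)))
        = (\<Sum>v\<in>?V. ?x v * sqrt (?x v) * (1 - ?x v))"
    proof -
      have "(\<Sum>u\<in>?V - {v}. ?x u * sqrt (?x u)) = (\<Sum>u\<in>?V. ?x u * sqrt (?x u)) - ?x v * sqrt (?x v)"
        if "v \<in> ?V" for v using that by (simp add: sum_diff1)
      then have "(\<Sum>v\<in>?V. ?x v * (\<Sum>u\<in>?V - {v}. ?x u * sqrt (?x u)))
          = (\<Sum>v\<in>?V. ?x v * (\<Sum>u\<in>?V. ?x u * sqrt (?x u)) - ?x v * (?x v * sqrt (?x v)))"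
        by (intro sum.cong) (auto simp: right_diff_distrib)
      also have "\<dots> = (\<Sum>v\<in>?V. ?x v) * (\<Sum>u\<in>?V. ?x u * sqrt (?x u)) - (\<Sum>v\<in>?V. ?x v * (?x v * sqrt (?x v)))"
        by (simp add: sum_subtractf sum_distrib_right)
      also have "\<dots> = (\<Sum>v\<in>?V. ?x v * sqrt (?x v) * (1 - ?x v))"
        by (simp add: sum_M[OF p jL] sum_subtractf[symmetric] algebra_simps)
      finally show ?thesis .
    qed
    \<comment> \<open>From \<open>2 * (1 - x) + 3 * x = 2 + x\<close>: the origin of the first
      summand of \<open>node_cost\<close>.\<close>
    also have "(\<Sum>v\<in>?V. 2 * sqrt (?x v) * (1 - ?x v)\<^sup>2) + 3 * (\<Sum>v\<in>?V. ?x v * sqrt (?x v) * (1 - ?x v))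
        = (\<Sum>v\<in>?V. sqrt (?x v) * (1 - ?x v) * (2 + ?x v))"
      by (simp add: sum_distrib_left sum.distrib[symmetric] power2_eq_square algebra_simps)
    also have "k * (\<Sum>v\<in>?V. sqrt (?x v) * (1 - ?x v) * (2 + ?x v))
        \<le> sqrt 6 * rate j / sqrt t / 3 * (\<Sum>v\<in>?V. sqrt (?x v) * (1 - ?x v) * (2 + ?x v))"
    proof (intro mult_right_mono sum_nonneg mult_nonneg_nonneg)
      have "0 < 2 * sqrt 6 * rate j * sqrt (real t)" using r t by simp
      moreover have "\<sigma> j = rate j * sqrt (pmf \<delta> j)" using d by (simp add: rate_def)
      then have "(\<sigma> j)\<^sup>2 = (rate j)\<^sup>2 * pmf \<delta> j" using d by (simp add: power_mult_distrib)
      then have "k = 4 * (rate j)\<^sup>2 / scale t j" using d by (simp add: k_def)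
      \<comment> \<open>Here the growing argument of the maximum in \<open>scale\<close> enters;
        \<open>4 / (2 * sqrt 6) = sqrt 6 / 3\<close> accounts for the division by 3 in
        \<open>node_cost\<close>.\<close>
      ultimately have "k \<le> 4 * (rate j)\<^sup>2 / (2 * sqrt 6 * rate j * sqrt t)"
        using scale_lower_bounds(2)[OF j, of t] c by (simp only:) (intro divide_left_mono, auto)
      also have "\<dots> = sqrt 6 * rate j / sqrt t / 3"
        using r t by (simp add: field_simps power2_eq_square)
      finally show "k \<le> sqrt 6 * rate j / sqrt t / 3" .
    qed (auto simp: M_nonneg M_le_1[OF p] add_nonneg_nonneg)
    finally show ?thesis by (simp add: sum_divide_distrib[symmetric])
  qed
  then have "(\<Sum>j=1..L. pmf \<delta> j * (\<Sum>v\<in>level \<T> j. M p v * stability_bound t p j v))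
      \<le> (\<Sum>j=1..L. sqrt 6 * rate j / sqrt t * (\<Sum>v\<in>level \<T> j. sqrt (M p v) * (1 - M p v) * (2 + M p v) / 3))"
    by (intro sum_mono)
  then show ?thesis
    by (simp add: round_bound_def penalty_bound_def node_cost_def sum.distrib distrib_left)
qed

section \<open>Regret of the leader along one sequence of estimates\<close>

text \<open>Induction with the comparator left free, so that the leader of the next round can serve
  as comparator for the previous ones. The point \<open>p n\<close> minimises with the regularizer
  of index \<open>Suc n\<close>, hence the correction
  \<open>\<psi> n (p n) - \<psi> (Suc n) (p n)\<close>. The bound \<open>S\<close> is abstract
  because it will depend on the realised move.\<close>

lemma ftrl_telescope:
  fixes z :: "nat \<Rightarrow> 'v \<Rightarrow> real" and S :: "nat \<Rightarrow> real"
  defines "Z \<equiv> \<lambda>n a. \<Sum>i<n. z i a"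
  defines "p \<equiv> \<lambda>n. P (Suc n) (Z n)"
  assumes stab: "\<And>n q. n < T \<Longrightarrow> set_pmf q \<subseteq> A \<Longrightarrow>
      linear (z n) (p n) - linear (z n) q - (objective (Suc n) (Z n) q - objective (Suc n) (Z n) (p n)) \<le> S n"
    and T: "1 \<le> T" and q: "set_pmf q \<subseteq> A"
  shows "(\<Sum>n<T. linear (z n) (p n)) \<le> linear (Z T) q + \<psi> T q - \<psi> 1 (p 0)
      + (\<Sum>n\<in>{1..<T}. \<psi> n (p n) - \<psi> (Suc n) (p n)) + (\<Sum>n<T. S n)"
  using T stab q
proof (induction T arbitrary: q rule: dec_induct)
  case base
  show ?case using base.prems(1)[of 0 q] base.prems(2)
    by (simp add: objective_def linear_def Z_def)
next
  case (step T)
  have "set_pmf (p T) \<subseteq> A" by (simp add: p_def ftrl_point_support)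
  \<comment> \<open>The induction hypothesis at the comparator \<open>p T\<close>;
    \<open>stab\<close> at round \<open>T\<close> then exchanges \<open>p T\<close> for
    \<open>q\<close>.\<close>
  then have "(\<Sum>n<T. linear (z n) (p n)) \<le> linear (Z T) (p T) + \<psi> T (p T) - \<psi> 1 (p 0)
      + (\<Sum>n\<in>{1..<T}. \<psi> n (p n) - \<psi> (Suc n) (p n)) + (\<Sum>n<T. S n)"
    using step by auto
  moreover have "linear (Z (Suc T)) q = linear (Z T) q + linear (z T) q"
    by (simp add: linear_def Z_def sum.distrib distrib_right)
  moreover have "(\<Sum>n\<in>{1..<Suc T}. \<psi> n (p n) - \<psi> (Suc n) (p n))
      = (\<Sum>n\<in>{1..<T}. \<psi> n (p n) - \<psi> (Suc n) (p n)) + (\<psi> T (p T) - \<psi> (Suc T) (p T))"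
    using step by (simp add: sum.atLeastLessThan_Suc)
  ultimately show ?case
    using step.prems(1)[of T q] step.prems(2) by (simp add: objective_def)
qed

lemma sqrt_ge_M: "set_pmf p \<subseteq> A \<Longrightarrow> M p v \<le> sqrt (M p v)"
  using M_le_1 M_nonneg by (intro real_le_rsqrt) (auto simp: power2_eq_square mult_left_le_one_le)

lemma penalty_bound_nonneg: "set_pmf p \<subseteq> A \<Longrightarrow> 0 \<le> penalty_bound t p"
  unfolding penalty_bound_def using rate_pos sqrt_ge_M
  by (intro sum_nonneg mult_nonneg_nonneg divide_nonneg_nonneg) (auto simp: less_imp_le)

text \<open>Every level contributes its coefficient increment times the nonnegative quantity
  \<open>sqrt (M p v) - M p v\<close>. The 4/3 in \<open>penalty_bound\<close> is 2 from the
  regularizer times 2/3 from \<open>sqrt_Suc_diff_le\<close>.\<close>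

lemma penalty_le:
  assumes p: "set_pmf p \<subseteq> A" and n: "1 \<le> n"
  shows "\<psi> n p - \<psi> (Suc n) p \<le> penalty_bound (Suc n) p"
proof -
  let ?E = "\<lambda>j. \<Sum>v\<in>level \<T> j. sqrt (M p v) - M p v"
  have "(\<Sum>v\<in>level \<T> j. M p v - sqrt (M p v)) = - ?E j" for j
    by (simp add: sum_subtractf)
  then have "\<psi> n p - \<psi> (Suc n) p = (\<Sum>j=1..L. (scale (Suc n) j - scale n j) * ?E j)"
    unfolding regularizer_eq by (simp add: sum_subtractf[symmetric] algebra_simps)
  also have "\<dots> \<le> (\<Sum>j=1..L. (2 * sqrt 6 * rate j * (2 / (3 * sqrt (Suc n)))) * ?E j)"
  proof (intro sum_mono mult_right_mono)
    fix j assume j: "j \<in> {1..L}"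
    have "scale (Suc n) j - scale n j \<le> 2 * sqrt 6 * rate j * (sqrt (Suc n) - sqrt n)"
      by (rule scale_diff(2)[OF j])
    also have "\<dots> \<le> 2 * sqrt 6 * rate j * (2 / (3 * sqrt (Suc n)))"
      using sqrt_Suc_diff_le[OF n] rate_pos[OF j] by (intro mult_left_mono) auto
    finally show "scale (Suc n) j - scale n j \<le> 2 * sqrt 6 * rate j * (2 / (3 * sqrt (Suc n)))" .
  qed (auto intro!: sum_nonneg simp: sqrt_ge_M[OF p])
  also have "\<dots> = penalty_bound (Suc n) p"
    unfolding penalty_bound_def sum_distrib_left[symmetric] by (intro sum.cong refl) simp
  finally show ?thesis .
qed

section \<open>Round costs and effective numbers of actions\<close>

lemma sum_sqrt_M_le:
  assumes p: "set_pmf p \<subseteq> A" and j: "j \<le> L"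
  shows "(\<Sum>v\<in>level \<T> j. sqrt (M p v)) \<le> sqrt (card (level \<T> j))"
  using sum_sqrt_le[of "level \<T> j" "M p" "\<lambda>_. 1"] sum_M[OF p j] M_nonneg by simp

lemma sqrt_K_eff:
  assumes "\<And>j. j \<in> {1..L} \<Longrightarrow> 0 \<le> r j"
  shows "sqrt (K_eff \<T> L r) = (\<Sum>j=1..L. r j * sqrt (card (level \<T> j)))"
  unfolding K_eff_def real_sqrt_abs using assms by (intro abs_of_nonneg sum_nonneg) auto

lemma initial_regularizer_le:
  assumes p: "set_pmf p \<subseteq> A"
  shows "- \<psi> 1 p \<le> 12 * sqrt (K_eff \<T> L (\<lambda>j. \<sigma> j / pmf \<delta> j))"
proof -
  have "- \<psi> 1 p = (\<Sum>j=1..L. scale 1 j * (\<Sum>v\<in>level \<T> j. sqrt (M p v) - M p v))"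
    unfolding regularizer_eq sum_negf[symmetric]
    by (intro sum.cong) (auto simp: sum_subtractf algebra_simps)
  also have "\<dots> \<le> (\<Sum>j=1..L. scale 1 j * sqrt (card (level \<T> j)))"
  proof (intro sum_mono mult_left_mono)
    fix j assume "j \<in> {1..L}"
    then show "(\<Sum>v\<in>level \<T> j. sqrt (M p v) - M p v) \<le> sqrt (card (level \<T> j))"
      using sum_sqrt_M_le[OF p, of j] sum_nonneg[of "level \<T> j" "M p"] M_nonneg
      by (simp add: sum_subtractf)
  qed (simp add: scale_pos less_imp_le)
  also have "\<dots> = 12 * (\<Sum>j=1..L. \<sigma> j / pmf \<delta> j * sqrt (card (level \<T> j)))"
    unfolding sum_distrib_left by (intro sum.cong) (auto simp only: scale_1 mult.assoc)
  also have "\<dots> = 12 * sqrt (K_eff \<T> L (\<lambda>j. \<sigma> j / pmf \<delta> j))"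
    using \<sigma>_pos \<delta>_pos by (subst sqrt_K_eff) (auto simp: less_imp_le)
  finally show ?thesis .
qed

lemma ftrl_regret:
  fixes z :: "nat \<Rightarrow> 'v \<Rightarrow> real" and S :: "nat \<Rightarrow> real"
  defines "Z \<equiv> \<lambda>n a. \<Sum>i<n. z i a"
  defines "p \<equiv> \<lambda>n. P (Suc n) (Z n)"
  assumes stab: "\<And>n q. n < T \<Longrightarrow> set_pmf q \<subseteq> A \<Longrightarrow>
      linear (z n) (p n) - linear (z n) q - (objective (Suc n) (Z n) q - objective (Suc n) (Z n) (p n)) \<le> S n"
    and T: "1 \<le> T" and a: "a \<in> A"
  shows "(\<Sum>n<T. linear (z n) (p n) - z n a) \<le> 12 * sqrt (K_eff \<T> L (\<lambda>j. \<sigma> j / pmf \<delta> j))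
      + (\<Sum>n<T. S n + penalty_bound (Suc n) (p n))"
proof -
  have p: "set_pmf (p n) \<subseteq> A" for n by (simp add: p_def ftrl_point_support)
  have "linear y (return_pmf a) = y a" for y
    using a by (simp add: linear_def indicator_def if_distrib[of "\<lambda>x. y _ * x"] cong: if_cong)
  moreover have "(\<Sum>n<T. linear (z n) (p n)) \<le> linear (Z T) (return_pmf a) + \<psi> T (return_pmf a)
      - \<psi> 1 (p 0) + (\<Sum>n\<in>{1..<T}. \<psi> n (p n) - \<psi> (Suc n) (p n)) + (\<Sum>n<T. S n)"
    unfolding p_def Z_def
    by (rule ftrl_telescope[OF _ T]) (use stab a in \<open>auto simp: p_def Z_def\<close>)
  ultimately have "(\<Sum>n<T. linear (z n) (p n)) \<le> (\<Sum>n<T. z n a) - \<psi> 1 (p 0)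
      + (\<Sum>n\<in>{1..<T}. \<psi> n (p n) - \<psi> (Suc n) (p n)) + (\<Sum>n<T. S n)"
    by (simp add: regularizer_return Z_def)
  moreover have "(\<Sum>n\<in>{1..<T}. \<psi> n (p n) - \<psi> (Suc n) (p n)) \<le> (\<Sum>n\<in>{1..<T}. penalty_bound (Suc n) (p n))"
    using penalty_le[OF p] by (intro sum_mono) auto
  \<comment> \<open>Adds the nonnegative term of index 0, so that every round is charged one
    stability and one penalty term.\<close>
  moreover have "\<dots> \<le> (\<Sum>n<T. penalty_bound (Suc n) (p n))"
    using penalty_bound_nonneg[OF p] by (intro sum_mono2) auto
  ultimately show ?thesis
    using initial_regularizer_le[OF p, of 0] by (simp add: sum_subtractf sum.distrib)
qed

lemma round_bound_adversarial:
  assumes p: "set_pmf p \<subseteq> A"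
  shows "round_bound t p \<le> 2 * sqrt 6 * sqrt (K_eff \<T> L rate) / sqrt t"
proof -
  have "round_bound t p \<le> (\<Sum>j=1..L. sqrt 6 * rate j / sqrt t * (2 * sqrt (card (level \<T> j))))"
    unfolding round_bound_def
  proof (intro sum_mono mult_left_mono)
    fix j assume j: "j \<in> {1..L}"
    have "(\<Sum>v\<in>level \<T> j. node_cost (M p v)) \<le> (\<Sum>v\<in>level \<T> j. 2 * sqrt (M p v))"
      by (intro sum_mono node_cost_le M_nonneg M_le_1[OF p])
    also have "\<dots> \<le> 2 * sqrt (card (level \<T> j))"
      using sum_sqrt_M_le[OF p, of j] j by (simp add: sum_distrib_left[symmetric])
    finally show "(\<Sum>v\<in>level \<T> j. node_cost (M p v)) \<le> 2 * sqrt (card (level \<T> j))" .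
  qed (simp add: rate_pos less_imp_le)
  also have "\<dots> = 2 * sqrt 6 * sqrt (K_eff \<T> L rate) / sqrt t"
    using rate_pos by (subst sqrt_K_eff) (auto simp: less_imp_le sum_distrib_left sum_divide_distrib mult_ac)
  finally show ?thesis .
qed

lemma min_gap_le: "a \<in> leaves_below \<T> v \<Longrightarrow> min_gap \<T> \<Delta> v \<le> \<Delta> a"
  unfolding min_gap_def by (intro Min_le) auto

lemma min_gap_attained: "\<exists>a\<in>leaves_below \<T> v. min_gap \<T> \<Delta> v = \<Delta> a"
proof -
  have "min_gap \<T> \<Delta> v \<in> \<Delta> ` leaves_below \<T> v"
    unfolding min_gap_def using leaves_below_nonempty by (intro Min_in) auto
  then show ?thesis by auto
qed

lemma round_bound_stochastic:
  assumes p: "set_pmf p \<subseteq> A" and t: "1 \<le> t"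
    and \<Delta>_nonneg: "\<And>a. a \<in> A \<Longrightarrow> 0 \<le> \<Delta> a" and \<Delta>_zero: "card {a \<in> A. \<Delta> a = 0} \<le> 1"
  shows "2 * round_bound t p - linear \<Delta> p \<le> 96 * K_eff_sto \<T> L \<Delta> rate / t"
proof -
  \<comment> \<open>The leaf with gap 0 if there is one, otherwise any leaf; either way all other
    gaps are positive.\<close>
  obtain a0 where a0: "a0 \<in> A" "\<And>a. a \<in> A \<Longrightarrow> a \<noteq> a0 \<Longrightarrow> 0 < \<Delta> a"
  proof (cases "{a \<in> A. \<Delta> a = 0} = {}")
    case True
    obtain a where "a \<in> A" using leaves_nonempty by auto
    then show ?thesis using True \<Delta>_nonneg that[of a] by (force simp: less_le)
  next
    case False
    then have "0 < card {a \<in> A. \<Delta> a = 0}" by (subst card_gt_0_iff) auto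
    then have "card {a \<in> A. \<Delta> a = 0} = 1" using \<Delta>_zero by linarith
    then obtain a where a: "{a \<in> A. \<Delta> a = 0} = {a}" by (auto simp: card_1_singleton_iff)
    then show ?thesis using \<Delta>_nonneg that[of a] by (force simp: less_le)
  qed
  define G where "G = linear \<Delta> p"
  define U where "U j = level \<T> j - {anc \<T> j a0}" for j
  let ?d = "min_gap \<T> \<Delta>"
  have gap_nonneg: "0 \<le> ?d v" for v
    using min_gap_attained[of v \<Delta>] \<Delta>_nonneg by (auto simp: leaves_below_def)
  have gap_pos: "0 < ?d v" if "v \<in> U j" "j \<le> L" for v j
  proof -
    obtain a where a: "a \<in> leaves_below \<T> v" "?d v = \<Delta> a" using min_gap_attained by blast
    then have "a \<in> A" "a \<noteq> a0" using that leaves_below_level[of v j] by (auto simp: U_def)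
    then show ?thesis using a a0 by simp
  qed
  \<comment> \<open>Each level separately is controlled by the same expected gap, which lets the sum
    over levels form inside the square of \<open>K_eff_sto\<close>.\<close>
  have G: "(\<Sum>v\<in>U j. ?d v * M p v) \<le> G" if "j \<le> L" for j
  proof -
    have "(\<Sum>v\<in>U j. ?d v * M p v) \<le> (\<Sum>v\<in>level \<T> j. ?d v * M p v)"
      using gap_nonneg M_nonneg by (intro sum_mono2) (auto simp: U_def)
    also have "\<dots> = (\<Sum>a\<in>A. ?d (anc \<T> j a) * pmf p a)" by (rule sum_mass[OF that])
    also have "\<dots> \<le> (\<Sum>a\<in>A. \<Delta> a * pmf p a)"
      using leaves_below_level anc_in_level that
      by (intro sum_mono mult_right_mono min_gap_le) auto
    finally show ?thesis by (simp add: G_def linear_def)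
  qed
  have G_nonneg: "0 \<le> G" unfolding G_def linear_def using \<Delta>_nonneg by (intro sum_nonneg) auto
  have inv_nonneg: "0 \<le> inverse_gaps \<T> j \<Delta>" for j
    unfolding inverse_gaps_def using gap_nonneg by (intro sum_nonneg) auto
  have level_le: "(\<Sum>v\<in>level \<T> j. node_cost (M p v)) \<le> 4 * (sqrt (inverse_gaps \<T> j \<Delta>) * sqrt G)"
    if j: "j \<le> L" for j
  proof -
    have v0: "anc \<T> j a0 \<in> level \<T> j" using a0 j by (rule_tac anc_in_level)
    \<comment> \<open>The cost of the exceptional node is passed on to its siblings at the level:
      \<open>1 - x\<close> is their mass, at most the sum of their roots. It doubles their own
      factor 2 to 4.\<close>
    have "1 - M p (anc \<T> j a0) = (\<Sum>v\<in>U j. M p v)"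
      using sum_M[OF p j] v0 by (simp add: U_def sum_diff1)
    also have "\<dots> \<le> (\<Sum>v\<in>U j. sqrt (M p v))" by (intro sum_mono sqrt_ge_M[OF p])
    finally have "node_cost (M p (anc \<T> j a0)) \<le> 2 * (\<Sum>v\<in>U j. sqrt (M p v))"
      using node_cost_le(2)[OF M_nonneg M_le_1[OF p], of "anc \<T> j a0"] by simp
    moreover have "(\<Sum>v\<in>U j. node_cost (M p v)) \<le> (\<Sum>v\<in>U j. 2 * sqrt (M p v))"
      by (intro sum_mono node_cost_le M_nonneg M_le_1[OF p])
    moreover have "(\<Sum>v\<in>level \<T> j. node_cost (M p v))
        = node_cost (M p (anc \<T> j a0)) + (\<Sum>v\<in>U j. node_cost (M p v))"
      unfolding U_def using v0 by (intro sum.remove) auto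
    ultimately have "(\<Sum>v\<in>level \<T> j. node_cost (M p v)) \<le> 4 * (\<Sum>v\<in>U j. sqrt (M p v))"
      by (simp add: sum_distrib_left[symmetric])
    also have "(\<Sum>v\<in>U j. sqrt (M p v)) \<le> sqrt (\<Sum>v\<in>U j. 1 / ?d v) * sqrt (\<Sum>v\<in>U j. ?d v * M p v)"
      using M_nonneg gap_pos j by (intro sum_sqrt_le) auto
    also have "\<dots> \<le> sqrt (inverse_gaps \<T> j \<Delta>) * sqrt G"
    proof (intro mult_mono real_sqrt_le_mono G j)
      show "(\<Sum>v\<in>U j. 1 / ?d v) \<le> inverse_gaps \<T> j \<Delta>"
        unfolding inverse_gaps_def
      proof (rule sum_mono2)
        show "U j \<subseteq> {v. v \<in> level \<T> j \<and> ?d v \<noteq> 0}"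
        proof
          fix v assume "v \<in> U j"
          then show "v \<in> {v. v \<in> level \<T> j \<and> ?d v \<noteq> 0}"
            using gap_pos[of v j] j by (simp add: U_def)
        qed
      qed (use gap_nonneg in auto)
      show "0 \<le> sqrt (\<Sum>v\<in>U j. ?d v * M p v)"
        using gap_nonneg M_nonneg by (intro real_sqrt_ge_zero sum_nonneg mult_nonneg_nonneg)
    qed (use inv_nonneg in simp)
    finally show ?thesis by simp
  qed
  define R where "R = (\<Sum>j=1..L. rate j * sqrt (inverse_gaps \<T> j \<Delta>))"
  have "round_bound t p \<le> (\<Sum>j=1..L. sqrt 6 * rate j / sqrt t * (4 * (sqrt (inverse_gaps \<T> j \<Delta>) * sqrt G)))"
    unfolding round_bound_def using rate_pos level_le
    by (intro sum_mono mult_left_mono) (auto simp: less_imp_le)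
  also have "\<dots> = 4 * sqrt 6 * R / sqrt t * sqrt G"
    by (simp add: R_def sum_distrib_left sum_distrib_right sum_divide_distrib mult_ac)
  \<comment> \<open>With \<open>b = 4 * sqrt 6 * R / sqrt t\<close> this is
    \<open>2 * b * sqrt G - G \<le> b\<^sup>2\<close>, and
    \<open>(4 * sqrt 6)\<^sup>2 = 96\<close>.\<close>
  finally have "2 * round_bound t p - G \<le> 2 * (4 * sqrt 6 * R / sqrt t) * sqrt G - (sqrt G)\<^sup>2"
    using G_nonneg by simp
  also have "\<dots> \<le> (4 * sqrt 6 * R / sqrt t)\<^sup>2"
    using zero_le_power2[of "4 * sqrt 6 * R / sqrt t - sqrt G"] unfolding power2_diff by linarith
  also have "\<dots> = 96 * R\<^sup>2 / t" using t by (simp add: power_mult_distrib power_divide)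
  finally show ?thesis by (simp add: G_def R_def K_eff_sto_def)
qed

section \<open>Averages over a move\<close>

lemma sum_draw_move:
  assumes p: "set_pmf p = A"
  shows "(\<Sum>m\<in>moves. pmf (draw_move \<T> \<delta> p) m * f m)
    = (\<Sum>j=1..L. pmf \<delta> j * (\<Sum>a1\<in>A. pmf p a1 *
        (\<Sum>a2 | a2 \<in> A \<and> anc \<T> (j - 1) a2 = anc \<T> (j - 1) a1.
          pmf p a2 / M p (anc \<T> (j - 1) a1) * f (a1, a2, j))))"
proof -
  have "(\<Sum>m\<in>moves. pmf (draw_move \<T> \<delta> p) m * f m)
      = (\<Sum>a1\<in>A. \<Sum>a2\<in>A. \<Sum>j=1..L. pmf (draw_move \<T> \<delta> p) (a1, a2, j) * f (a1, a2, j))"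
    unfolding moves_def by (simp add: sum.cartesian_product split_beta)
  also have "\<dots> = (\<Sum>a1\<in>A. \<Sum>j=1..L. \<Sum>a2\<in>A. pmf (draw_move \<T> \<delta> p) (a1, a2, j) * f (a1, a2, j))"
    by (intro sum.cong refl sum.swap)
  also have "\<dots> = (\<Sum>j=1..L. \<Sum>a1\<in>A. \<Sum>a2\<in>A. pmf (draw_move \<T> \<delta> p) (a1, a2, j) * f (a1, a2, j))"
    by (rule sum.swap)
  also have "\<dots> = (\<Sum>j=1..L. \<Sum>a1\<in>A. pmf \<delta> j * (pmf p a1 *
        (\<Sum>a2 | a2 \<in> A \<and> anc \<T> (j - 1) a2 = anc \<T> (j - 1) a1.
          pmf p a2 / M p (anc \<T> (j - 1) a1) * f (a1, a2, j))))"
  proof (intro sum.cong refl)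
    fix j a1 assume j: "j \<in> {1..L}" and a1: "a1 \<in> A"
    let ?u = "anc \<T> (j - 1) a1"
    have "pmf (draw_move \<T> \<delta> p) (a1, a2, j) * f (a1, a2, j)
        = (if anc \<T> (j - 1) a2 = ?u then pmf \<delta> j * pmf p a1 * (pmf p a2 / M p ?u * f (a1, a2, j)) else 0)" for a2
      using pmf_draw_move[of p a1 j a2] p j a1 by (simp add: same_anc_def)
    then have "(\<Sum>a2\<in>A. pmf (draw_move \<T> \<delta> p) (a1, a2, j) * f (a1, a2, j))
        = (\<Sum>a2\<in>A. if anc \<T> (j - 1) a2 = ?u then pmf \<delta> j * pmf p a1 * (pmf p a2 / M p ?u * f (a1, a2, j)) else 0)"
      by simp
    also have "\<dots> = (\<Sum>a2 | a2 \<in> A \<and> anc \<T> (j - 1) a2 = ?u. pmf \<delta> j * pmf p a1 * (pmf p a2 / M p ?u * f (a1, a2, j)))"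
      by (rule sum.inter_filter[symmetric]) simp
    finally show "(\<Sum>a2\<in>A. pmf (draw_move \<T> \<delta> p) (a1, a2, j) * f (a1, a2, j))
        = pmf \<delta> j * (pmf p a1 * (\<Sum>a2 | a2 \<in> A \<and> anc \<T> (j - 1) a2 = ?u. pmf p a2 / M p ?u * f (a1, a2, j)))"
      by (simp add: sum_distrib_left mult.assoc)
  qed
  finally show ?thesis by (simp add: sum_distrib_left)
qed

lemma sum_cond:
  assumes "a \<in> A" "j \<le> L" "M p (anc \<T> j a) \<noteq> 0"
  shows "(\<Sum>b | b \<in> A \<and> anc \<T> j b = anc \<T> j a. pmf p b / M p (anc \<T> j a)) = 1"
proof -
  have "M p (anc \<T> j a) = (\<Sum>b | b \<in> A \<and> anc \<T> j b = anc \<T> j a. pmf p b)"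
    using assms anc_in_level by (intro mass_level)
  then show ?thesis using assms by (simp add: sum_divide_distrib[symmetric])
qed

lemma sum_cond_pred:
  assumes "\<And>v. 0 < M p v" "a \<in> A" "j \<in> {1..L}"
  shows "(\<Sum>b | b \<in> A \<and> anc \<T> (j - 1) b = anc \<T> (j - 1) a. pmf p b / M p (anc \<T> (j - 1) a)) = 1"
proof (rule sum_cond)
  show "M p (anc \<T> (j - 1) a) \<noteq> 0" using assms(1)[of "anc \<T> (j - 1) a"] by simp
qed (use assms in auto)

lemma sum_\<delta>: "(\<Sum>j=1..L. pmf \<delta> j) = 1"
  using \<delta>_support by (intro sum_pmf_eq_1) auto

lemma sum_draw_move_first:
  assumes p: "set_pmf p = A" and p_pos: "\<And>v. 0 < M p v"
  shows "(\<Sum>m\<in>moves. pmf (draw_move \<T> \<delta> p) m * (case m of (a1, a2, j) \<Rightarrow> f a1 j))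
    = (\<Sum>j=1..L. pmf \<delta> j * (\<Sum>a\<in>A. pmf p a * f a j))"
proof -
  have "(\<Sum>a2 | a2 \<in> A \<and> anc \<T> (j - 1) a2 = anc \<T> (j - 1) a1.
      pmf p a2 / M p (anc \<T> (j - 1) a1) * f a1 j) = f a1 j" if "j \<in> {1..L}" "a1 \<in> A" for j a1
    unfolding sum_distrib_right[symmetric]
    using sum_cond_pred[OF p_pos that(2), of j] that(1) by simp
  then show ?thesis unfolding sum_draw_move[OF p] by simp
qed

text \<open>For fixed \<open>j\<close> the joint weight \<open>p a1 * p a2 / M p u\<close>, with
  \<open>u\<close> the common ancestor at depth \<open>j - 1\<close>, is symmetric in the two
  leaves, so the second action inherits the marginal law of the first.\<close>

lemma sum_draw_move_second:
  assumes p: "set_pmf p = A" and p_pos: "\<And>v. 0 < M p v"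
  shows "(\<Sum>m\<in>moves. pmf (draw_move \<T> \<delta> p) m * (case m of (a1, a2, j) \<Rightarrow> f a2))
    = (\<Sum>a\<in>A. pmf p a * f a)"
proof -
  have "(\<Sum>a1\<in>A. pmf p a1 * (\<Sum>a2 | a2 \<in> A \<and> anc \<T> (j - 1) a2 = anc \<T> (j - 1) a1.
          pmf p a2 / M p (anc \<T> (j - 1) a1) * f a2)) = (\<Sum>a\<in>A. pmf p a * f a)" if j: "j \<in> {1..L}" for j
  proof -
    let ?c = "\<lambda>a. anc \<T> (j - 1) a"
    have "(\<Sum>a1\<in>A. pmf p a1 * (\<Sum>a2 | a2 \<in> A \<and> ?c a2 = ?c a1. pmf p a2 / M p (?c a1) * f a2))
        = (\<Sum>a1\<in>A. \<Sum>a2 | a2 \<in> A \<and> ?c a2 = ?c a1. pmf p a2 * f a2 * (pmf p a1 / M p (?c a2)))"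
      unfolding sum_distrib_left by (intro sum.cong refl) auto
    also have "\<dots> = (\<Sum>a2\<in>A. \<Sum>a1 | a1 \<in> A \<and> ?c a2 = ?c a1. pmf p a2 * f a2 * (pmf p a1 / M p (?c a2)))"
      by (rule sum.swap_restrict) auto
    also have "\<dots> = (\<Sum>a2\<in>A. pmf p a2 * f a2)"
    proof (intro sum.cong refl)
      fix a2 assume a2: "a2 \<in> A"
      have "{a1. a1 \<in> A \<and> ?c a2 = ?c a1} = {a1. a1 \<in> A \<and> ?c a1 = ?c a2}" by auto
      then show "(\<Sum>a1 | a1 \<in> A \<and> ?c a2 = ?c a1. pmf p a2 * f a2 * (pmf p a1 / M p (?c a2))) = pmf p a2 * f a2"
        unfolding sum_distrib_left[symmetric] by (simp only: sum_cond_pred[OF p_pos a2 j] mult_1_right)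
    qed
    finally show ?thesis .
  qed
  then show ?thesis
    unfolding sum_draw_move[OF p] by (simp add: sum_distrib_right[symmetric] sum_\<delta>[simplified])
qed

text \<open>
  The estimate is unbiased up to a shift independent of the leaf: given level \<open>j\<close>, the conditional
  mean is the difference of the averages of \<open>y\<close> below the ancestors of \<open>b\<close> at depths \<open>j\<close> and
  \<open>j - 1\<close>, so the sum over \<open>j\<close> telescopes.
\<close>

lemma sum_draw_move_estimate:
  assumes p: "set_pmf p = A" and p_pos: "\<And>v. 0 < M p v" and b: "b \<in> A"
  shows "(\<Sum>m\<in>moves. pmf (draw_move \<T> \<delta> p) m * loss_estimate \<T> \<sigma> \<delta> p (observe (y, m)) b)
    = y b - linear y p + (\<Sum>j=1..L. \<sigma> j)"
proof -
  define Y where "Y j = (\<Sum>a | a \<in> A \<and> anc \<T> j a = anc \<T> j b. pmf p a / M p (anc \<T> j b) * y a)" for j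
  have "(\<Sum>m\<in>moves. pmf (draw_move \<T> \<delta> p) m * loss_estimate \<T> \<sigma> \<delta> p (observe (y, m)) b)
      = (\<Sum>j=1..L. Y j - Y (j - 1) + \<sigma> j)"
    unfolding sum_draw_move[OF p]
  proof (intro sum.cong refl)
    fix j assume j: "j \<in> {1..L}"
    let ?v = "anc \<T> j b" and ?u = "anc \<T> (j - 1) b"
    have d: "pmf \<delta> j > 0" by (rule \<delta>_pos[OF j])
    have inner: "(\<Sum>a2 | a2 \<in> A \<and> anc \<T> (j - 1) a2 = anc \<T> (j - 1) a1.
          pmf p a2 / M p (anc \<T> (j - 1) a1) * loss_estimate \<T> \<sigma> \<delta> p (observe (y, a1, a2, j)) b)
        = (if anc \<T> j a1 = ?v then (y a1 - Y (j - 1) + \<sigma> j) / (pmf \<delta> j * M p ?v) else 0)"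
      if a1: "a1 \<in> A" for a1
    proof (cases "anc \<T> j a1 = ?v")
      case False
      then show ?thesis by (auto simp: observe_def loss_estimate_def same_anc_def)
    next
      case True
      \<comment> \<open>Sharing the ancestor at depth \<open>j\<close> forces sharing it at depth
        \<open>j - 1\<close>, so the second action is drawn from the block of
        \<open>b\<close>.\<close>
      then have u: "anc \<T> (j - 1) a1 = ?u"
        using same_anc_mono[OF a1 b, of "j - 1" j] j by (simp add: same_anc_def)
      have "(\<Sum>a2 | a2 \<in> A \<and> anc \<T> (j - 1) a2 = ?u.
          pmf p a2 / M p ?u * loss_estimate \<T> \<sigma> \<delta> p (observe (y, a1, a2, j)) b)
        = (\<Sum>a2 | a2 \<in> A \<and> anc \<T> (j - 1) a2 = ?u.
          (pmf p a2 / M p ?u * (y a1 + \<sigma> j) - pmf p a2 / M p ?u * y a2) / (pmf \<delta> j * M p ?v))"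
      proof (intro sum.cong refl)
        fix a2
        have "loss_estimate \<T> \<sigma> \<delta> p (observe (y, a1, a2, j)) b = (y a1 - y a2 + \<sigma> j) / (pmf \<delta> j * M p ?v)"
          using True by (simp add: observe_def loss_estimate_def same_anc_def)
        moreover have "k * ((y a1 - y a2 + \<sigma> j) / c) = (k * (y a1 + \<sigma> j) - k * y a2) / c" for k c :: real
          by (simp add: algebra_simps add_divide_distrib diff_divide_distrib)
        ultimately show "pmf p a2 / M p ?u * loss_estimate \<T> \<sigma> \<delta> p (observe (y, a1, a2, j)) b
            = (pmf p a2 / M p ?u * (y a1 + \<sigma> j) - pmf p a2 / M p ?u * y a2) / (pmf \<delta> j * M p ?v)"
          by (simp only:)
      qed
      also have "\<dots> = ((\<Sum>a2 | a2 \<in> A \<and> anc \<T> (j - 1) a2 = ?u. pmf p a2 / M p ?u) * (y a1 + \<sigma> j) - Y (j - 1))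
          / (pmf \<delta> j * M p ?v)"
        by (simp only: sum_divide_distrib[symmetric] sum_subtractf sum_distrib_right[symmetric] Y_def)
      also have "(\<Sum>a2 | a2 \<in> A \<and> anc \<T> (j - 1) a2 = ?u. pmf p a2 / M p ?u) = 1"
        by (rule sum_cond_pred[OF p_pos b j])
      finally show ?thesis using True u by (simp add: algebra_simps)
    qed
    have "pmf \<delta> j * (\<Sum>a1\<in>A. pmf p a1 * (\<Sum>a2 | a2 \<in> A \<and> anc \<T> (j - 1) a2 = anc \<T> (j - 1) a1.
          pmf p a2 / M p (anc \<T> (j - 1) a1) * loss_estimate \<T> \<sigma> \<delta> p (observe (y, a1, a2, j)) b))
        = pmf \<delta> j * (\<Sum>a1\<in>A. if anc \<T> j a1 = ?v then pmf p a1 * ((y a1 - Y (j - 1) + \<sigma> j) / (pmf \<delta> j * M p ?v)) else 0)"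
      using inner by (intro arg_cong2[of _ _ _ _ "(*)"] sum.cong refl) auto
    also have "\<dots> = pmf \<delta> j * (\<Sum>a1 | a1 \<in> A \<and> anc \<T> j a1 = ?v. pmf p a1 * ((y a1 - Y (j - 1) + \<sigma> j) / (pmf \<delta> j * M p ?v)))"
      by (intro arg_cong2[of _ _ _ _ "(*)"] refl sum.inter_filter[symmetric]) simp
    also have "\<dots> = (\<Sum>a1 | a1 \<in> A \<and> anc \<T> j a1 = ?v.
          pmf p a1 / M p ?v * y a1 + pmf p a1 / M p ?v * (\<sigma> j - Y (j - 1)))"
      unfolding sum_distrib_left
    proof (intro sum.cong refl)
      fix a1
      have "M p ?v \<noteq> 0" using p_pos[of ?v] by simp
      then show "pmf \<delta> j * (pmf p a1 * ((y a1 - Y (j - 1) + \<sigma> j) / (pmf \<delta> j * M p ?v)))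
          = pmf p a1 / M p ?v * y a1 + pmf p a1 / M p ?v * (\<sigma> j - Y (j - 1))"
        using d by (simp add: field_simps)
    qed
    also have "\<dots> = Y j + (\<Sum>a1 | a1 \<in> A \<and> anc \<T> j a1 = ?v. pmf p a1 / M p ?v) * (\<sigma> j - Y (j - 1))"
      by (simp only: sum.distrib sum_distrib_right[symmetric] Y_def)
    also have "(\<Sum>a1 | a1 \<in> A \<and> anc \<T> j a1 = ?v. pmf p a1 / M p ?v) = 1"
      using sum_cond[OF b, of j p] p_pos[of ?v] j by simp
    finally show "pmf \<delta> j * (\<Sum>a1\<in>A. pmf p a1 * (\<Sum>a2 | a2 \<in> A \<and> anc \<T> (j - 1) a2 = anc \<T> (j - 1) a1.
          pmf p a2 / M p (anc \<T> (j - 1) a1) * loss_estimate \<T> \<sigma> \<delta> p (observe (y, a1, a2, j)) b))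
        = Y j - Y (j - 1) + \<sigma> j"
      by simp
  qed
  also have "\<dots> = Y L - Y 0 + (\<Sum>j=1..L. \<sigma> j)"
  proof -
    have "(\<Sum>j=1..n. Y j - Y (j - 1)) = Y n - Y 0" for n by (induction n) auto
    then show ?thesis by (simp add: sum.distrib)
  qed
  also have "Y L = y b"
  proof -
    have "{a \<in> A. anc \<T> L a = anc \<T> L b} = {b}" using b by (auto simp: anc_L)
    moreover have "M p b = pmf p b" "pmf p b \<noteq> 0"
      using M_leaf[OF b] p b by (auto simp: set_pmf_iff)
    ultimately show ?thesis using b by (simp add: Y_def anc_L)
  qed
  also have "Y 0 = linear y p"
  proof -
    have root: "anc \<T> 0 a = rt" if "a \<in> A" for a
      using anc_in_level[OF that, of 0] depth_eq_0_iff by (simp add: level_def)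
    have "level \<T> 0 = {rt}" using depth_eq_0_iff by (auto simp: level_def)
    then have "M p (anc \<T> 0 b) = 1" using sum_M[of p 0] p root[OF b] by simp
    moreover have "{a \<in> A. anc \<T> 0 a = anc \<T> 0 b} = A" using root b by auto
    ultimately show ?thesis by (simp add: Y_def linear_def mult.commute)
  qed
  finally show ?thesis by simp
qed

end

section \<open>The law of the game\<close>

locale bandit_game =
  fixes A :: "'v::finite set" and env :: "'v environment" and \<pi> :: "'v algorithm"
  assumes env: "is_environment A env" and alg: "is_algorithm A \<pi>"
begin

abbreviation "G \<equiv> game_law A env \<pi>"
abbreviation "history n \<equiv> \<Pi>\<^sub>M i\<in>{0..<n}. round_space A"
abbreviation past :: "nat \<Rightarrow> (nat \<Rightarrow> 'v round) \<Rightarrow> nat \<Rightarrow> 'v round" where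
  "past n \<omega> \<equiv> restrict \<omega> {0..<n}"
abbreviation move_prob :: "nat \<Rightarrow> (nat \<Rightarrow> 'v round) \<Rightarrow> 'v move \<Rightarrow> real" where
  "move_prob n \<omega> m \<equiv> pmf (\<pi> n (observed n \<omega>)) m"

sublocale IT: Ionescu_Tulcea "round_kernel env \<pi>" "\<lambda>_. round_space A"
  using env alg by (rule Ionescu_Tulcea_round_kernel)

lemma G_eq: "G = IT.PF.lim"
  by (simp add: game_law_def)

lemma sets_G [measurable_cong]: "sets G = sets (\<Pi>\<^sub>M i\<in>UNIV. round_space A)"
  by (simp add: G_eq)

text \<open>\<open>IT.up_to\<close> is the least strict upper bound of an index set, here
  \<open>n\<close> itself, so the marginal of the infinite play is the plain composition of the
  first \<open>n\<close> kernels.\<close>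

lemma distr_past: "distr G (history n) (past n) = IT.C 0 n (\<lambda>_. undefined)"
proof -
  have "IT.up_to {0..<n} = n"
  proof (rule antisym)
    show "IT.up_to {0..<n} \<le> n" by (simp add: IT.up_to_iff)
    have "IT.up_to {0..<n} \<le> IT.up_to {0..<n}" ..
    then have "\<forall>i\<in>{0..<n}. i < IT.up_to {0..<n}" by (subst (asm) IT.up_to_iff) auto
    then show "n \<le> IT.up_to {0..<n}" by (meson atLeastLessThan_iff le0 less_irrefl not_le_imp_less)
  qed
  then have "IT.CI {0..<n} = IT.C 0 n (\<lambda>_. undefined)"
    using IT.distr_C[of n n "\<lambda>_. undefined" 0] by (simp add: IT.CI_def)
  then show ?thesis using IT.distr_lim[of "{0..<n}"] by (simp add: G_eq)
qed

lemma measurable_past [measurable]: "past n \<in> G \<rightarrow>\<^sub>M history n"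
  by (simp add: measurable_cong_sets[OF sets_G refl] measurable_restrict_subset)

lemma measurable_round [measurable]: "(\<lambda>\<omega>. \<omega> n) \<in> G \<rightarrow>\<^sub>M round_space A"
  by (simp add: measurable_cong_sets[OF sets_G refl])

sublocale G: prob_space G
proof (rule prob_space_distrD[OF measurable_past[of 0]])
  show "prob_space (distr G (history 0) (past 0))"
    unfolding distr_past by (rule IT.prob_space_C) simp
qed

lemma measurable_loss [measurable]: "(\<lambda>\<omega>. fst (\<omega> n)) \<in> G \<rightarrow>\<^sub>M loss_space A"
  using measurable_round unfolding round_space_def by (rule measurable_compose) simp

lemma measurable_move [measurable]: "(\<lambda>\<omega>. snd (\<omega> n)) \<in> G \<rightarrow>\<^sub>M count_space UNIV"
  using measurable_round unfolding round_space_def by (rule measurable_compose) simp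

lemma observed_past: "observed n (past n \<omega>) = observed n \<omega>"
  by (auto simp: observed_def)

lemma measurable_move_prob: "(\<lambda>h. move_prob n h m) \<in> borel_measurable (history n)"
proof -
  have "(\<lambda>h. measure_pmf (\<pi> n (observed n h))) \<in> history n \<rightarrow>\<^sub>M prob_algebra (count_space UNIV)"
    using alg by (intro measurable_compose[OF measurable_observed]) (simp add: is_algorithm_def)
  then have "(\<lambda>h. measure_pmf (\<pi> n (observed n h))) \<in> history n \<rightarrow>\<^sub>M subprob_algebra (count_space UNIV)"
    by (rule measurable_prob_algebraD)
  then show ?thesis
    unfolding pmf.rep_eq by (rule measure_measurable_subprob_algebra2[rotated]) simp
qed

lemma measurable_move_prob_past [measurable]: "(\<lambda>\<omega>. move_prob n \<omega> m) \<in> borel_measurable G"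
  using measurable_compose[OF measurable_past measurable_move_prob, of n m] by (simp add: observed_past)

lemma past_in_space: "\<omega> \<in> space G \<Longrightarrow> past n \<omega> \<in> space (history n)"
  by (rule measurable_space[OF measurable_past])

text \<open>The tower property for one round: the last coordinate is integrated against its kernel,
  with the past still distributed by the infinite play.\<close>

lemma nn_integral_game:
  assumes f [measurable]: "f \<in> borel_measurable (history (Suc n))"
  shows "(\<integral>\<^sup>+\<omega>. f (past (Suc n) \<omega>) \<partial>G)
    = (\<integral>\<^sup>+\<omega>. (\<integral>\<^sup>+r. f ((past n \<omega>)(n := r)) \<partial>round_kernel env \<pi> n (past n \<omega>)) \<partial>G)"
proof -
  let ?u = "\<lambda>_::nat. undefined :: 'v round"
  let ?g = "\<lambda>h. \<integral>\<^sup>+x. f x \<partial>IT.eP n h"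
  have u: "?u \<in> space (history 0)" by simp
  have g [measurable]: "?g \<in> borel_measurable (history n)"
    by (rule nn_integral_measurable_subprob_algebra2[OF _ IT.measurable_eP]) simp
  have "(\<integral>\<^sup>+\<omega>. f (past (Suc n) \<omega>) \<partial>G) = (\<integral>\<^sup>+h. f h \<partial>distr G (history (Suc n)) (past (Suc n)))"
    by (simp add: nn_integral_distr)
  also have "\<dots> = (\<integral>\<^sup>+h. f h \<partial>(IT.C 0 n ?u \<bind> IT.eP n))"
    unfolding distr_past by simp
  also have "\<dots> = (\<integral>\<^sup>+h. ?g h \<partial>IT.C 0 n ?u)"
    using IT.measurable_eP[of n] IT.sets_C[OF u, of n]
    by (subst nn_integral_bind[where B = "history (Suc n)"]) (auto cong: measurable_cong_sets)
  also have "\<dots> = (\<integral>\<^sup>+\<omega>. ?g (past n \<omega>) \<partial>G)"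
    unfolding distr_past[symmetric] by (simp add: nn_integral_distr)
  also have "\<dots> = (\<integral>\<^sup>+\<omega>. (\<integral>\<^sup>+r. f ((past n \<omega>)(n := r)) \<partial>round_kernel env \<pi> n (past n \<omega>)) \<partial>G)"
    by (intro nn_integral_cong IT.nn_integral_eP past_in_space f)
  finally show ?thesis .
qed

section \<open>Conditional independence of loss and move within a round\<close>

lemma prob_space_env: "h \<in> space (history n) \<Longrightarrow> prob_space (env n h)"
  and sets_env: "h \<in> space (history n) \<Longrightarrow> sets (env n h) = sets (loss_space A)"
  using env measurable_space[of "env n" "history n" "prob_algebra (loss_space A)" h]
  by (auto simp: is_environment_def space_prob_algebra)

lemma nn_integral_round_kernel:
  assumes h: "h \<in> space (history n)" and F: "F \<in> borel_measurable (loss_space A)"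
  shows "(\<integral>\<^sup>+r. F (fst r) * k (snd r) \<partial>round_kernel env \<pi> n h)
    = (\<integral>\<^sup>+y. F y \<partial>env n h) * (\<integral>\<^sup>+m. k m \<partial>measure_pmf (\<pi> n (observed n h)))"
proof -
  interpret env: prob_space "env n h" by (rule prob_space_env[OF h])
  interpret pair_sigma_finite "env n h" "measure_pmf (\<pi> n (observed n h))" ..
  have [measurable]: "F \<in> borel_measurable (env n h)"
    using F by (simp add: measurable_cong_sets[OF sets_env[OF h] refl])
  have "(\<integral>\<^sup>+r. F (fst r) * k (snd r) \<partial>round_kernel env \<pi> n h)
      = (\<integral>\<^sup>+y. (\<integral>\<^sup>+m. F y * k m \<partial>measure_pmf (\<pi> n (observed n h))) \<partial>env n h)"
    unfolding round_kernel_def by (subst measure_pmf.nn_integral_fst[symmetric]) auto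
  also have "\<dots> = (\<integral>\<^sup>+y. F y * (\<integral>\<^sup>+m. k m \<partial>measure_pmf (\<pi> n (observed n h))) \<partial>env n h)"
    by (simp add: nn_integral_cmult)
  also have "\<dots> = (\<integral>\<^sup>+y. F y \<partial>env n h) * (\<integral>\<^sup>+m. k m \<partial>measure_pmf (\<pi> n (observed n h)))"
    by (rule nn_integral_multc) simp
  finally show ?thesis .
qed

text \<open>Both sides equal the integral over the past of \<open>\<integral> F d(env)\<close> times
  the move probability, because the round kernel is a product. Thus the move is averaged out while
  the past and the current loss stay fixed.\<close>

lemma nn_integral_move:
  assumes F [measurable]: "F \<in> borel_measurable (history n \<Otimes>\<^sub>M loss_space A)"
  shows "(\<integral>\<^sup>+\<omega>. F (past n \<omega>, fst (\<omega> n)) * indicator {m} (snd (\<omega> n)) \<partial>G)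
    = (\<integral>\<^sup>+\<omega>. F (past n \<omega>, fst (\<omega> n)) * ennreal (move_prob n \<omega> m) \<partial>G)"
proof -
  have past_past: "past n (past (Suc n) \<omega>) = past n \<omega>" "past n ((past n \<omega>)(n := r)) = past n \<omega>" for \<omega> r
    by auto
  have [measurable]: "past n \<in> history (Suc n) \<rightarrow>\<^sub>M history n"
    by (rule measurable_restrict_subset) auto
  have round: "(\<lambda>h. h n) \<in> history (Suc n) \<rightarrow>\<^sub>M round_space A" by simp
  have [measurable]: "(\<lambda>h. fst (h n)) \<in> history (Suc n) \<rightarrow>\<^sub>M loss_space A"
    "(\<lambda>h. snd (h n)) \<in> history (Suc n) \<rightarrow>\<^sub>M count_space UNIV"
    using round unfolding round_space_def by (auto intro: measurable_compose)
  have [measurable]: "(\<lambda>h. move_prob n (past n h) m) \<in> borel_measurable (history (Suc n))"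
    by (rule measurable_compose[OF _ measurable_move_prob]) simp
  have F_h [measurable]: "(\<lambda>y. F (h, y)) \<in> borel_measurable (loss_space A)" if "h \<in> space (history n)" for h
    using that by simp
  have "(\<integral>\<^sup>+\<omega>. F (past n \<omega>, fst (\<omega> n)) * indicator {m} (snd (\<omega> n)) \<partial>G)
      = (\<integral>\<^sup>+\<omega>. (\<integral>\<^sup>+r. F (past n \<omega>, fst r) * indicator {m} (snd r) \<partial>round_kernel env \<pi> n (past n \<omega>)) \<partial>G)"
    using nn_integral_game[of "\<lambda>h. F (past n h, fst (h n)) * indicator {m} (snd (h n))" n]
    by (simp add: past_past)
  also have "\<dots> = (\<integral>\<^sup>+\<omega>. (\<integral>\<^sup>+y. F (past n \<omega>, y) \<partial>env n (past n \<omega>)) * ennreal (move_prob n \<omega> m) \<partial>G)"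
    using past_in_space F_h
    by (intro nn_integral_cong, subst nn_integral_round_kernel)
       (auto simp: emeasure_pmf_single observed_past)
  \<comment> \<open>The way back: given the past the probability is a constant, which may stand as
    the move factor of the product kernel.\<close>
  also have "\<dots> = (\<integral>\<^sup>+\<omega>. (\<integral>\<^sup>+r. F (past n \<omega>, fst r) * ennreal (move_prob n \<omega> m) \<partial>round_kernel env \<pi> n (past n \<omega>)) \<partial>G)"
    using past_in_space F_h
    by (intro nn_integral_cong, subst nn_integral_round_kernel[where k = "\<lambda>_. ennreal (move_prob n _ m)"])
       (auto simp: observed_past)
  also have "\<dots> = (\<integral>\<^sup>+\<omega>. F (past n \<omega>, fst (\<omega> n)) * ennreal (move_prob n \<omega> m) \<partial>G)"
  proof -
    have "(\<lambda>h. F (past n h, fst (h n)) * ennreal (move_prob n (past n h) m))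
        \<in> borel_measurable (history (Suc n))"
      by measurable
    from nn_integral_game[OF this] show ?thesis by (simp add: past_past observed_past)
  qed
  finally show ?thesis .
qed

text \<open>Confines the pathwise analysis to moves in the support, whose two actions share the
  ancestor at depth \<open>j - 1\<close>. There are countably many moves, so the exceptional null
  sets can be united.\<close>

lemma AE_move_prob_pos: "AE \<omega> in G. 0 < move_prob n \<omega> (snd (\<omega> n))"
proof -
  have "AE \<omega> in G. snd (\<omega> n) = m \<longrightarrow> 0 < move_prob n \<omega> m" for m
  proof -
    let ?F = "\<lambda>(h, y :: 'v \<Rightarrow> real). indicator {x. x \<le> (0::real)} (move_prob n h m) :: ennreal"
    note [measurable] = measurable_move_prob
    have F: "?F \<in> borel_measurable (history n \<Otimes>\<^sub>M loss_space A)"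
      by measurable
    have "(\<integral>\<^sup>+\<omega>. ?F (past n \<omega>, fst (\<omega> n)) * indicator {m} (snd (\<omega> n)) \<partial>G) = 0"
      unfolding nn_integral_move[OF F] by (simp add: observed_past nn_integral_0_iff_AE indicator_def)
    then have "AE \<omega> in G. ?F (past n \<omega>, fst (\<omega> n)) * indicator {m} (snd (\<omega> n)) = 0"
      by (subst (asm) nn_integral_0_iff_AE) (auto simp: observed_past)
    then show ?thesis
      by eventually_elim (auto simp: observed_past indicator_def split: if_splits)
  qed
  then have "AE \<omega> in G. \<forall>m. snd (\<omega> n) = m \<longrightarrow> 0 < move_prob n \<omega> m"
    by (subst AE_all_countable) blast
  then show ?thesis by eventually_elim blast
qed

text \<open>Tree compatibility is assumed kernel by kernel. The indicator of its failure integrates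
  to 0 under every kernel, hence under the law of the play.\<close>

lemma AE_loss:
  assumes Q: "Measurable.pred (loss_space A) Q"
    and AE: "\<And>h. h \<in> space (history n) \<Longrightarrow> AE y in env n h. Q y"
  shows "AE \<omega> in G. Q (fst (\<omega> n))"
proof -
  let ?f = "\<lambda>y. indicator {y. \<not> Q y} y :: ennreal"
  have f: "?f \<in> borel_measurable (loss_space A)"
    using Q by (auto simp: indicator_def)
  have round: "(\<lambda>h. h n) \<in> history (Suc n) \<rightarrow>\<^sub>M round_space A" by simp
  have "(\<lambda>h. fst (h n)) \<in> history (Suc n) \<rightarrow>\<^sub>M loss_space A"
    using round unfolding round_space_def by (auto intro: measurable_compose)
  then have "(\<lambda>h. ?f (fst (h n))) \<in> borel_measurable (history (Suc n))"
    by (rule measurable_compose[OF _ f])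
  from nn_integral_game[OF this]
  have "(\<integral>\<^sup>+\<omega>. ?f (fst (\<omega> n)) \<partial>G)
      = (\<integral>\<^sup>+\<omega>. (\<integral>\<^sup>+r. ?f (fst r) * 1 \<partial>round_kernel env \<pi> n (past n \<omega>)) \<partial>G)"
    by simp
  also have "\<dots> = (\<integral>\<^sup>+\<omega>. 0 \<partial>G)"
  proof (rule nn_integral_cong)
    fix \<omega> assume "\<omega> \<in> space G"
    then have h: "past n \<omega> \<in> space (history n)" by (rule past_in_space)
    have "(\<integral>\<^sup>+y. ?f y \<partial>env n (past n \<omega>)) = (\<integral>\<^sup>+y. 0 \<partial>env n (past n \<omega>))"
      using AE[OF h] by (intro nn_integral_cong_AE) (auto simp: indicator_def)
    then show "(\<integral>\<^sup>+r. ?f (fst r) * 1 \<partial>round_kernel env \<pi> n (past n \<omega>)) = 0"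
      using nn_integral_round_kernel[OF h f, of "\<lambda>_. 1"] by simp
  qed
  finally have "(\<integral>\<^sup>+\<omega>. ?f (fst (\<omega> n)) \<partial>G) = 0" by simp
  moreover have "(\<lambda>\<omega>. ?f (fst (\<omega> n))) \<in> borel_measurable G"
    by (rule measurable_compose[OF measurable_loss f])
  ultimately have "AE \<omega> in G. ?f (fst (\<omega> n)) = 0"
    by (simp add: nn_integral_0_iff_AE)
  then show ?thesis by eventually_elim (auto simp: indicator_def split: if_splits)
qed

lemma integral_single_move:
  fixes f :: "(nat \<Rightarrow> 'v round) \<times> ('v \<Rightarrow> real) \<Rightarrow> real"
  assumes f [measurable]: "f \<in> borel_measurable (history n \<Otimes>\<^sub>M loss_space A)"
    and int: "integrable G (\<lambda>\<omega>. move_prob n \<omega> m * f (past n \<omega>, fst (\<omega> n)))"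
  shows "integrable G (\<lambda>\<omega>. indicator {m} (snd (\<omega> n)) * f (past n \<omega>, fst (\<omega> n)))"
    and "(\<integral>\<omega>. indicator {m} (snd (\<omega> n)) * f (past n \<omega>, fst (\<omega> n)) \<partial>G)
      = (\<integral>\<omega>. move_prob n \<omega> m * f (past n \<omega>, fst (\<omega> n)) \<partial>G)"
proof -
  \<comment> \<open>The constants \<open>c = 1\<close> and \<open>c = -1\<close> yield the positive
    and the negative part of \<open>f\<close>, which transfers both integrability and the
    value.\<close>
  have nn: "(\<integral>\<^sup>+\<omega>. ennreal (indicator {m} (snd (\<omega> n)) * (c * f (past n \<omega>, fst (\<omega> n)))) \<partial>G)
      = (\<integral>\<^sup>+\<omega>. ennreal (move_prob n \<omega> m * (c * f (past n \<omega>, fst (\<omega> n)))) \<partial>G)" for c :: real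
    using nn_integral_move[of "\<lambda>x. ennreal (c * f x)" n m]
    by (simp add: ennreal_mult' mult.commute ennreal_indicator)
  have meas: "(\<lambda>\<omega>. indicator {m} (snd (\<omega> n)) * f (past n \<omega>, fst (\<omega> n))) \<in> borel_measurable G"
    by measurable
  show int': "integrable G (\<lambda>\<omega>. indicator {m} (snd (\<omega> n)) * f (past n \<omega>, fst (\<omega> n)))"
    using int meas nn[of 1] nn[of "-1"] unfolding real_integrable_def by simp
  show "(\<integral>\<omega>. indicator {m} (snd (\<omega> n)) * f (past n \<omega>, fst (\<omega> n)) \<partial>G)
      = (\<integral>\<omega>. move_prob n \<omega> m * f (past n \<omega>, fst (\<omega> n)) \<partial>G)"
    using nn[of 1] nn[of "-1"]
    unfolding real_lebesgue_integral_def[OF int] real_lebesgue_integral_def[OF int'] by simp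
qed

lemma integral_move:
  fixes f :: "'v move \<Rightarrow> (nat \<Rightarrow> 'v round) \<times> ('v \<Rightarrow> real) \<Rightarrow> real"
  assumes fin: "finite S" and supp: "\<And>\<omega>. set_pmf (\<pi> n (observed n \<omega>)) \<subseteq> S"
    and f [measurable]: "\<And>m. f m \<in> borel_measurable (history n \<Otimes>\<^sub>M loss_space A)"
    and int: "\<And>m. m \<in> S \<Longrightarrow> integrable G (\<lambda>\<omega>. move_prob n \<omega> m * f m (past n \<omega>, fst (\<omega> n)))"
  shows "integrable G (\<lambda>\<omega>. f (snd (\<omega> n)) (past n \<omega>, fst (\<omega> n)))"
    and "(\<integral>\<omega>. f (snd (\<omega> n)) (past n \<omega>, fst (\<omega> n)) \<partial>G)
      = (\<integral>\<omega>. (\<Sum>m\<in>S. move_prob n \<omega> m * f m (past n \<omega>, fst (\<omega> n))) \<partial>G)"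
proof -
  let ?f = "\<lambda>\<omega>. f (snd (\<omega> n)) (past n \<omega>, fst (\<omega> n))"
  let ?g = "\<lambda>\<omega>. \<Sum>m\<in>S. indicator {m} (snd (\<omega> n)) * f m (past n \<omega>, fst (\<omega> n))"
  \<comment> \<open>Expanding over the finite set \<open>S\<close> is correct only up to the null
    event that the move leaves the support.\<close>
  have ae: "AE \<omega> in G. ?g \<omega> = ?f \<omega>"
    using AE_move_prob_pos[of n]
  proof eventually_elim
    case (elim \<omega>)
    then have S: "snd (\<omega> n) \<in> S" using supp[of \<omega>] by (auto simp: pmf_positive_iff)
    have "?g \<omega> = (\<Sum>m\<in>S. if m = snd (\<omega> n) then f m (past n \<omega>, fst (\<omega> n)) else 0)"
      by (intro sum.cong) (auto simp: indicator_def)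
    then show ?case using S fin by simp
  qed
  have int_g: "integrable G ?g"
    using int by (intro Bochner_Integration.integrable_sum integral_single_move) auto
  have meas: "?f \<in> borel_measurable G"
    by (rule measurable_compose_countable[OF _ measurable_move]) measurable
  show "integrable G ?f"
    using int_g integrable_cong_AE[OF borel_measurable_integrable[OF int_g] meas ae] by simp
  have "(\<integral>\<omega>. ?f \<omega> \<partial>G) = (\<integral>\<omega>. ?g \<omega> \<partial>G)"
    using ae by (intro integral_cong_AE meas borel_measurable_integrable[OF int_g]) auto
  also have "\<dots> = (\<Sum>m\<in>S. \<integral>\<omega>. indicator {m} (snd (\<omega> n)) * f m (past n \<omega>, fst (\<omega> n)) \<partial>G)"
    using int by (intro Bochner_Integration.integral_sum integral_single_move) auto
  also have "\<dots> = (\<Sum>m\<in>S. \<integral>\<omega>. move_prob n \<omega> m * f m (past n \<omega>, fst (\<omega> n)) \<partial>G)"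
    using int by (intro sum.cong integral_single_move) auto
  also have "\<dots> = (\<integral>\<omega>. (\<Sum>m\<in>S. move_prob n \<omega> m * f m (past n \<omega>, fst (\<omega> n))) \<partial>G)"
    using int by (intro Bochner_Integration.integral_sum[symmetric]) auto
  finally show "(\<integral>\<omega>. ?f \<omega> \<partial>G)
      = (\<integral>\<omega>. (\<Sum>m\<in>S. move_prob n \<omega> m * f m (past n \<omega>, fst (\<omega> n))) \<partial>G)" .
qed

lemma measurable_loss_component [measurable]: "(\<lambda>y. y a) \<in> borel_measurable (loss_space A)"
proof (cases "a \<in> A")
  case True
  then show ?thesis by (simp add: loss_space_def)
next
  case False
  then have "y a = undefined" if "y \<in> space (loss_space A)" for y
    using that by (auto simp: loss_space_def space_PiM PiE_iff extensional_def)
  then have "(\<lambda>y. y a) \<in> borel_measurable (loss_space A) \<longleftrightarrow>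
      (\<lambda>y. undefined :: real) \<in> borel_measurable (loss_space A)"
    by (intro measurable_cong) auto
  then show ?thesis by simp
qed

end

section \<open>Expected regret\<close>

locale tree_game = tree_algorithm \<T> L \<sigma> \<delta>
  for \<T> :: "'v::finite rooted_tree" and L \<sigma> \<delta> +
  fixes env :: "'v environment" and T :: nat
  assumes is_env: "is_environment A env"
    and compatible: "tree_compatible_environment \<T> L \<sigma> env"
    and integrable_losses: "integrable_losses A env (tree_ftrl \<T> L \<sigma> \<delta>) T"
    and T: "1 \<le> T"
begin

sublocale bandit_game A env "tree_ftrl \<T> L \<sigma> \<delta>"
  using is_env is_algorithm_tree_ftrl by unfold_locales

definition strategy :: "nat \<Rightarrow> (nat \<Rightarrow> 'v round) \<Rightarrow> 'v pmf" where
  "strategy n \<omega> = P (Suc n) (cumulative_estimate \<T> L \<sigma> \<delta> n (observed n \<omega>))"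

definition estimate :: "nat \<Rightarrow> (nat \<Rightarrow> 'v round) \<Rightarrow> 'v \<Rightarrow> real" where
  "estimate n \<omega> = loss_estimate \<T> \<sigma> \<delta> (strategy n \<omega>) (observe (\<omega> n))"

definition move_stability :: "nat \<Rightarrow> 'v pmf \<Rightarrow> 'v move \<Rightarrow> real" where
  "move_stability n p = (\<lambda>(a1, a2, j). stability_bound (Suc n) p j (anc \<T> j a1))"

lemma tree_ftrl_eq: "tree_ftrl \<T> L \<sigma> \<delta> n (observed n \<omega>) = draw_move \<T> \<delta> (strategy n \<omega>)"
  by (simp add: tree_ftrl_def strategy_def)

lemma strategy_past: "strategy n (past n \<omega>) = strategy n \<omega>"
  by (simp add: strategy_def observed_past)

lemma set_strategy: "set_pmf (strategy n \<omega>) = A"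
proof
  show "set_pmf (strategy n \<omega>) \<subseteq> A" unfolding strategy_def by (rule ftrl_point_support)
  show "A \<subseteq> set_pmf (strategy n \<omega>)"
    unfolding strategy_def using ftrl_point_pos by (auto simp: pmf_positive_iff[symmetric])
qed

lemma set_strategy_subset: "set_pmf (strategy n \<omega>) \<subseteq> A"
  by (simp add: set_strategy)

lemma M_strategy_pos: "0 < M (strategy n \<omega>) v"
  by (simp add: strategy_def M_ftrl_point_pos)

lemma support_moves: "set_pmf (tree_ftrl \<T> L \<sigma> \<delta> n (observed n \<omega>)) \<subseteq> moves"
  unfolding tree_ftrl_eq using set_draw_move[OF set_strategy_subset] by blast

lemma cumulative_estimate_eq:
  "cumulative_estimate \<T> L \<sigma> \<delta> n (observed n \<omega>) = (\<lambda>a. \<Sum>i<n. estimate i \<omega> a)"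
proof (induction n)
  case 0
  then show ?case by simp
next
  case (Suc n)
  have "cumulative_estimate \<T> L \<sigma> \<delta> n (observed (Suc n) \<omega>) = cumulative_estimate \<T> L \<sigma> \<delta> n (observed n \<omega>)"
    by (rule cumulative_estimate_cong) (simp add: observed_def)
  moreover have "observed (Suc n) \<omega> n = observe (\<omega> n)" by (simp add: observed_def)
  ultimately have "cumulative_estimate \<T> L \<sigma> \<delta> (Suc n) (observed (Suc n) \<omega>)
      = (\<lambda>a. cumulative_estimate \<T> L \<sigma> \<delta> n (observed n \<omega>) a + estimate n \<omega> a)"
    by (simp add: estimate_def strategy_def)
  then show ?case by (simp add: Suc.IH)
qed

lemma measurable_strategy: "(\<lambda>h. pmf (strategy n h) a) \<in> borel_measurable (history n)"
  unfolding strategy_def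
proof (intro measurable_ftrl_point measurable_cumulative_estimate)
  fix i assume "i < n"
  then show "(\<lambda>h. observed n h i) \<in> history n \<rightarrow>\<^sub>M observation_space"
    by (intro measurable_compose[OF measurable_observed measurable_component_singleton]) auto
qed

lemma measurable_M_strategy: "(\<lambda>h. M (strategy n h) v) \<in> borel_measurable (history n)"
  unfolding mass_def by (intro borel_measurable_sum measurable_strategy)

lemma measurable_strategy_G [measurable]: "(\<lambda>\<omega>. pmf (strategy n \<omega>) a) \<in> borel_measurable G"
  using measurable_compose[OF measurable_past measurable_strategy] by (simp add: strategy_past)

lemma measurable_M_strategy_G [measurable]: "(\<lambda>\<omega>. M (strategy n \<omega>) v) \<in> borel_measurable G"
  unfolding mass_def by measurable

lemma integrable_loss: "n < T \<Longrightarrow> a \<in> A \<Longrightarrow> integrable G (\<lambda>\<omega>. fst (\<omega> n) a)"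
  using integrable_losses by (simp add: integrable_losses_def loss_at_def)

lemma AE_compatible: "AE \<omega> in G. tree_compatible \<T> L \<sigma> (fst (\<omega> n))"
proof (rule AE_loss)
  show "Measurable.pred (loss_space A) (tree_compatible \<T> L \<sigma>)"
    unfolding tree_compatible_def by measurable
qed (use compatible in \<open>auto simp: tree_compatible_environment_def\<close>)

text \<open>Agreement at depth \<open>j - 1\<close> means similarity at least \<open>j\<close>.
  Monotonicity of the scales covers depths up to \<open>L\<close>; similarity \<open>L + 1\<close>,
  the same leaf played twice, is settled by the convention that the scale is 0 there.\<close>

lemma \<sigma>_similarity:
  assumes "a \<in> A" "b \<in> A" "j \<in> {1..L}" "same_anc \<T> (j - 1) a b"
  shows "\<sigma> (similarity \<T> L a b) \<le> \<sigma> j"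
proof (cases "similarity \<T> L a b = L + 1")
  case True
  then show ?thesis using \<sigma>_last \<sigma>_pos[OF assms(3)] by simp
next
  case False
  moreover have "similarity \<T> L a b \<le> L + 1" using assms by (rule_tac similarity_le)
  moreover have "j \<le> similarity \<T> L a b"
    using similarity_ge[OF assms(4) order.trans[OF diff_le_self]] assms(3) by simp
  ultimately show ?thesis using assms(3) by (intro \<sigma>_antimono) auto
qed

text \<open>For a move in the support the two losses differ by at most \<open>\<sigma> j\<close>, so
  adding \<open>\<sigma> j\<close> brings the numerator into the interval from 0 to
  \<open>2 * \<sigma> j\<close>. This is the range of weights that \<open>stability\<close>
  accepts.\<close>

lemma estimate_stability:
  assumes y: "tree_compatible \<T> L \<sigma> (fst (\<omega> n))" and m: "0 < move_prob n \<omega> (snd (\<omega> n))"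
    and q: "set_pmf q \<subseteq> A"
  defines "Z \<equiv> \<lambda>a. \<Sum>i<n. estimate i \<omega> a"
  shows "linear (estimate n \<omega>) (P (Suc n) Z) - linear (estimate n \<omega>) q
      - (objective (Suc n) Z q - objective (Suc n) Z (P (Suc n) Z))
    \<le> move_stability n (strategy n \<omega>) (snd (\<omega> n))"
proof -
  obtain y a1 a2 j where \<omega>: "\<omega> n = (y, a1, a2, j)" by (cases "\<omega> n")
  have "snd (\<omega> n) \<in> set_pmf (draw_move \<T> \<delta> (strategy n \<omega>))"
    using m by (simp add: tree_ftrl_eq pmf_positive_iff)
  then have "(a1, a2, j) \<in> moves" and same: "same_anc \<T> (j - 1) a2 a1"
    using set_draw_move[OF set_strategy_subset] \<omega> by fastforce+
  then have a: "a1 \<in> A" "a2 \<in> A" and j: "j \<in> {1..L}" by (auto simp: moves_def)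
  have "same_anc \<T> (j - 1) a1 a2" using same by (simp add: same_anc_def)
  then have "\<bar>y a1 - y a2\<bar> \<le> \<sigma> j"
    using y \<omega> a \<sigma>_similarity[OF a j] unfolding tree_compatible_def by force
  then have num: "0 \<le> y a1 - y a2 + \<sigma> j" "y a1 - y a2 + \<sigma> j \<le> 2 * \<sigma> j" by auto
  have p: "strategy n \<omega> = P (Suc n) Z" by (simp add: strategy_def cumulative_estimate_eq Z_def)
  let ?d = "pmf \<delta> j * M (P (Suc n) Z) (anc \<T> j a1)"
  have d: "0 < ?d" using \<delta>_pos[OF j] by (simp add: M_ftrl_point_pos)
  have "estimate n \<omega> b = (if anc \<T> j b = anc \<T> j a1 then (y a1 - y a2 + \<sigma> j) / ?d else 0)" for b
    by (simp add: estimate_def \<omega> observe_def loss_estimate_def same_anc_def p)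
  moreover have "0 \<le> (y a1 - y a2 + \<sigma> j) / ?d" "(y a1 - y a2 + \<sigma> j) / ?d \<le> 2 * \<sigma> j / ?d"
    using num d by (auto intro!: divide_right_mono divide_nonneg_pos)
  ultimately show ?thesis
    unfolding move_stability_def p \<omega> using j a q
    by (auto intro!: stability anc_in_level)
qed

lemma AE_ftrl_regret:
  assumes a: "a \<in> A"
  shows "AE \<omega> in G. (\<Sum>n<T. linear (estimate n \<omega>) (strategy n \<omega>) - estimate n \<omega> a)
    \<le> 12 * sqrt (K_eff \<T> L (\<lambda>j. \<sigma> j / pmf \<delta> j))
      + (\<Sum>n<T. move_stability n (strategy n \<omega>) (snd (\<omega> n)) + penalty_bound (Suc n) (strategy n \<omega>))"
proof -
  have "AE \<omega> in G. \<forall>n. tree_compatible \<T> L \<sigma> (fst (\<omega> n))" by (simp add: AE_all_countable AE_compatible)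
  moreover have "AE \<omega> in G. \<forall>n. 0 < move_prob n \<omega> (snd (\<omega> n))" by (simp add: AE_all_countable AE_move_prob_pos)
  ultimately show ?thesis
  proof eventually_elim
    case (elim \<omega>)
    have eq: "strategy n \<omega> = P (Suc n) (\<lambda>a. \<Sum>i<n. estimate i \<omega> a)" for n
      by (simp add: strategy_def cumulative_estimate_eq)
    show ?case
      unfolding eq using elim estimate_stability[of \<omega>, unfolded eq]
      by (intro ftrl_regret[OF _ T a]) blast
  qed
qed

lemma estimate_eq:
  "estimate n \<omega> b = loss_estimate \<T> \<sigma> \<delta> (strategy n \<omega>) (observe (fst (\<omega> n), snd (\<omega> n))) b"
  by (simp add: estimate_def)

lemma move_prob_eq: "move_prob n \<omega> m = pmf (draw_move \<T> \<delta> (strategy n \<omega>)) m"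
  by (simp add: tree_ftrl_eq)

text \<open>The factor on the right is exactly the denominator of the estimate. Hence probability
  times estimate is bounded by the numerator, and integrability follows without a lower bound on the
  masses.\<close>

lemma move_prob_le:
  assumes "(a1, a2, j) \<in> moves"
  shows "move_prob n \<omega> (a1, a2, j) \<le> pmf \<delta> j * M (strategy n \<omega>) (anc \<T> j a1)"
proof -
  let ?p = "strategy n \<omega>"
  have a: "a1 \<in> A" "a2 \<in> A" and j: "j \<in> {1..L}" using assms by (auto simp: moves_def)
  have "pmf ?p a2 \<le> M ?p (anc \<T> (j - 1) a1)" if "same_anc \<T> (j - 1) a2 a1"
  proof -
    have "a2 \<in> leaves_below \<T> (anc \<T> (j - 1) a1)"
      using that a j anc_in_level[OF a(1), of "j - 1"]
      by (subst leaves_below_level[of _ "j - 1"]) (auto simp: same_anc_def)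
    then show ?thesis unfolding mass_def by (intro member_le_sum) auto
  qed
  then have "(if same_anc \<T> (j - 1) a2 a1 then pmf ?p a2 / M ?p (anc \<T> (j - 1) a1) else 0) \<le> 1"
    using M_strategy_pos[of n \<omega> "anc \<T> (j - 1) a1"] by (simp add: divide_le_eq_1)
  then have "pmf ?p a1 * pmf \<delta> j * (if same_anc \<T> (j - 1) a2 a1 then pmf ?p a2 / M ?p (anc \<T> (j - 1) a1) else 0)
      \<le> pmf ?p a1 * pmf \<delta> j * 1"
    by (intro mult_left_mono) auto
  moreover have "pmf ?p a1 \<le> M ?p (anc \<T> j a1)"
    unfolding mass_def using a(1) j anc_in_level[OF a(1), of j]
    by (intro member_le_sum) (auto simp: leaves_below_level[of _ j])
  then have "pmf ?p a1 * pmf \<delta> j \<le> pmf \<delta> j * M ?p (anc \<T> j a1)"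
    by (simp add: mult.commute mult_left_mono)
  moreover have "move_prob n \<omega> (a1, a2, j) = pmf ?p a1 * pmf \<delta> j *
      (if same_anc \<T> (j - 1) a2 a1 then pmf ?p a2 / M ?p (anc \<T> (j - 1) a1) else 0)"
    unfolding move_prob_eq using a j by (intro pmf_draw_move) (auto simp: set_strategy)
  ultimately show ?thesis by simp
qed

section \<open>Expectations of losses, gaps and estimates\<close>

lemma expected_loss:
  assumes n: "n < T"
  shows "integrable G (\<lambda>\<omega>. 1/2 * (loss_at \<omega> n (action1 \<omega> n) + loss_at \<omega> n (action2 \<omega> n)))"
    and "(\<integral>\<omega>. 1/2 * (loss_at \<omega> n (action1 \<omega> n) + loss_at \<omega> n (action2 \<omega> n)) \<partial>G)
      = (\<integral>\<omega>. linear (fst (\<omega> n)) (strategy n \<omega>) \<partial>G)"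
proof -
  define f :: "'v move \<Rightarrow> (nat \<Rightarrow> 'v round) \<times> ('v \<Rightarrow> real) \<Rightarrow> real"
    where "f = (\<lambda>(a1, a2, j) (h, y). 1/2 * (y a1 + y a2))"
  have f_meas: "f m \<in> borel_measurable (history n \<Otimes>\<^sub>M loss_space A)" for m
    unfolding f_def by (cases m) (simp add: split_beta, measurable)
  have f_int: "integrable G (\<lambda>\<omega>. move_prob n \<omega> m * f m (past n \<omega>, fst (\<omega> n)))" if "m \<in> moves" for m
  proof -
    obtain a1 a2 j where m: "m = (a1, a2, j)" by (cases m)
    have "integrable G (\<lambda>\<omega>. f m (past n \<omega>, fst (\<omega> n)))"
      using that integrable_loss[OF n] by (simp add: m f_def moves_def)
    then show ?thesis
    proof (rule Bochner_Integration.integrable_bound)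
      show "AE \<omega> in G. norm (move_prob n \<omega> m * f m (past n \<omega>, fst (\<omega> n))) \<le> norm (f m (past n \<omega>, fst (\<omega> n)))"
        by (simp add: abs_mult mult_left_le_one_le pmf_le_1)
      show "(\<lambda>\<omega>. move_prob n \<omega> m * f m (past n \<omega>, fst (\<omega> n))) \<in> borel_measurable G"
        using f_meas by measurable
    qed
  qed
  have eq: "f (snd (\<omega> n)) (past n \<omega>, fst (\<omega> n)) = 1/2 * (loss_at \<omega> n (action1 \<omega> n) + loss_at \<omega> n (action2 \<omega> n))" for \<omega>
    by (simp add: f_def loss_at_def action1_def action2_def split_beta)
  have avg: "(\<Sum>m\<in>moves. move_prob n \<omega> m * f m (past n \<omega>, fst (\<omega> n))) = linear (fst (\<omega> n)) (strategy n \<omega>)" for \<omega>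
  proof -
    let ?y = "fst (\<omega> n)" and ?w = "pmf (draw_move \<T> \<delta> (strategy n \<omega>))"
    have "(\<Sum>m\<in>moves. move_prob n \<omega> m * f m (past n \<omega>, ?y))
        = 1/2 * ((\<Sum>m\<in>moves. ?w m * (case m of (a1, a2, j) \<Rightarrow> ?y a1)) + (\<Sum>m\<in>moves. ?w m * (case m of (a1, a2, j) \<Rightarrow> ?y a2)))"
      unfolding move_prob_eq sum.distrib[symmetric] sum_distrib_left
      by (intro sum.cong) (auto simp: f_def algebra_simps)
    also have "\<dots> = linear ?y (strategy n \<omega>)"
      using sum_draw_move_first[OF set_strategy M_strategy_pos, of n \<omega> "\<lambda>a _. ?y a"]
        sum_draw_move_second[OF set_strategy M_strategy_pos, of n \<omega> ?y]
      by (simp add: sum_distrib_right[symmetric] sum_\<delta>[simplified] linear_def mult.commute)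
    finally show ?thesis .
  qed
  show "integrable G (\<lambda>\<omega>. 1/2 * (loss_at \<omega> n (action1 \<omega> n) + loss_at \<omega> n (action2 \<omega> n)))"
    using integral_move(1)[OF finite_moves support_moves f_meas f_int] by (simp only: eq)
  show "(\<integral>\<omega>. 1/2 * (loss_at \<omega> n (action1 \<omega> n) + loss_at \<omega> n (action2 \<omega> n)) \<partial>G)
      = (\<integral>\<omega>. linear (fst (\<omega> n)) (strategy n \<omega>) \<partial>G)"
    using integral_move(2)[OF finite_moves support_moves f_meas f_int] by (simp only: eq avg)
qed

lemma expected_gap:
  shows "integrable G (\<lambda>\<omega>. 1/2 * (\<Delta> (action1 \<omega> n) + \<Delta> (action2 \<omega> n)))"
    and "(\<integral>\<omega>. 1/2 * (\<Delta> (action1 \<omega> n) + \<Delta> (action2 \<omega> n)) \<partial>G) = (\<integral>\<omega>. linear \<Delta> (strategy n \<omega>) \<partial>G)"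
proof -
  define f :: "'v move \<Rightarrow> (nat \<Rightarrow> 'v round) \<times> ('v \<Rightarrow> real) \<Rightarrow> real"
    where "f = (\<lambda>(a1, a2, j) _. 1/2 * (\<Delta> a1 + \<Delta> a2))"
  have f_meas: "f m \<in> borel_measurable (history n \<Otimes>\<^sub>M loss_space A)" for m
    unfolding f_def by (cases m) simp
  have f_int: "integrable G (\<lambda>\<omega>. move_prob n \<omega> m * f m (past n \<omega>, fst (\<omega> n)))" for m
  proof (cases m)
    case (fields a1 a2 j)
    have "integrable G (\<lambda>\<omega>. move_prob n \<omega> m)"
      by (rule G.integrable_const_bound[of _ 1]) (auto simp: pmf_le_1)
    then show ?thesis by (simp add: fields f_def)
  qed
  have eq: "f (snd (\<omega> n)) (past n \<omega>, fst (\<omega> n)) = 1/2 * (\<Delta> (action1 \<omega> n) + \<Delta> (action2 \<omega> n))" for \<omega>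
    by (simp add: f_def action1_def action2_def split_beta)
  have avg: "(\<Sum>m\<in>moves. move_prob n \<omega> m * f m (past n \<omega>, fst (\<omega> n))) = linear \<Delta> (strategy n \<omega>)" for \<omega>
  proof -
    let ?w = "pmf (draw_move \<T> \<delta> (strategy n \<omega>))"
    have "(\<Sum>m\<in>moves. move_prob n \<omega> m * f m (past n \<omega>, fst (\<omega> n)))
        = 1/2 * ((\<Sum>m\<in>moves. ?w m * (case m of (a1, a2, j) \<Rightarrow> \<Delta> a1)) + (\<Sum>m\<in>moves. ?w m * (case m of (a1, a2, j) \<Rightarrow> \<Delta> a2)))"
      unfolding move_prob_eq sum.distrib[symmetric] sum_distrib_left
      by (intro sum.cong) (auto simp: f_def algebra_simps)
    also have "\<dots> = linear \<Delta> (strategy n \<omega>)"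
      using sum_draw_move_first[OF set_strategy M_strategy_pos, of n \<omega> "\<lambda>a _. \<Delta> a"]
        sum_draw_move_second[OF set_strategy M_strategy_pos, of n \<omega> \<Delta>]
      by (simp add: sum_distrib_right[symmetric] sum_\<delta>[simplified] linear_def mult.commute)
    finally show ?thesis .
  qed
  show "integrable G (\<lambda>\<omega>. 1/2 * (\<Delta> (action1 \<omega> n) + \<Delta> (action2 \<omega> n)))"
    using integral_move(1)[OF finite_moves support_moves f_meas f_int] by (simp only: eq)
  show "(\<integral>\<omega>. 1/2 * (\<Delta> (action1 \<omega> n) + \<Delta> (action2 \<omega> n)) \<partial>G) = (\<integral>\<omega>. linear \<Delta> (strategy n \<omega>) \<partial>G)"
    using integral_move(2)[OF finite_moves support_moves f_meas f_int] by (simp only: eq avg)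
qed

lemma integrable_linear_loss:
  assumes "n < T"
  shows "integrable G (\<lambda>\<omega>. linear (fst (\<omega> n)) (strategy n \<omega>))"
  unfolding linear_def
proof (intro Bochner_Integration.integrable_sum)
  fix a assume "a \<in> A"
  with assms have int: "integrable G (\<lambda>\<omega>. fst (\<omega> n) a)" by (rule integrable_loss)
  then show "integrable G (\<lambda>\<omega>. fst (\<omega> n) a * pmf (strategy n \<omega>) a)"
  proof (rule Bochner_Integration.integrable_bound)
    show "AE \<omega> in G. norm (fst (\<omega> n) a * pmf (strategy n \<omega>) a) \<le> norm (fst (\<omega> n) a)"
      by (simp add: abs_mult mult_right_le_one_le pmf_le_1)
    show "(\<lambda>\<omega>. fst (\<omega> n) a * pmf (strategy n \<omega>) a) \<in> borel_measurable G"
      using borel_measurable_integrable[OF int] by measurable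
  qed
qed

text \<open>Only the difference between the mixture and a leaf is evaluated: both weight vectors
  have total mass 1, so the part of the mean that does not depend on the leaf drops out.\<close>

lemma expected_estimate:
  assumes n: "n < T" and a: "a \<in> A"
  shows "integrable G (\<lambda>\<omega>. linear (estimate n \<omega>) (strategy n \<omega>) - estimate n \<omega> a)"
    and "(\<integral>\<omega>. linear (estimate n \<omega>) (strategy n \<omega>) - estimate n \<omega> a \<partial>G)
      = (\<integral>\<omega>. linear (fst (\<omega> n)) (strategy n \<omega>) - fst (\<omega> n) a \<partial>G)"
proof -
  let ?i = "\<lambda>b. if b = a then 1 else 0 :: real"
  define f :: "'v move \<Rightarrow> (nat \<Rightarrow> 'v round) \<times> ('v \<Rightarrow> real) \<Rightarrow> real"
    where "f = (\<lambda>m (h, y). \<Sum>b\<in>A. loss_estimate \<T> \<sigma> \<delta> (strategy n h) (observe (y, m)) b * (pmf (strategy n h) b - ?i b))"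
  have f_meas: "f m \<in> borel_measurable (history n \<Otimes>\<^sub>M loss_space A)" for m
  proof -
    have [measurable]: "(\<lambda>x. pmf (strategy n (fst x)) b) \<in> borel_measurable (history n \<Otimes>\<^sub>M loss_space A)" for b
      by (rule measurable_compose[OF measurable_fst measurable_strategy])
    have "(\<lambda>x. observe (snd x, m)) \<in> history n \<Otimes>\<^sub>M loss_space A \<rightarrow>\<^sub>M observation_space"
      by (rule measurable_compose[OF _ measurable_observe[of A]]) (simp add: round_space_def)
    then have [measurable]: "(\<lambda>x. loss_estimate \<T> \<sigma> \<delta> (strategy n (fst x)) (observe (snd x, m)) b)
        \<in> borel_measurable (history n \<Otimes>\<^sub>M loss_space A)" for b
      by (intro measurable_loss_estimate) measurable
    show ?thesis unfolding f_def split_beta by measurable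
  qed
  have f_int: "integrable G (\<lambda>\<omega>. move_prob n \<omega> m * f m (past n \<omega>, fst (\<omega> n)))" if "m \<in> moves" for m
  proof -
    obtain a1 a2 j where m: "m = (a1, a2, j)" by (cases m)
    have a12: "a1 \<in> A" "a2 \<in> A" and j: "j \<in> {1..L}" using that by (auto simp: m moves_def)
    let ?D = "\<lambda>\<omega>. fst (\<omega> n) a1 - fst (\<omega> n) a2 + \<sigma> j"
    have "integrable G (\<lambda>\<omega>. real (card A) * ?D \<omega>)"
      using integrable_loss[OF n] a12 by simp
    then show ?thesis
    proof (rule Bochner_Integration.integrable_bound)
      show "(\<lambda>\<omega>. move_prob n \<omega> m * f m (past n \<omega>, fst (\<omega> n))) \<in> borel_measurable G"
        using f_meas by measurable
      show "AE \<omega> in G. norm (move_prob n \<omega> m * f m (past n \<omega>, fst (\<omega> n))) \<le> norm (real (card A) * ?D \<omega>)"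
      proof (rule AE_I2)
        fix \<omega>
        let ?p = "strategy n \<omega>"
        have "\<bar>move_prob n \<omega> m * (loss_estimate \<T> \<sigma> \<delta> ?p (observe (fst (\<omega> n), m)) b * (pmf ?p b - ?i b))\<bar> \<le> \<bar>?D \<omega>\<bar>" for b
        proof -
          have "\<bar>pmf ?p b - ?i b\<bar> \<le> 1" using pmf_le_1[of ?p b] pmf_nonneg[of ?p b] by auto
          let ?d = "pmf \<delta> j * M ?p (anc \<T> j a1)"
          have d: "0 < ?d" using \<delta>_pos[OF j] M_strategy_pos[of n \<omega>] by simp
          have "\<bar>loss_estimate \<T> \<sigma> \<delta> ?p (observe (fst (\<omega> n), m)) b\<bar> \<le> \<bar>?D \<omega>\<bar> / ?d"
            using \<delta>_pos[OF j] M_strategy_pos[of n \<omega> "anc \<T> j a1"]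
            by (auto simp: m observe_def loss_estimate_def abs_mult)
          then have "move_prob n \<omega> m * \<bar>loss_estimate \<T> \<sigma> \<delta> ?p (observe (fst (\<omega> n), m)) b\<bar> \<le> ?d * (\<bar>?D \<omega>\<bar> / ?d)"
            \<comment> \<open>The denominator \<open>?d\<close> cancels here; what remains is the
              integrable loss difference plus \<open>\<sigma> j\<close>.\<close>
            using move_prob_le[of a1 a2 j n \<omega>] that d by (intro mult_mono) (auto simp: m)
          also have "\<dots> = \<bar>?D \<omega>\<bar>"
            using \<delta>_pos[OF j] M_strategy_pos[of n \<omega> "anc \<T> j a1"] by simp
          finally have "(move_prob n \<omega> m * \<bar>loss_estimate \<T> \<sigma> \<delta> ?p (observe (fst (\<omega> n), m)) b\<bar>) * \<bar>pmf ?p b - ?i b\<bar> \<le> \<bar>?D \<omega>\<bar> * 1"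
            using \<open>\<bar>pmf ?p b - ?i b\<bar> \<le> 1\<close> by (intro mult_mono) auto
          then show ?thesis by (simp add: abs_mult mult.assoc)
        qed
        then have "\<bar>\<Sum>b\<in>A. move_prob n \<omega> m * (loss_estimate \<T> \<sigma> \<delta> ?p (observe (fst (\<omega> n), m)) b * (pmf ?p b - ?i b))\<bar>
            \<le> (\<Sum>b\<in>A. \<bar>?D \<omega>\<bar>)"
          by (intro order.trans[OF sum_abs] sum_mono)
        then show "norm (move_prob n \<omega> m * f m (past n \<omega>, fst (\<omega> n))) \<le> norm (real (card A) * ?D \<omega>)"
          by (simp add: f_def strategy_past sum_distrib_left abs_mult)
      qed
    qed
  qed
  have sum_i: "(\<Sum>b\<in>A. x b * ?i b) = x a" for x :: "'v \<Rightarrow> real"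
    using a by (simp add: if_distrib[of "\<lambda>c. x _ * c"] cong: if_cong)
  have eq: "f (snd (\<omega> n)) (past n \<omega>, fst (\<omega> n)) = linear (estimate n \<omega>) (strategy n \<omega>) - estimate n \<omega> a" for \<omega>
    by (simp only: f_def split_beta fst_conv snd_conv strategy_past estimate_eq linear_def right_diff_distrib sum_subtractf sum_i)
  have avg: "(\<Sum>m\<in>moves. move_prob n \<omega> m * f m (past n \<omega>, fst (\<omega> n)))
      = linear (fst (\<omega> n)) (strategy n \<omega>) - fst (\<omega> n) a" for \<omega>
  proof -
    let ?p = "strategy n \<omega>" and ?y = "fst (\<omega> n)"
    have "(\<Sum>m\<in>moves. move_prob n \<omega> m * f m (past n \<omega>, ?y))
        = (\<Sum>m\<in>moves. \<Sum>b\<in>A. (pmf ?p b - ?i b) * (pmf (draw_move \<T> \<delta> ?p) m * loss_estimate \<T> \<sigma> \<delta> ?p (observe (?y, m)) b))"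
      by (simp only: f_def split_beta fst_conv snd_conv strategy_past move_prob_eq sum_distrib_left mult_ac)
    also have "\<dots> = (\<Sum>b\<in>A. (pmf ?p b - ?i b) * (\<Sum>m\<in>moves. pmf (draw_move \<T> \<delta> ?p) m * loss_estimate \<T> \<sigma> \<delta> ?p (observe (?y, m)) b))"
      unfolding sum_distrib_left by (rule sum.swap)
    also have "\<dots> = (\<Sum>b\<in>A. (pmf ?p b - ?i b) * (?y b - linear ?y ?p + (\<Sum>j=1..L. \<sigma> j)))"
      using sum_draw_move_estimate[OF set_strategy M_strategy_pos] by (intro sum.cong) auto
    also have "\<dots> = (\<Sum>b\<in>A. ?y b * pmf ?p b - ?y b * ?i b + (pmf ?p b - 1 * ?i b) * ((\<Sum>j=1..L. \<sigma> j) - linear ?y ?p))"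
      by (intro sum.cong refl) (simp only: algebra_simps mult_1_left)
    \<comment> \<open>The factor \<open>1 - 1\<close> is the mass of \<open>p\<close> minus the mass
      of the point mass at \<open>a\<close>; it annihilates the common shift.\<close>
    also have "\<dots> = linear ?y ?p - ?y a + (1 - 1) * ((\<Sum>j=1..L. \<sigma> j) - linear ?y ?p)"
      using sum_pmf_leaves[OF set_strategy_subset, of n \<omega>]
      by (simp only: sum.distrib sum_subtractf sum_distrib_right[symmetric] sum_i linear_def)
    finally show ?thesis by simp
  qed
  show "integrable G (\<lambda>\<omega>. linear (estimate n \<omega>) (strategy n \<omega>) - estimate n \<omega> a)"
    using integral_move(1)[OF finite_moves support_moves f_meas f_int] by (simp only: eq)
  show "(\<integral>\<omega>. linear (estimate n \<omega>) (strategy n \<omega>) - estimate n \<omega> a \<partial>G)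
      = (\<integral>\<omega>. linear (fst (\<omega> n)) (strategy n \<omega>) - fst (\<omega> n) a \<partial>G)"
    using integral_move(2)[OF finite_moves support_moves f_meas f_int] by (simp only: eq avg)
qed

section \<open>Expected cost of one round\<close>

lemma stability_bound_nonneg: "j \<in> {1..L} \<Longrightarrow> set_pmf p \<subseteq> A \<Longrightarrow> 0 \<le> stability_bound t p j v"
  unfolding stability_bound_def using scale_pos[of j t]
  by (intro mult_nonneg_nonneg divide_nonneg_nonneg add_nonneg_nonneg sum_nonneg) (auto simp: M_nonneg)

lemma expected_move_stability:
  "(\<Sum>m\<in>moves. move_prob n \<omega> m * move_stability n (strategy n \<omega>) m) + penalty_bound (Suc n) (strategy n \<omega>)
    \<le> round_bound (Suc n) (strategy n \<omega>)"
proof -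
  let ?p = "strategy n \<omega>"
  have "(\<Sum>m\<in>moves. move_prob n \<omega> m * move_stability n ?p m)
      = (\<Sum>j=1..L. pmf \<delta> j * (\<Sum>a\<in>A. pmf ?p a * stability_bound (Suc n) ?p j (anc \<T> j a)))"
    unfolding move_prob_eq move_stability_def by (rule sum_draw_move_first[OF set_strategy M_strategy_pos])
  also have "\<dots> = (\<Sum>j=1..L. pmf \<delta> j * (\<Sum>v\<in>level \<T> j. M ?p v * stability_bound (Suc n) ?p j v))"
  proof (intro sum.cong refl)
    fix j assume j: "j \<in> {1..L}"
    have "(\<Sum>a\<in>A. pmf ?p a * g (anc \<T> j a)) = (\<Sum>v\<in>level \<T> j. M ?p v * g v)" for g
      using sum_mass[of j g "pmf ?p"] j by (simp add: mult.commute)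
    then show "pmf \<delta> j * (\<Sum>a\<in>A. pmf ?p a * stability_bound (Suc n) ?p j (anc \<T> j a))
        = pmf \<delta> j * (\<Sum>v\<in>level \<T> j. M ?p v * stability_bound (Suc n) ?p j v)" by simp
  qed
  finally show ?thesis
    using expected_stability_bound[OF set_strategy_subset M_strategy_pos, of "Suc n" n \<omega>] by simp
qed

lemma move_stability_nonneg: "m \<in> moves \<Longrightarrow> 0 \<le> move_stability n (strategy n \<omega>) m"
  by (auto simp: move_stability_def moves_def intro!: stability_bound_nonneg set_strategy_subset)

lemma sum_move_stability_nonneg:
  "0 \<le> (\<Sum>m\<in>moves. move_prob n \<omega> m * move_stability n (strategy n \<omega>) m)"
  by (intro sum_nonneg mult_nonneg_nonneg move_stability_nonneg) auto

text \<open>Deterministic bounds that secure integrability. Stability average and penalty are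
  nonnegative and together at most \<open>round_bound\<close>, which has a bound independent of the
  path; nonnegativity of \<open>round_bound\<close> comes from the same chain.\<close>

lemma round_bounds_le:
  defines "B \<equiv> \<lambda>n. 2 * sqrt 6 * sqrt (K_eff \<T> L rate) / sqrt (Suc n)"
  shows "\<bar>round_bound (Suc n) (strategy n \<omega>)\<bar> \<le> B n"
    and "\<bar>penalty_bound (Suc n) (strategy n \<omega>)\<bar> \<le> B n"
    and "m \<in> moves \<Longrightarrow> \<bar>move_prob n \<omega> m * move_stability n (strategy n \<omega>) m\<bar> \<le> B n"
proof -
  note bound = expected_move_stability[of n \<omega>] sum_move_stability_nonneg[of n \<omega>]
    penalty_bound_nonneg[OF set_strategy_subset, of "Suc n" n \<omega>]
    round_bound_adversarial[OF set_strategy_subset, of "Suc n" n \<omega>]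
  show "\<bar>round_bound (Suc n) (strategy n \<omega>)\<bar> \<le> B n" using bound unfolding B_def by linarith
  show "\<bar>penalty_bound (Suc n) (strategy n \<omega>)\<bar> \<le> B n" using bound unfolding B_def by linarith
  assume m: "m \<in> moves"
  then have "move_prob n \<omega> m * move_stability n (strategy n \<omega>) m
      \<le> (\<Sum>m\<in>moves. move_prob n \<omega> m * move_stability n (strategy n \<omega>) m)"
    using finite_moves move_stability_nonneg by (intro member_le_sum mult_nonneg_nonneg) auto
  then show "\<bar>move_prob n \<omega> m * move_stability n (strategy n \<omega>) m\<bar> \<le> B n"
    using bound move_stability_nonneg[OF m, of n \<omega>] unfolding B_def by simp
qed

lemma integrable_round_bound: "integrable G (\<lambda>\<omega>. round_bound (Suc n) (strategy n \<omega>))"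
proof (rule G.integrable_const_bound[OF AE_I2])
  show "norm (round_bound (Suc n) (strategy n \<omega>)) \<le> 2 * sqrt 6 * sqrt (K_eff \<T> L rate) / sqrt (Suc n)" for \<omega>
    using round_bounds_le(1) by simp
qed (unfold round_bound_def node_cost_def, measurable)

lemma integrable_penalty_bound: "integrable G (\<lambda>\<omega>. penalty_bound (Suc n) (strategy n \<omega>))"
proof (rule G.integrable_const_bound[OF AE_I2])
  show "norm (penalty_bound (Suc n) (strategy n \<omega>)) \<le> 2 * sqrt 6 * sqrt (K_eff \<T> L rate) / sqrt (Suc n)" for \<omega>
    using round_bounds_le(2) by simp
qed (unfold penalty_bound_def, measurable)

lemma integrable_linear_strategy: "integrable G (\<lambda>\<omega>. linear \<Delta> (strategy n \<omega>))"
  unfolding linear_def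
  by (intro Bochner_Integration.integrable_sum integrable_mult_right G.integrable_const_bound[of _ 1])
     (auto simp: pmf_le_1)

lemma expected_round_cost:
  shows "integrable G (\<lambda>\<omega>. move_stability n (strategy n \<omega>) (snd (\<omega> n)) + penalty_bound (Suc n) (strategy n \<omega>))"
    and "(\<integral>\<omega>. move_stability n (strategy n \<omega>) (snd (\<omega> n)) + penalty_bound (Suc n) (strategy n \<omega>) \<partial>G)
      \<le> (\<integral>\<omega>. round_bound (Suc n) (strategy n \<omega>) \<partial>G)"
proof -
  define f :: "'v move \<Rightarrow> (nat \<Rightarrow> 'v round) \<times> ('v \<Rightarrow> real) \<Rightarrow> real"
    where "f = (\<lambda>m (h, y). move_stability n (strategy n h) m)"
  have f_meas: "f m \<in> borel_measurable (history n \<Otimes>\<^sub>M loss_space A)" for m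
  proof -
    have [measurable]: "(\<lambda>x. M (strategy n (fst x)) v) \<in> borel_measurable (history n \<Otimes>\<^sub>M loss_space A)" for v
      by (rule measurable_compose[OF measurable_fst measurable_M_strategy])
    show ?thesis
      unfolding f_def move_stability_def stability_bound_def by (cases m) (simp add: split_beta)
  qed
  have f_eq: "f m (past n \<omega>, fst (\<omega> n)) = move_stability n (strategy n \<omega>) m" for m \<omega>
    by (simp add: f_def strategy_past)
  have f_int: "integrable G (\<lambda>\<omega>. move_prob n \<omega> m * f m (past n \<omega>, fst (\<omega> n)))" if "m \<in> moves" for m
  proof (rule G.integrable_const_bound[OF AE_I2])
    show "norm (move_prob n \<omega> m * f m (past n \<omega>, fst (\<omega> n))) \<le> 2 * sqrt 6 * sqrt (K_eff \<T> L rate) / sqrt (Suc n)" for \<omega>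
      using round_bounds_le(3)[OF that] by (simp add: f_eq)
  qed (use f_meas in measurable)
  note int = integral_move[OF finite_moves support_moves f_meas f_int, unfolded f_eq]
  show "integrable G (\<lambda>\<omega>. move_stability n (strategy n \<omega>) (snd (\<omega> n)) + penalty_bound (Suc n) (strategy n \<omega>))"
    using int(1) integrable_penalty_bound by simp
  have int_sum: "integrable G (\<lambda>\<omega>. \<Sum>m\<in>moves. move_prob n \<omega> m * move_stability n (strategy n \<omega>) m)"
    using f_int by (simp add: f_eq)
  have "(\<integral>\<omega>. move_stability n (strategy n \<omega>) (snd (\<omega> n)) + penalty_bound (Suc n) (strategy n \<omega>) \<partial>G)
      = (\<integral>\<omega>. (\<Sum>m\<in>moves. move_prob n \<omega> m * move_stability n (strategy n \<omega>) m) + penalty_bound (Suc n) (strategy n \<omega>) \<partial>G)"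
    using int integrable_penalty_bound int_sum by simp
  also have "\<dots> \<le> (\<integral>\<omega>. round_bound (Suc n) (strategy n \<omega>) \<partial>G)"
    using integrable_penalty_bound int_sum integrable_round_bound expected_move_stability
    by (intro integral_mono) auto
  finally show "(\<integral>\<omega>. move_stability n (strategy n \<omega>) (snd (\<omega> n)) + penalty_bound (Suc n) (strategy n \<omega>) \<partial>G)
      \<le> (\<integral>\<omega>. round_bound (Suc n) (strategy n \<omega>) \<partial>G)" .
qed

section \<open>From round costs to the two regret bounds\<close>

lemma regret_le:
  "regret A env (tree_ftrl \<T> L \<sigma> \<delta>) T
    \<le> 12 * sqrt (K_eff \<T> L (\<lambda>j. \<sigma> j / pmf \<delta> j)) + (\<Sum>n<T. \<integral>\<omega>. round_bound (Suc n) (strategy n \<omega>) \<partial>G)"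
proof -
  let ?K = "12 * sqrt (K_eff \<T> L (\<lambda>j. \<sigma> j / pmf \<delta> j))"
  let ?cost = "\<lambda>n \<omega>. move_stability n (strategy n \<omega>) (snd (\<omega> n)) + penalty_bound (Suc n) (strategy n \<omega>)"
  let ?g = "\<lambda>a. \<integral>\<omega>. (\<Sum>n<T. loss_at \<omega> n a) \<partial>G"
  have int_cost: "integrable G (\<lambda>\<omega>. \<Sum>n<T. ?cost n \<omega>)"
    by (rule Bochner_Integration.integrable_sum) (rule expected_round_cost(1))
  have "(MIN a\<in>A. ?g a) \<in> ?g ` A" using leaves_nonempty by (intro Min_in) auto
  \<comment> \<open>The comparator minimises the expected loss and is thus one fixed leaf, to which
    the almost sure bound can be applied.\<close>
  then obtain a where a: "a \<in> A" "(MIN a\<in>A. ?g a) = ?g a" by auto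
  have "regret A env (tree_ftrl \<T> L \<sigma> \<delta>) T
      = (\<Sum>n<T. \<integral>\<omega>. linear (fst (\<omega> n)) (strategy n \<omega>) \<partial>G) - (\<Sum>n<T. \<integral>\<omega>. fst (\<omega> n) a \<partial>G)"
    unfolding regret_def a(2)
    using expected_loss integrable_loss[OF _ a(1)]
    by (subst (1 2) Bochner_Integration.integral_sum) (auto simp: loss_at_def)
  also have "\<dots> = (\<Sum>n<T. \<integral>\<omega>. linear (fst (\<omega> n)) (strategy n \<omega>) - fst (\<omega> n) a \<partial>G)"
    unfolding sum_subtractf[symmetric]
    using integrable_linear_loss integrable_loss[OF _ a(1)] by (intro sum.cong) auto
  also have "\<dots> = (\<Sum>n<T. \<integral>\<omega>. linear (estimate n \<omega>) (strategy n \<omega>) - estimate n \<omega> a \<partial>G)"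
    using expected_estimate(2)[OF _ a(1)] by (intro sum.cong) auto
  also have "\<dots> = (\<integral>\<omega>. (\<Sum>n<T. linear (estimate n \<omega>) (strategy n \<omega>) - estimate n \<omega> a) \<partial>G)"
    using expected_estimate(1)[OF _ a(1)] by (intro Bochner_Integration.integral_sum[symmetric]) auto
  also have "\<dots> \<le> (\<integral>\<omega>. ?K + (\<Sum>n<T. ?cost n \<omega>) \<partial>G)"
  proof (rule integral_mono_AE[OF _ _ AE_ftrl_regret[OF a(1)]])
    show "integrable G (\<lambda>\<omega>. \<Sum>n<T. linear (estimate n \<omega>) (strategy n \<omega>) - estimate n \<omega> a)"
      by (rule Bochner_Integration.integrable_sum, rule expected_estimate(1)[OF _ a(1)]) simp
    show "integrable G (\<lambda>\<omega>. ?K + (\<Sum>n<T. ?cost n \<omega>))"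
      by (rule Bochner_Integration.integrable_add[OF _ int_cost]) simp
  qed
  also have "\<dots> = (\<integral>\<omega>. ?K \<partial>G) + (\<integral>\<omega>. (\<Sum>n<T. ?cost n \<omega>) \<partial>G)"
    by (rule Bochner_Integration.integral_add[OF _ int_cost]) simp
  also have "(\<integral>\<omega>. ?K \<partial>G) = ?K" by (simp add: G.prob_space)
  also have "(\<integral>\<omega>. (\<Sum>n<T. ?cost n \<omega>) \<partial>G) = (\<Sum>n<T. \<integral>\<omega>. ?cost n \<omega> \<partial>G)"
    by (rule Bochner_Integration.integral_sum) (rule expected_round_cost(1))
  also have "?K + (\<Sum>n<T. \<integral>\<omega>. ?cost n \<omega> \<partial>G)
      \<le> ?K + (\<Sum>n<T. \<integral>\<omega>. round_bound (Suc n) (strategy n \<omega>) \<partial>G)"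
    by (intro add_left_mono sum_mono expected_round_cost(2))
  finally show ?thesis .
qed

lemma regret_adversarial:
  "regret A env (tree_ftrl \<T> L \<sigma> \<delta>) T
    \<le> 12 * sqrt (K_eff \<T> L (\<lambda>j. \<sigma> j / pmf \<delta> j)) + 4 * sqrt 6 * sqrt (K_eff \<T> L rate * real T)"
proof -
  let ?c = "2 * sqrt 6 * sqrt (K_eff \<T> L rate)"
  have "(\<integral>\<omega>. round_bound (Suc n) (strategy n \<omega>) \<partial>G) \<le> ?c * (1 / sqrt (real (Suc n)))" for n
    using round_bound_adversarial[OF set_strategy_subset, of "Suc n" n]
    by (intro G.integral_le_const integrable_round_bound AE_I2) simp
  then have "(\<Sum>n<T. \<integral>\<omega>. round_bound (Suc n) (strategy n \<omega>) \<partial>G) \<le> ?c * (\<Sum>n<T. 1 / sqrt (real (Suc n)))"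
    unfolding sum_distrib_left by (intro sum_mono)
  also have "\<dots> \<le> ?c * (2 * sqrt (real T))"
    by (intro mult_left_mono sum_inverse_sqrt_le) (simp add: K_eff_def)
  also have "\<dots> = 4 * sqrt 6 * sqrt (K_eff \<T> L rate * real T)" by (simp add: real_sqrt_mult)
  finally show ?thesis using regret_le by simp
qed

lemma regret_stochastic:
  assumes \<Delta>: "\<And>a. a \<in> A \<Longrightarrow> 0 \<le> \<Delta> a" "card {a \<in> A. \<Delta> a = 0} \<le> 1"
    and gaps: "expected_gaps A env (tree_ftrl \<T> L \<sigma> \<delta>) \<Delta> T \<le> regret A env (tree_ftrl \<T> L \<sigma> \<delta>) T"
  shows "regret A env (tree_ftrl \<T> L \<sigma> \<delta>) T
    \<le> 24 * sqrt (K_eff \<T> L (\<lambda>j. \<sigma> j / pmf \<delta> j)) + 96 * K_eff_sto \<T> L \<Delta> rate * ln (exp 1 * real T)"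
proof -
  let ?r = "\<lambda>n \<omega>. round_bound (Suc n) (strategy n \<omega>)" and ?l = "\<lambda>n \<omega>. linear \<Delta> (strategy n \<omega>)"
  have "expected_gaps A env (tree_ftrl \<T> L \<sigma> \<delta>) \<Delta> T = (\<Sum>n<T. \<integral>\<omega>. ?l n \<omega> \<partial>G)"
    unfolding expected_gaps_def using expected_gap
    by (subst Bochner_Integration.integral_sum) auto
  \<comment> \<open>Twice \<open>regret_le\<close>, minus the regret itself, bounded below by the
    expected gaps; doubling turns 12 into 24.\<close>
  then have "regret A env (tree_ftrl \<T> L \<sigma> \<delta>) T
      \<le> 24 * sqrt (K_eff \<T> L (\<lambda>j. \<sigma> j / pmf \<delta> j)) + (2 * (\<Sum>n<T. \<integral>\<omega>. ?r n \<omega> \<partial>G) - (\<Sum>n<T. \<integral>\<omega>. ?l n \<omega> \<partial>G))"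
    using regret_le gaps by simp
  also have "2 * (\<Sum>n<T. \<integral>\<omega>. ?r n \<omega> \<partial>G) - (\<Sum>n<T. \<integral>\<omega>. ?l n \<omega> \<partial>G)
      = (\<Sum>n<T. \<integral>\<omega>. 2 * ?r n \<omega> - ?l n \<omega> \<partial>G)"
    unfolding sum_distrib_left sum_subtractf[symmetric]
    using integrable_round_bound integrable_linear_strategy by (intro sum.cong) auto
  also have "\<dots> \<le> (\<Sum>n<T. 96 * K_eff_sto \<T> L \<Delta> rate * (1 / real (Suc n)))"
  proof (rule sum_mono)
    fix n
    show "(\<integral>\<omega>. 2 * ?r n \<omega> - ?l n \<omega> \<partial>G) \<le> 96 * K_eff_sto \<T> L \<Delta> rate * (1 / real (Suc n))"
      using round_bound_stochastic[OF set_strategy_subset _ \<Delta>, of "Suc n" n]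
        integrable_round_bound integrable_linear_strategy
      by (intro G.integral_le_const AE_I2 Bochner_Integration.integrable_diff integrable_mult_right) auto
  qed
  also have "\<dots> = 96 * K_eff_sto \<T> L \<Delta> rate * (\<Sum>n<T. 1 / real (Suc n))"
    by (rule sum_distrib_left[symmetric])
  also have "\<dots> \<le> 96 * K_eff_sto \<T> L \<Delta> rate * ln (exp 1 * real T)"
    by (intro mult_left_mono sum_inverse_le_ln T) (simp add: K_eff_sto_def)
  finally show ?thesis by simp
qed

end

theorem theorem3:
  fixes \<T> :: "'v::finite rooted_tree"
    and L T :: nat
    and \<sigma> :: "nat \<Rightarrow> real"
    and \<delta> :: "nat pmf"
    and env :: "'v environment"
  assumes tree: "uniform_tree \<T> L"
    and \<sigma>_antimono: "\<And>i j. 1 \<le> i \<Longrightarrow> i \<le> j \<Longrightarrow> j \<le> L \<Longrightarrow> \<sigma> j \<le> \<sigma> i"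
    and \<sigma>_pos: "\<sigma> L > 0"
    and \<sigma>_last: "\<sigma> (L + 1) = 0"
    and \<delta>_support: "set_pmf \<delta> = {1..L}"
    and env: "is_environment (leaves \<T>) env"
    and compatible: "tree_compatible_environment \<T> L \<sigma> env"
    and integrable: "integrable_losses (leaves \<T>) env (tree_ftrl \<T> L \<sigma> \<delta>) T"
    and T: "T \<ge> 1"
  shows
    "regret (leaves \<T>) env (tree_ftrl \<T> L \<sigma> \<delta>) T
       \<le> 18 * sqrt (K_eff \<T> L (\<lambda>j. \<sigma> j / pmf \<delta> j))
         + 8 * sqrt 6 * sqrt (K_eff \<T> L (\<lambda>j. \<sigma> j / sqrt (pmf \<delta> j)) * real T)
     \<and> (\<forall>\<Delta>.
          (\<forall>a\<in>leaves \<T>. \<Delta> a \<ge> 0) \<and>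
          card {a \<in> leaves \<T>. \<Delta> a = 0} \<le> 1 \<and>
          (\<forall>\<pi>. is_algorithm (leaves \<T>) \<pi> \<and> integrable_losses (leaves \<T>) env \<pi> T \<longrightarrow>
             regret (leaves \<T>) env \<pi> T \<ge> expected_gaps (leaves \<T>) env \<pi> \<Delta> T)
          \<longrightarrow> regret (leaves \<T>) env (tree_ftrl \<T> L \<sigma> \<delta>) T
                \<le> 36 * sqrt (K_eff \<T> L (\<lambda>j. \<sigma> j / pmf \<delta> j))
                  + 96 * K_eff_sto \<T> L \<Delta> (\<lambda>j. \<sigma> j / sqrt (pmf \<delta> j)) * ln (exp 1 * real T))"
proof -
  interpret tree_game \<T> L \<sigma> \<delta> env T
    by unfold_locales (use assms in auto)
  have pos: "0 \<le> sqrt (K_eff \<T> L r)" for r by (simp add: K_eff_def)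
  have rate_eq: "rate = (\<lambda>j. \<sigma> j / sqrt (pmf \<delta> j))" by (simp add: rate_def fun_eq_iff)
  show ?thesis
  proof (intro conjI allI impI; (elim conjE)?)
    \<comment> \<open>The bound obtained has 12 and \<open>4 * sqrt 6\<close> where 18 and
      \<open>8 * sqrt 6\<close> are claimed; nonnegativity of both quantities closes the
      difference.\<close>
    have "0 \<le> sqrt 6 * sqrt (K_eff \<T> L rate * real T)" by (simp add: K_eff_def)
    then show "regret (leaves \<T>) env (tree_ftrl \<T> L \<sigma> \<delta>) T
        \<le> 18 * sqrt (K_eff \<T> L (\<lambda>j. \<sigma> j / pmf \<delta> j))
          + 8 * sqrt 6 * sqrt (K_eff \<T> L (\<lambda>j. \<sigma> j / sqrt (pmf \<delta> j)) * real T)"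
      using regret_adversarial pos[of "\<lambda>j. \<sigma> j / pmf \<delta> j"] unfolding rate_eq by linarith
  next
    fix \<Delta> :: "'v \<Rightarrow> real"
    assume \<Delta>: "\<forall>a\<in>leaves \<T>. \<Delta> a \<ge> 0" "card {a \<in> leaves \<T>. \<Delta> a = 0} \<le> 1"
      and gaps: "\<forall>\<pi>. is_algorithm (leaves \<T>) \<pi> \<and> integrable_losses (leaves \<T>) env \<pi> T \<longrightarrow>
             regret (leaves \<T>) env \<pi> T \<ge> expected_gaps (leaves \<T>) env \<pi> \<Delta> T"
    \<comment> \<open>The gap inequality is instantiated with the learner's own algorithm, which is
      what makes its regret bound itself.\<close>
    have "expected_gaps (leaves \<T>) env (tree_ftrl \<T> L \<sigma> \<delta>) \<Delta> T
        \<le> regret (leaves \<T>) env (tree_ftrl \<T> L \<sigma> \<delta>) T"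
      using gaps is_algorithm_tree_ftrl integrable_losses by blast
    then have "regret (leaves \<T>) env (tree_ftrl \<T> L \<sigma> \<delta>) T
        \<le> 24 * sqrt (K_eff \<T> L (\<lambda>j. \<sigma> j / pmf \<delta> j)) + 96 * K_eff_sto \<T> L \<Delta> rate * ln (exp 1 * real T)"
      using regret_stochastic \<Delta> by blast
    then show "regret (leaves \<T>) env (tree_ftrl \<T> L \<sigma> \<delta>) T
        \<le> 36 * sqrt (K_eff \<T> L (\<lambda>j. \<sigma> j / pmf \<delta> j))
          + 96 * K_eff_sto \<T> L \<Delta> (\<lambda>j. \<sigma> j / sqrt (pmf \<delta> j)) * ln (exp 1 * real T)"
      using pos[of "\<lambda>j. \<sigma> j / pmf \<delta> j"] unfolding rate_eq by linarith
  qed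
qed

end
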